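(* There is no universal test for ITRM-c-randomness: the union $U$ of all ITRM-decidable meager sets of reals is not ITRM-decidable.
   Context: Reals are subsets of $\omega$ (identified with elements of ${}^\omega 2$). An infinite time register machine (ITRM) has finitely many registers, each holding a natural number, and runs a finite register-machine program in transfinite ordinal time; with an oracle $x\subseteq\omega$ it may test whether the content of a register belongs to $x$. At successor times it acts as an ordinary register machine; at limit times the active program line is the $\liminf$ of the earlier program lines, and each register holds the $\liminf$ of its earlier contents if that is finite, and $0$ otherwise. $P^x\downarrow=i$ means program $P$ run with oracle $x$ halts with output $i$. A set $X$ of reals is ITRM-decidable iff there is a program $P$ such that for all reals $z$: $P^{z}\downarrow=1$ if $z\in X$ and $P^{z}\downarrow=0$ if $z\notin X$. A real is ITRM-c-random iff it belongs to no meager ITRM-decidable set of reals. *)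

theory Defs
  imports "HOL-Analysis.Analysis"
begin

text \<open>Reals are elements of Cantor space nat => bool (= subsets of omega), with the
product topology of the discrete space bool.\<close>

type_synonym creal = "nat \<Rightarrow> bool"

text \<open>Register machine instructions (Koepke style). Registers are indexed by nat;
a program only mentions finitely many of them.\<close>
datatype instr =
    Zero nat
  | Inc nat
  | Copy nat nat
  | Jump nat nat nat
  | Oracle nat

type_synonym program = "instr list"

text \<open>Configuration: (active program line, register contents).
The machine has halted once the active line is \<ge> length of the program.\<close>
type_synonym config = "nat \<times> (nat \<Rightarrow> nat)"

fun exec :: "creal \<Rightarrow> instr \<Rightarrow> config \<Rightarrow> config" where
  "exec x (Zero n) (l, R) = (Suc l, R(n := 0))"
| "exec x (Inc n) (l, R) = (Suc l, R(n := Suc (R n)))"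
| "exec x (Copy m n) (l, R) = (Suc l, R(n := R m))"
| "exec x (Jump m n q) (l, R) = (if R m = R n then q else Suc l, R)"
| "exec x (Oracle n) (l, R) = (Suc l, R(n := (if x (R n) then 1 else 0)))"

definition step :: "program \<Rightarrow> creal \<Rightarrow> config \<Rightarrow> config" where
  "step P x c = (if fst c < length P then exec x (P ! fst c) c else c)"

text \<open>Time is indexed by the field of a well-order W (an ordinal).\<close>
definition wlt :: "('a \<times> 'a) set \<Rightarrow> 'a \<Rightarrow> 'a \<Rightarrow> bool" where
  "wlt W a b \<longleftrightarrow> (a, b) \<in> W \<and> a \<noteq> b"

definition is_ipred :: "('a \<times> 'a) set \<Rightarrow> 'a \<Rightarrow> 'a \<Rightarrow> bool" where
  "is_ipred W b a \<longleftrightarrow> wlt W b a \<and> (\<forall>g. (b, g) \<in> W \<and> (g, a) \<in> W \<longrightarrow> g = b \<or> g = a)"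

definition cofinal_val :: "('a \<times> 'a) set \<Rightarrow> 'a \<Rightarrow> ('a \<Rightarrow> nat) \<Rightarrow> nat \<Rightarrow> bool" where
  "cofinal_val W a f k \<longleftrightarrow> (\<forall>g. wlt W g a \<longrightarrow> (\<exists>b. (g, b) \<in> W \<and> wlt W b a \<and> f b = k))"

text \<open>For natural-number valued f and a limit point a, the liminf of f below a is the
least value attained cofinally often (if there is one); if the liminf is infinite
(no value attained cofinally often) the result is 0, as required by the ITRM limit rule.\<close>
definition liminf0 :: "('a \<times> 'a) set \<Rightarrow> 'a \<Rightarrow> ('a \<Rightarrow> nat) \<Rightarrow> nat" where
  "liminf0 W a f = (if \<exists>k. cofinal_val W a f k then LEAST k. cofinal_val W a f k else 0)"

definition limit_config :: "('a \<times> 'a) set \<Rightarrow> 'a \<Rightarrow> ('a \<Rightarrow> config) \<Rightarrow> config" where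
  "limit_config W a c = (liminf0 W a (\<lambda>b. fst (c b)), \<lambda>n. liminf0 W a (\<lambda>b. snd (c b) n))"

definition itrm_run :: "('a \<times> 'a) set \<Rightarrow> ('a \<Rightarrow> config) \<Rightarrow> program \<Rightarrow> creal \<Rightarrow> bool" where
  "itrm_run W c P x \<longleftrightarrow> Well_order W \<and>
     (\<forall>a\<in>Field W.
        (if (\<forall>b\<in>Field W. (a, b) \<in> W) then c a = (0, \<lambda>_. 0)
         else if (\<exists>b. is_ipred W b a) then c a = step P x (c (THE b. is_ipred W b a))
         else c a = limit_config W a c)) \<and>
     (\<forall>a\<in>Field W. \<forall>b\<in>Field W. wlt W b a \<longrightarrow> fst (c b) < length P)"

text \<open>P^x halts with output i (output = content of register 0 at halting time).
Halting times of ITRMs are countable ordinals, so well-orders on the type nat set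
(of size continuum) represent all possible halting times.\<close>
definition halts_with :: "program \<Rightarrow> creal \<Rightarrow> nat \<Rightarrow> bool" where
  "halts_with P x i \<longleftrightarrow> (\<exists>(W :: (nat set \<times> nat set) set) c. itrm_run W c P x \<and>
      (\<exists>e\<in>Field W. (\<forall>a\<in>Field W. (a, e) \<in> W) \<and> length P \<le> fst (c e) \<and> snd (c e) 0 = i))"

definition itrm_decidable :: "creal set \<Rightarrow> bool" where
  "itrm_decidable X \<longleftrightarrow> (\<exists>P. \<forall>z. (z \<in> X \<longrightarrow> halts_with P z 1) \<and> (z \<notin> X \<longrightarrow> halts_with P z 0))"

definition nowhere_dense :: "'a::topological_space set \<Rightarrow> bool" where
  "nowhere_dense A \<longleftrightarrow> interior (closure A) = {}"

definition meager :: "'a::topological_space set \<Rightarrow> bool" where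
  "meager A \<longleftrightarrow> (\<exists>F :: nat \<Rightarrow> 'a set. (\<forall>n. nowhere_dense (F n)) \<and> A \<subseteq> (\<Union>n. F n))"

end

theory Submission
  imports Defs "HOL-Library.List_Lexorder"
begin

text \<open>Suppose that \<open>P\<close> decides the union \<open>U\<close>. Halting runs are unique, so there are only countably many decidable
  sets, and \<open>U\<close> is meager. In a halting run of a program with \<open>N\<close> registers, overflows are nested to depth at
  most \<open>N + 1\<close>, so \<open>P\<close> halting with output \<open>0\<close> is expressible by finitely many nested inductive definitions over
  the oracle. ITRMs decide sets defined in this way, because they can search trees for infinite branches, and
  therefore they also decide the corresponding forcing relation for Cohen reals. Hence there is a decidable
  real \<open>x\<close> that is generic enough for the truth of ``\<open>P\<close> halts with output \<open>0\<close>'' to be decided by an initial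
  segment. Now \<open>{x}\<close> is decidable and nowhere dense, so \<open>x\<close> lies in \<open>U\<close> and \<open>P\<close> does not output \<open>0\<close> on \<open>x\<close>. This is
  forced by an initial segment of \<open>x\<close>, although by Baire category that segment also extends to a generic real
  outside \<open>U\<close>, on which \<open>P\<close> does output \<open>0\<close>.\<close>

subsection \<open>Runs assembled from single steps and limits of countable sequences\<close>

text \<open>Forcing cannot follow a transfinite computation whose oracle is known only in part, so
  the run must be described by a formula. The hard case of their forcing theorem is the fixed point:
  a premise that is forced only further along the generic real might be forced at a later stage, and
  induction on stages would break down. Hence genericity is also demanded for a stage comparison,
  which is decidable because it is an inductive definition itself. In the description of a run,
  limits with finite registers need no nesting: the limit vector is guessed, and \<open>j\<close>
  returns to it are required for every \<open>j\<close>, which is positive information. An overflow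
  is negative information, as no value recurs cofinally; it can be expressed only after the
  reachable part below it is completely defined, and so costs one more fixed point. A coordinate
  that overflows at a limit is positive close below it and cannot overflow there, so the number of
  fixed points depends on \<open>P\<close> alone and not on the oracle.\<close>

definition inf0 :: "(nat \<Rightarrow> nat set) \<Rightarrow> nat" where
  "inf0 X = (if \<exists>k. \<exists>\<^sub>\<infinity>i. k \<in> X i then LEAST k. \<exists>\<^sub>\<infinity>i. k \<in> X i else 0)"

text \<open>When omega many segments are concatenated, a value is attained cofinally below the limit
  iff it occurs in infinitely many segments. So the sets of visited configurations suffice, and the
  order and length of the single segments can be forgotten.\<close>

definition limc :: "(nat \<Rightarrow> config set) \<Rightarrow> config" where
  "limc V = (inf0 (\<lambda>i. fst ` V i), \<lambda>r. inf0 (\<lambda>i. (\<lambda>q. snd q r) ` V i))"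

text \<open>The set argument of \<open>run\<close> consists of the configurations visited before the last one.\<close>

inductive run :: "program \<Rightarrow> creal \<Rightarrow> config \<Rightarrow> config set \<Rightarrow> config \<Rightarrow> bool" for P z where
  run_step: "fst c < length P \<Longrightarrow> run P z c {c} (step P z c)"
| run_trans: "run P z c V d \<Longrightarrow> run P z d V' e \<Longrightarrow> run P z c (V \<union> V') e"
| run_lim: "(\<And>i. run P z (c i) (V i) (c (Suc i))) \<Longrightarrow> run P z (c 0) (\<Union>i. V i) (limc V)"

lemma run_start: "run P z c V d \<Longrightarrow> c \<in> V"
  by (induction rule: run.induct) auto

definition cofin :: "'t::linorder set \<Rightarrow> ('t \<Rightarrow> nat) \<Rightarrow> nat \<Rightarrow> bool" where
  "cofin B f k \<longleftrightarrow> (\<forall>g\<in>B. \<exists>b\<in>B. g \<le> b \<and> f b = k)"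

definition lim0 :: "'t::linorder set \<Rightarrow> ('t \<Rightarrow> nat) \<Rightarrow> nat" where
  "lim0 B f = (if \<exists>k. cofin B f k then LEAST k. cofin B f k else 0)"

text \<open>The start, successor and limit clauses of a run merged into one function of the set
  \<open>B\<close> of earlier times. It depends only on final segments of \<open>B\<close> and is
  invariant under order isomorphism, which is all that cutting and gluing of runs requires.\<close>

definition cnext :: "program \<Rightarrow> creal \<Rightarrow> 't::linorder set \<Rightarrow> ('t \<Rightarrow> config) \<Rightarrow> config \<Rightarrow> config" where
  "cnext P z B f c =
    (if B = {} then c
     else if \<exists>m\<in>B. \<forall>b\<in>B. b \<le> m then step P z (f (THE m. m \<in> B \<and> (\<forall>b\<in>B. b \<le> m)))
     else (lim0 B (fst \<circ> f), \<lambda>r. lim0 B (\<lambda>b. snd (f b) r)))"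

lemma lim0_cong: "(\<And>k. cofin B f k \<longleftrightarrow> cofin B' g k) \<Longrightarrow> lim0 B f = lim0 B' g"
  unfolding lim0_def by presburger

lemma cnext_max: "m \<in> B \<Longrightarrow> \<forall>b\<in>B. b \<le> m \<Longrightarrow> cnext P z B f c = step P z (f m)"
proof -
  assume m: "m \<in> B" "\<forall>b\<in>B. b \<le> m"
  then have "(THE m. m \<in> B \<and> (\<forall>b\<in>B. b \<le> m)) = m"
    by (intro the_equality) (auto intro: antisym)
  then show ?thesis using m unfolding cnext_def by auto
qed

lemma cnext_lim: "B \<noteq> {} \<Longrightarrow> \<not> (\<exists>m\<in>B. \<forall>b\<in>B. b \<le> m) \<Longrightarrow>
    cnext P z B f c = (lim0 B (\<lambda>b. fst (f b)), \<lambda>r. lim0 B (\<lambda>b. snd (f b) r))"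
  unfolding cnext_def by (simp only: if_False comp_def)

lemma cnext_empty [simp]: "cnext P z {} f c = c"
  by (simp add: cnext_def)

lemma cofin_image:
  assumes "strict_mono_on B h"
  shows "cofin (h ` B) f k \<longleftrightarrow> cofin B (f \<circ> h) k"
  unfolding cofin_def using strict_mono_on_leD[OF assms] strict_mono_on_less_eq[OF assms] by auto

lemma cofin_final:
  assumes "B' \<subseteq> B" "B' \<noteq> {}" "\<And>b b'. b \<in> B - B' \<Longrightarrow> b' \<in> B' \<Longrightarrow> b < b'"
  shows "cofin B f k \<longleftrightarrow> cofin B' f k"
proof
  assume *: "cofin B f k"
  show "cofin B' f k"
    unfolding cofin_def
  proof
    fix g assume g: "g \<in> B'"
    then obtain b where b: "b \<in> B" "g \<le> b" "f b = k" using * assms(1) unfolding cofin_def by blast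
    then have "b \<in> B'" using assms(3) g by (meson DiffI leD)
    then show "\<exists>b\<in>B'. g \<le> b \<and> f b = k" using b by blast
  qed
next
  assume *: "cofin B' f k"
  show "cofin B f k"
    unfolding cofin_def
  proof
    fix g assume g: "g \<in> B"
    obtain b' where b': "b' \<in> B'" using assms(2) by blast
    show "\<exists>b\<in>B. g \<le> b \<and> f b = k"
    proof (cases "g \<in> B'")
      case True
      then show ?thesis using * assms(1) unfolding cofin_def by blast
    next
      case False
      then have "g < b'" using g b' assms(3) by blast
      then show ?thesis using * b' assms(1) unfolding cofin_def
        by (meson less_le_trans less_imp_le subsetD)
    qed
  qed
qed

text \<open>A maximum and the values attained cofinally can be read off any nonempty final segment,
  so the configuration after a concatenation is determined by its last piece.\<close>

lemma cnext_final:
  assumes "B' \<subseteq> B" "B' \<noteq> {}" "\<And>b b'. b \<in> B - B' \<Longrightarrow> b' \<in> B' \<Longrightarrow> b < b'"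
  shows "cnext P z B f c = cnext P z B' f c'"
proof (cases "\<exists>m\<in>B'. \<forall>b\<in>B'. b \<le> m")
  case True
  then obtain m where m: "m \<in> B'" "\<forall>b\<in>B'. b \<le> m" by blast
  then have "m \<in> B" "\<forall>b\<in>B. b \<le> m" using assms by (auto, meson DiffI less_imp_le)
  then show ?thesis using m by (simp add: cnext_max)
next
  case False
  have "\<not> (\<exists>m\<in>B. \<forall>b\<in>B. b \<le> m)"
  proof
    assume "\<exists>m\<in>B. \<forall>b\<in>B. b \<le> m"
    then obtain m where m: "m \<in> B" "\<forall>b\<in>B. b \<le> m" by blast
    have "m \<in> B'"
    proof (rule ccontr)
      assume "m \<notin> B'"
      then show False using m assms by (meson DiffI ex_in_conv leD subsetD)
    qed
    then show False using False m assms(1) by blast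
  qed
  moreover have "lim0 B g = lim0 B' g" for g
    by (rule lim0_cong) (rule cofin_final[OF assms])
  moreover have "B \<noteq> {}" using assms by blast
  ultimately show ?thesis using False assms(2) by (simp only: cnext_lim not_False_eq_True)
qed

lemma cnext_image:
  assumes "strict_mono_on B h"
  shows "cnext P z (h ` B) f c = cnext P z B (f \<circ> h) c"
proof (cases "\<exists>m\<in>B. \<forall>b\<in>B. b \<le> m")
  case True
  then obtain m where m: "m \<in> B" "\<forall>b\<in>B. b \<le> m" by blast
  then have "h m \<in> h ` B" "\<forall>b\<in>h ` B. b \<le> h m" using strict_mono_on_leD[OF assms] by auto
  then show ?thesis using m by (simp add: cnext_max)
next
  case False
  then have "\<not> (\<exists>m\<in>h ` B. \<forall>b\<in>h ` B. b \<le> m)"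
    using strict_mono_on_less_eq[OF assms] by auto
  moreover have "lim0 (h ` B) g = lim0 B (g \<circ> h)" for g
    by (rule lim0_cong) (rule cofin_image[OF assms])
  ultimately show ?thesis using False
    by (cases "B = {}") (simp_all only: cnext_lim image_is_empty not_False_eq_True comp_def image_empty cnext_empty)
qed

text \<open>A run is realised along a well-ordered set of times without last point; finite lists of
  naturals under the lexicographic order are closed under ordered sums indexed by the naturals.\<close>

definition timeline :: "program \<Rightarrow> creal \<Rightarrow> nat list set \<Rightarrow> (nat list \<Rightarrow> config) \<Rightarrow> config \<Rightarrow> bool" where
  "timeline P z A f c \<longleftrightarrow> A \<noteq> {} \<and> (\<forall>B\<subseteq>A. B \<noteq> {} \<longrightarrow> (\<exists>m\<in>B. \<forall>b\<in>B. m \<le> b)) \<and>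
     (\<forall>a\<in>A. fst (f a) < length P \<and> f a = cnext P z {b\<in>A. b < a} f c)"

definition tsum :: "nat set \<Rightarrow> (nat \<Rightarrow> nat list set) \<Rightarrow> nat list set" where
  "tsum I A = {i # a | i a. i \<in> I \<and> a \<in> A i}"

definition fsum :: "(nat \<Rightarrow> nat list \<Rightarrow> config) \<Rightarrow> nat list \<Rightarrow> config" where
  "fsum f l = f (hd l) (tl l)"

lemma Cons_strict_mono: "strict_mono_on B ((#) (i::nat))"
  by (auto simp: strict_mono_on_def)

text \<open>With the index of the summand in front of each time, the lexicographic order is the
  ordered sum. A time with predecessors in its own summand depends on these alone; the first time of
  summand \<open>Suc j\<close> has summand \<open>j\<close> as a final segment below it, and
  \<open>nx\<close> says that this produces the start configuration
  \<open>c (Suc j)\<close>.\<close>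

lemma timeline_tsum:
  assumes tl: "\<And>i. i \<in> I \<Longrightarrow> timeline P z (A i) (f i) (c i)"
    and nx: "\<And>i. Suc i \<in> I \<Longrightarrow> cnext P z (A i) (f i) (c i) = c (Suc i)"
    and I: "0 \<in> I" "\<And>i. Suc i \<in> I \<Longrightarrow> i \<in> I"
  shows "timeline P z (tsum I A) (fsum f) (c 0)"
proof -
  have ne: "A i \<noteq> {}" if "i \<in> I" for i using tl[OF that] by (auto simp: timeline_def)
  have "tsum I A \<noteq> {}" using ne I unfolding tsum_def by blast
  moreover have "\<exists>m\<in>B. \<forall>b\<in>B. m \<le> b" if B: "B \<subseteq> tsum I A" "B \<noteq> {}" for B
  proof -
    define n where "n = (LEAST i. \<exists>a. i # a \<in> B)"
    have "\<exists>i a. i # a \<in> B" using B unfolding tsum_def by blast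
    then have n: "\<exists>a. n # a \<in> B" unfolding n_def by (rule LeastI_ex)
    have n_le: "n \<le> i" if "i # a \<in> B" for i a
      unfolding n_def using that by (blast intro: Least_le)
    define B' where "B' = {a. n # a \<in> B}"
    have "n \<in> I" "B' \<subseteq> A n" "B' \<noteq> {}" using n B unfolding B'_def tsum_def by auto
    then obtain m where m: "m \<in> B'" "\<forall>b\<in>B'. m \<le> b" using tl unfolding timeline_def by meson
    have "n # m \<le> b" if b: "b \<in> B" for b
    proof -
      obtain i a where ia: "b = i # a" using b B unfolding tsum_def by blast
      then have "n \<le> i" using b n_le by blast
      then show ?thesis using m b ia unfolding B'_def
        by (cases "n = i") (auto simp: less_le)
    qed
    then show ?thesis using m unfolding B'_def by blast
  qed
  moreover have "fst (fsum f t) < length P \<and> fsum f t = cnext P z {b \<in> tsum I A. b < t} (fsum f) (c 0)"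
    if t: "t \<in> tsum I A" for t
  proof -
    obtain i a where ia: "t = i # a" "i \<in> I" "a \<in> A i" using t unfolding tsum_def by blast
    have fa: "fst (f i a) < length P" "f i a = cnext P z {b \<in> A i. b < a} (f i) (c i)"
      using tl[OF ia(2)] ia(3) unfolding timeline_def by auto
    have seg: "cnext P z ((#) j ` B) (fsum f) e = cnext P z B (f j) e" for j B e
      by (subst cnext_image[OF Cons_strict_mono]) (simp add: comp_def fsum_def)
    have eq: "cnext P z {b \<in> tsum I A. b < t} (fsum f) (c 0) = f i a"
    proof (cases "{b \<in> A i. b < a} = {}")
      case False
      have "cnext P z {b \<in> tsum I A. b < t} (fsum f) (c 0)
          = cnext P z ((#) i ` {b \<in> A i. b < a}) (fsum f) (c i)"
        by (rule cnext_final) (use False ia in \<open>auto simp: tsum_def\<close>)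
      then show ?thesis using seg fa by simp
    next
      case True
      show ?thesis
      proof (cases i)
        case 0
        then have "{b \<in> tsum I A. b < t} = {}" using True ia by (auto simp: tsum_def)
        then show ?thesis using fa True 0 by (simp add: cnext_def)
      next
        case (Suc j)
        then have j: "j \<in> I" using I ia by auto
        have "cnext P z {b \<in> tsum I A. b < t} (fsum f) (c 0) = cnext P z ((#) j ` A j) (fsum f) (c j)"
          by (rule cnext_final) (use True ia Suc j ne[OF j] in \<open>auto simp: tsum_def less_Suc_eq\<close>)
        then show ?thesis using seg fa nx Suc ia True by (simp only: cnext_empty)
      qed
    qed
    then show ?thesis using fa ia by (simp add: fsum_def)
  qed
  ultimately show ?thesis unfolding timeline_def by blast
qed

lemma run_timeline:
  "run P z c V d \<Longrightarrow> \<exists>A f. timeline P z A f c \<and> V = f ` A \<and> d = cnext P z A f c"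
proof (induction rule: run.induct)
  case (run_step c)
  have "timeline P z {[] :: nat list} (\<lambda>_. c) c"
    unfolding timeline_def
    using run_step by (auto simp: cnext_def)
  moreover have "cnext P z {[] :: nat list} (\<lambda>_. c) c = step P z c" by (subst cnext_max[of "[]"]) auto
  ultimately show ?case by (intro exI[of _ "{[]}"] exI[of _ "\<lambda>_. c"]) simp
next
  case (run_trans c V d V' e)
  then obtain A f A' f' where
    A: "timeline P z A f c" "V = f ` A" "d = cnext P z A f c" and
    A': "timeline P z A' f' d" "V' = f' ` A'" "e = cnext P z A' f' d" by blast
  define B where "B i = (if i = 0 then A else A')" for i :: nat
  define g where "g i = (if i = 0 then f else f')" for i :: nat
  define h where "h i = (if i = 0 then c else d)" for i :: nat
  have 1: "timeline P z (tsum {0,1} B) (fsum g) (h 0)"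
    by (rule timeline_tsum) (use A A' in \<open>auto simp: B_def g_def h_def\<close>)
  have ne: "A' \<noteq> {}" using A' by (auto simp: timeline_def)
  have "cnext P z (tsum {0,1} B) (fsum g) c = cnext P z ((#) 1 ` A') (fsum g) d"
    by (rule cnext_final) (use ne in \<open>auto simp: tsum_def B_def split: if_splits\<close>)
  also have "\<dots> = e"
    by (subst cnext_image[OF Cons_strict_mono]) (simp add: comp_def fsum_def g_def A')
  finally have 2: "cnext P z (tsum {0,1} B) (fsum g) c = e" .
  have "tsum {0,1} B = (#) 0 ` A \<union> (#) 1 ` A'"
    unfolding tsum_def B_def by auto
  then have 3: "fsum g ` (tsum {0,1} B) = V \<union> V'"
    using A A' by (simp add: image_Un image_image fsum_def g_def)
  show ?case using 1 2 3 by (intro exI[of _ "tsum {0,1} B"] exI[of _ "fsum g"]) (auto simp: h_def)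
next
  case (run_lim c V)
  then obtain A f where A: "\<And>i. timeline P z (A i) (f i) (c i)" "\<And>i. V i = f i ` A i"
      "\<And>i. c (Suc i) = cnext P z (A i) (f i) (c i)"
    by metis
  let ?T = "tsum UNIV A"
  have 1: "timeline P z ?T (fsum f) (c 0)"
    by (rule timeline_tsum) (use A in auto)
  have ne: "A i \<noteq> {}" for i using A(1)[of i] by (auto simp: timeline_def)
  have 2: "fsum f ` ?T = (\<Union>i. V i)"
    unfolding tsum_def A(2) by (force simp: fsum_def image_iff)
  have nomax: "\<not> (\<exists>m\<in>?T. \<forall>b\<in>?T. b \<le> m)"
  proof
    assume "\<exists>m\<in>?T. \<forall>b\<in>?T. b \<le> m"
    then obtain i a where ia: "\<forall>b\<in>?T. b \<le> i # a" unfolding tsum_def by blast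
    obtain a' where "a' \<in> A (Suc i)" using ne by blast
    then have "Suc i # a' \<in> ?T" by (auto simp: tsum_def)
    then show False using ia by fastforce
  qed
  have cf: "cofin ?T (\<lambda>b. h (fsum f b)) k \<longleftrightarrow> (\<exists>\<^sub>\<infinity>i. k \<in> h ` V i)" for h k
  proof
    assume *: "cofin ?T (\<lambda>b. h (fsum f b)) k"
    show "\<exists>\<^sub>\<infinity>i. k \<in> h ` V i"
      unfolding INFM_nat_le
    proof
      fix m
      obtain a where "a \<in> A m" using ne by blast
      then have "m # a \<in> ?T" by (auto simp: tsum_def)
      then obtain b where b: "b \<in> ?T" "m # a \<le> b" "h (fsum f b) = k" using * unfolding cofin_def by blast
      then obtain i a' where "b = i # a'" "a' \<in> A i" unfolding tsum_def by blast
      with b have "m \<le> i" "k \<in> h ` V i" by (auto simp: A(2) fsum_def)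
      then show "\<exists>n\<ge>m. k \<in> h ` V n" by blast
    qed
  next
    assume *: "\<exists>\<^sub>\<infinity>i. k \<in> h ` V i"
    show "cofin ?T (\<lambda>b. h (fsum f b)) k"
      unfolding cofin_def
    proof
      fix g assume "g \<in> ?T"
      then obtain i a where g: "g = i # a" unfolding tsum_def by blast
      obtain j where j: "j > i" "k \<in> h ` V j" using * unfolding INFM_nat by blast
      then obtain a' where a': "a' \<in> A j" "k = h (f j a')" by (auto simp: A(2))
      then have "j # a' \<in> ?T" "g \<le> j # a'" "h (fsum f (j # a')) = k"
        using j g by (auto simp: tsum_def fsum_def)
      then show "\<exists>b\<in>?T. g \<le> b \<and> h (fsum f b) = k" by blast
    qed
  qed
  have "?T \<noteq> {}" using 1 by (auto simp: timeline_def)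
  then have "cnext P z ?T (fsum f) (c 0) =
      (lim0 ?T (\<lambda>b. fst (fsum f b)), \<lambda>r. lim0 ?T (\<lambda>b. snd (fsum f b) r))"
    by (rule cnext_lim[OF _ nomax])
  also have "\<dots> = limc V"
    unfolding limc_def inf0_def lim0_def cf[of fst] cf[of "\<lambda>q. snd q _"] ..
  finally have 3: "cnext P z ?T (fsum f) (c 0) = limc V" .
  show ?case using 1 2 3 by (intro exI[of _ ?T] exI[of _ "fsum f"]) auto
qed

section \<open>From sets of times to runs over a well-order on \<open>nat set\<close>\<close>

definition rel_of :: "'t::linorder set \<Rightarrow> ('t \<times> 't) set" where
  "rel_of A = {(a, b). a \<in> A \<and> b \<in> A \<and> a \<le> b}"

lemma Field_rel_of: "Field (rel_of A) = A"
  by (auto simp: rel_of_def Field_def)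

lemma wlt_rel_of: "wlt (rel_of A) a b \<longleftrightarrow> a \<in> A \<and> b \<in> A \<and> a < b"
  by (auto simp: rel_of_def wlt_def)

lemma Well_order_rel_of:
  assumes "\<forall>B\<subseteq>A. B \<noteq> {} \<longrightarrow> (\<exists>m\<in>B. \<forall>b\<in>B. m \<le> b)"
  shows "Well_order (rel_of A)"
proof -
  have "wf (rel_of A - Id)"
  proof (rule wfI_min)
    fix x Q assume "x \<in> (Q :: 'a set)"
    show "\<exists>z\<in>Q. \<forall>y. (y, z) \<in> rel_of A - Id \<longrightarrow> y \<notin> Q"
    proof (cases "Q \<inter> A = {}")
      case True
      then show ?thesis using \<open>x \<in> Q\<close> by (auto simp: rel_of_def)
    next
      case False
      then obtain m where "m \<in> Q \<inter> A" "\<forall>b\<in>Q \<inter> A. m \<le> b" using assms by (meson Int_lower2)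
      then show ?thesis by (intro bexI[of _ m]) (auto simp: rel_of_def intro: antisym)
    qed
  qed
  then show ?thesis
    unfolding well_order_on_def linear_order_on_def partial_order_on_def preorder_on_def Field_rel_of
    by (auto simp: rel_of_def refl_on_def trans_def antisym_def total_on_def)
qed

lemma is_ipred_rel_of:
  "is_ipred (rel_of A) b a \<longleftrightarrow> a \<in> A \<and> b \<in> {b\<in>A. b < a} \<and> (\<forall>g\<in>{b\<in>A. b < a}. g \<le> b)"
  unfolding is_ipred_def wlt_rel_of by (force simp: rel_of_def)

lemma itrm_run_rel_of:
  assumes wo: "\<forall>B\<subseteq>A. B \<noteq> {} \<longrightarrow> (\<exists>m\<in>B. \<forall>b\<in>B. m \<le> b)"
    and loc: "\<And>a. a \<in> A \<Longrightarrow> f a = cnext P z {b\<in>A. b < a} f (0, \<lambda>_. 0)"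
    and unh: "\<And>a b. a \<in> A \<Longrightarrow> b \<in> A \<Longrightarrow> b < a \<Longrightarrow> fst (f b) < length P"
  shows "itrm_run (rel_of A) f P z"
proof -
  have "(if (\<forall>b\<in>A. (a, b) \<in> rel_of A) then f a = (0, \<lambda>_. 0)
         else if (\<exists>b. is_ipred (rel_of A) b a) then f a = step P z (f (THE b. is_ipred (rel_of A) b a))
         else f a = limit_config (rel_of A) a f)" if a: "a \<in> A" for a
  proof -
    let ?B = "{b\<in>A. b < a}"
    have 1: "(\<forall>b\<in>A. (a, b) \<in> rel_of A) \<longleftrightarrow> ?B = {}"
      using a by (auto simp: rel_of_def not_less[symmetric])
    have cv: "cofinal_val (rel_of A) a h k \<longleftrightarrow> cofin ?B h k" for h k
      unfolding cofinal_val_def wlt_rel_of cofin_def using a by (auto simp: rel_of_def)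
    have "liminf0 (rel_of A) a h = lim0 ?B h" for h
      unfolding liminf0_def lim0_def cv ..
    then have 2: "limit_config (rel_of A) a f = (lim0 ?B (fst \<circ> f), \<lambda>r. lim0 ?B (\<lambda>b. snd (f b) r))"
      unfolding limit_config_def by (simp add: comp_def)
    have 3: "is_ipred (rel_of A) b a \<longleftrightarrow> b \<in> ?B \<and> (\<forall>g\<in>?B. g \<le> b)" for b
      using a is_ipred_rel_of by blast
    show ?thesis unfolding 1 2 3 using loc[OF a] unfolding cnext_def by auto
  qed
  then show ?thesis
    unfolding itrm_run_def Field_rel_of wlt_rel_of
    using Well_order_rel_of[OF wo, unfolded Field_rel_of] unh by blast
qed

lemma Field_map_prod_image: "Field (map_prod h h ` W) = h ` Field W"
  by (force simp: Field_def Domain_iff Range_iff image_iff)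

text \<open>\<open>halts_with\<close> fixes \<open>nat set\<close> as the type of times, whereas
  runs are built on lists; being a run is invariant under injective renaming of times.\<close>

lemma itrm_run_transfer:
  assumes h: "inj h" and r: "itrm_run W c P z"
  shows "itrm_run (map_prod h h ` W) (c \<circ> inv h) P z"
proof -
  define W' where "W' = map_prod h h ` W"
  have mem: "(h a, h b) \<in> W' \<longleftrightarrow> (a, b) \<in> W" for a b
    unfolding W'_def using h by (auto dest: injD intro: rev_image_eqI)
  have F: "Field W' = h ` Field W" unfolding W'_def by (rule Field_map_prod_image)
  have wl: "wlt W' (h a) (h b) \<longleftrightarrow> wlt W a b" for a b
    unfolding wlt_def mem using h by (auto dest: injD)
  have rng: "x \<in> range h" if "(x, y) \<in> W' \<or> (y, x) \<in> W'" for x y using that unfolding W'_def by auto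
  have ip: "is_ipred W' x (h a) \<longleftrightarrow> (\<exists>b. x = h b \<and> is_ipred W b a)" for x a
  proof
    assume *: "is_ipred W' x (h a)"
    then obtain b where b: "x = h b" using rng unfolding is_ipred_def wlt_def by blast
    have "is_ipred W b a" using * unfolding is_ipred_def b wl by (metis mem inj_eq[OF h])
    then show "\<exists>b. x = h b \<and> is_ipred W b a" using b by blast
  next
    assume "\<exists>b. x = h b \<and> is_ipred W b a"
    then obtain b where b: "x = h b" "is_ipred W b a" by blast
    show "is_ipred W' x (h a)" unfolding is_ipred_def b(1) wl
    proof (intro conjI allI impI)
      show "wlt W b a" using b(2) by (simp add: is_ipred_def)
      fix g assume g: "(h b, g) \<in> W' \<and> (g, h a) \<in> W'"
      then obtain g' where "g = h g'" using rng by blast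
      then show "g = h b \<or> g = h a" using b(2) g mem by (auto simp: is_ipred_def)
    qed
  qed
  have W: "Well_order W" using r by (simp add: itrm_run_def)
  then have W_refl: "refl_on (Field W) W" and W_trans: "trans W" and W_antisym: "antisym W"
    and W_total: "total_on (Field W) W" and W_wf: "wf (W - Id)"
    by (simp_all add: well_order_on_def linear_order_on_def partial_order_on_def preorder_on_def)
  have cv: "cofinal_val W' (h a) (\<lambda>b. g (inv h b)) k \<longleftrightarrow> cofinal_val W a g k" for a g k
  proof
    assume *: "cofinal_val W' (h a) (\<lambda>b. g (inv h b)) k"
    show "cofinal_val W a g k" unfolding cofinal_val_def
    proof (intro allI impI)
      fix x assume "wlt W x a"
      then obtain b where b: "(h x, b) \<in> W'" "wlt W' b (h a)" "g (inv h b) = k"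
        using * wl unfolding cofinal_val_def by blast
      then obtain b' where "b = h b'" using rng by blast
      then show "\<exists>b. (x, b) \<in> W \<and> wlt W b a \<and> g b = k" using b mem wl h by auto
    qed
  next
    assume *: "cofinal_val W a g k"
    show "cofinal_val W' (h a) (\<lambda>b. g (inv h b)) k" unfolding cofinal_val_def
    proof (intro allI impI)
      fix x assume x: "wlt W' x (h a)"
      then obtain x' where x': "x = h x'" using rng unfolding wlt_def by blast
      then obtain b where "(x', b) \<in> W" "wlt W b a" "g b = k" using * x wl unfolding cofinal_val_def by blast
      then show "\<exists>b. (x, b) \<in> W' \<and> wlt W' b (h a) \<and> g (inv h b) = k"
        using x' mem wl h by (intro exI[of _ "h b"]) auto
    qed
  qed
  have the: "(THE x. \<exists>b. x = h b \<and> is_ipred W b a) = h (THE b. is_ipred W b a)"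
    if ba: "is_ipred W b a" for a b
  proof -
    have uni: "b' = b" if b'a: "is_ipred W b' a" for b'
    proof (rule ccontr)
      assume ne: "b' \<noteq> b"
      have F: "b \<in> Field W" "b' \<in> Field W" and lt: "(b, a) \<in> W" "b \<noteq> a" "(b', a) \<in> W" "b' \<noteq> a"
        using ba b'a unfolding is_ipred_def wlt_def by (blast intro: FieldI1)+
      from W_total F ne have "(b, b') \<in> W \<or> (b', b) \<in> W"
        by (simp add: total_on_def)
      then show False
      proof
        assume "(b, b') \<in> W"
        then have "b' = b \<or> b' = a" using ba lt(3) unfolding is_ipred_def by blast
        then show False using ne lt by simp
      next
        assume "(b', b) \<in> W"
        then have "b = b' \<or> b = a" using b'a lt(1) unfolding is_ipred_def by blast
        then show False using ne lt by simp
      qed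
    qed
    have "(THE b. is_ipred W b a) = b" by (rule the_equality) (use ba uni in blast)+
    moreover have "(THE x. \<exists>b. x = h b \<and> is_ipred W b a) = h b"
      by (rule the_equality) (use ba uni in blast)+
    ultimately show ?thesis by simp
  qed
  have "Well_order W'"
  proof -
    have "well_order_on (Field W') W'"
      unfolding well_order_on_def linear_order_on_def partial_order_on_def preorder_on_def
    proof (intro conjI)
      show "refl_on (Field W') W'" using W_refl unfolding F refl_on_def by (auto simp: mem)
      show "trans W'" unfolding trans_def
      proof (intro allI impI)
        fix x y zz assume *: "(x, y) \<in> W'" "(y, zz) \<in> W'"
        then obtain a b d where "x = h a" "y = h b" "zz = h d" using rng by blast
        then show "(x, zz) \<in> W'" using * mem transD[OF W_trans] by auto
      qed
      show "antisym W'" unfolding antisym_def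
      proof (intro allI impI)
        fix x y assume *: "(x, y) \<in> W'" "(y, x) \<in> W'"
        then obtain a b where "x = h a" "y = h b" using rng by blast
        then show "x = y" using * mem antisymD[OF W_antisym] by auto
      qed
      show "total_on (Field W') W'" using W_total unfolding F total_on_def by (auto simp: mem)
      have "W' - Id = map_prod h h ` (W - Id)" unfolding W'_def using h by (auto simp: image_iff dest: injD)
      then show "wf (W' - Id)" using wf_map_prod_image[OF W_wf h] by simp
      show "W' \<subseteq> Field W' \<times> Field W'" by (auto simp: Field_def)
    qed
    then show ?thesis .
  qed
  moreover have loc: "(if (\<forall>b\<in>Field W'. (h a, b) \<in> W') then (c \<circ> inv h) (h a) = (0, \<lambda>_. 0)
         else if (\<exists>b. is_ipred W' b (h a)) then (c \<circ> inv h) (h a) = step P z ((c \<circ> inv h) (THE b. is_ipred W' b (h a)))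
         else (c \<circ> inv h) (h a) = limit_config W' (h a) (c \<circ> inv h))" if a: "a \<in> Field W" for a
  proof -
    have 1: "(\<forall>b\<in>Field W'. (h a, b) \<in> W') \<longleftrightarrow> (\<forall>b\<in>Field W. (a, b) \<in> W)"
      unfolding F by (auto simp: mem)
    have 2: "limit_config W' (h a) (c \<circ> inv h) = limit_config W a c"
      unfolding limit_config_def liminf0_def comp_def
      cv[of _ "\<lambda>b. fst (c b)"] cv[of _ "\<lambda>b. snd (c b) _"] ..
    have 3: "(if (\<forall>b\<in>Field W. (a, b) \<in> W) then c a = (0, \<lambda>_. 0)
         else if (\<exists>b. is_ipred W b a) then c a = step P z (c (THE b. is_ipred W b a))
         else c a = limit_config W a c)" using r a unfolding itrm_run_def by blast
    have ex: "(\<exists>x b. x = h b \<and> is_ipred W b a) \<longleftrightarrow> (\<exists>b. is_ipred W b a)" by blast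
    have inv: "(c \<circ> inv h) (h x) = c x" for x using h by simp
    show ?thesis
    proof (cases "\<exists>b. is_ipred W b a")
      case True
      then obtain b where "is_ipred W b a" by blast
      then show ?thesis unfolding 1 2 ip ex inv the[OF \<open>is_ipred W b a\<close>] using 3 by simp
    next
      case False
      then show ?thesis unfolding 1 2 ip ex inv using 3 by simp
    qed
  qed
  moreover have unh: "fst ((c \<circ> inv h) (h b)) < length P"
    if "a \<in> Field W" "b \<in> Field W" "wlt W' (h b) (h a)" for a b
    using that r h by (simp add: itrm_run_def wl)
  ultimately show ?thesis
    unfolding W'_def[symmetric] itrm_run_def
  proof (intro conjI ballI impI)
    fix a assume "a \<in> Field W'"
    then obtain a' where "a = h a'" "a' \<in> Field W" unfolding F by blast
    then show "if \<forall>b\<in>Field W'. (a, b) \<in> W' then (c \<circ> inv h) a = (0, \<lambda>_. 0)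
         else if \<exists>b. is_ipred W' b a then (c \<circ> inv h) a = step P z ((c \<circ> inv h) (THE b. is_ipred W' b a))
         else (c \<circ> inv h) a = limit_config W' a (c \<circ> inv h)"
      using loc by blast
  next
    fix a b assume "a \<in> Field W'" "b \<in> Field W'" "wlt W' b a"
    then show "fst ((c \<circ> inv h) b) < length P" using unh unfolding F by blast
  qed
qed

text \<open>Putting \<open>0\<close> in front of all times makes room for a last time
  \<open>[1]\<close>, which carries the halting configuration. Singletons of list codes then embed
  the times into \<open>nat set\<close>.\<close>

lemma run_halts_with:
  assumes r: "run P z (0, \<lambda>_. 0) V d" and d: "length P \<le> fst d"
  shows "halts_with P z (snd d 0)"
proof -
  obtain A f where A: "timeline P z A f (0, \<lambda>_. 0)" "d = cnext P z A f (0, \<lambda>_. 0)"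
    using run_timeline[OF r] by blast
  let ?B = "(#) 0 ` A"
  let ?A = "insert [1] ?B"
  define g where "g l = (if l = [1] then d else f (tl l))" for l
  have lt: "b < [1]" if "b \<in> ?B" for b using that by auto
  have n1: "[1] \<notin> ?B" by auto
  have cn: "cnext P z ((#) 0 ` B) g e = cnext P z B f e" for B e
    by (subst cnext_image[OF Cons_strict_mono]) (simp add: comp_def g_def)
  have loc: "g a = cnext P z {b\<in>?A. b < a} g (0, \<lambda>_. 0)" if a: "a \<in> ?A" for a
  proof (cases "a = [1]")
    case True
    have "{b\<in>?A. b < [1]} = ?B" by auto
    then show ?thesis using True cn A by (simp add: g_def)
  next
    case False
    then obtain a' where a': "a = 0 # a'" "a' \<in> A" using a by auto
    have "{b\<in>?A. b < a} = (#) 0 ` {b\<in>A. b < a'}" using a' by auto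
    then show ?thesis using a' A cn unfolding timeline_def by (simp add: g_def)
  qed
  have wo: "\<forall>B\<subseteq>?A. B \<noteq> {} \<longrightarrow> (\<exists>m\<in>B. \<forall>b\<in>B. m \<le> b)"
  proof (intro allI impI)
    fix B assume B: "B \<subseteq> ?A" "B \<noteq> {}"
    define B' where "B' = {a. 0 # a \<in> B}"
    have B'A: "B' \<subseteq> A" using B by (auto simp: B'_def)
    show "\<exists>m\<in>B. \<forall>b\<in>B. m \<le> b"
    proof (cases "B' = {}")
      case True
      then have "B = {[1]}" using B by (auto simp: B'_def)
      then show ?thesis by auto
    next
      case False
      then obtain m where m: "m \<in> B'" "\<forall>b\<in>B'. m \<le> b" using A(1) B'A unfolding timeline_def by meson
      have "0 # m \<le> b" if "b \<in> B" for b
        using that B m by (auto simp: B'_def less_le)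
      then show ?thesis using m by (auto simp: B'_def)
    qed
  qed
  have unh: "fst (g b) < length P" if "a \<in> ?A" "b \<in> ?A" "b < a" for a b
  proof -
    have "b \<in> ?B" using that lt by (metis insertE less_asym less_irrefl)
    then show ?thesis using A(1) unfolding timeline_def g_def by auto
  qed
  have R: "itrm_run (rel_of ?A) g P z" by (rule itrm_run_rel_of) (fact wo loc unh)+
  define h where "h l = {list_encode l}" for l :: "nat list"
  have h: "inj h" unfolding h_def inj_def by (simp add: list_encode_eq)
  have R': "itrm_run (map_prod h h ` rel_of ?A) (g \<circ> inv h) P z"
    by (rule itrm_run_transfer[OF h R])
  have F: "Field (map_prod h h ` rel_of ?A) = h ` ?A"
    by (simp only: Field_map_prod_image Field_rel_of)
  have top: "\<forall>a\<in>h ` ?A. (a, h [1]) \<in> map_prod h h ` rel_of ?A"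
  proof
    fix a assume "a \<in> h ` ?A"
    then obtain b where b: "a = h b" "b \<in> ?A" by blast
    then have "b \<le> [1]" using lt by (metis insertE less_imp_le order_refl)
    then have "(b, [1]) \<in> rel_of ?A" using b by (simp add: rel_of_def)
    then show "(a, h [1]) \<in> map_prod h h ` rel_of ?A" using b by (metis map_prod_imageI)
  qed
  have gd: "(g \<circ> inv h) (h [1]) = d" using h by (simp add: g_def)
  have mem: "h [1] \<in> Field (map_prod h h ` rel_of ?A)" unfolding F by blast
  show ?thesis
    unfolding halts_with_def
    by (intro exI[of _ "map_prod h h ` rel_of ?A"] exI[of _ "g \<circ> inv h"] conjI
        bexI[of _ "h [1]", OF _ mem] R' top[folded F]) (simp_all only: gd d)
qed

subsection \<open>Structured programs\<close>

datatype com = Bas instr | Seq com com (infixr ";;" 60) | IfE nat nat com com | Whl nat nat com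

text \<open>\<open>IfE m n a b\<close> runs \<open>a\<close> if registers \<open>m\<close> and \<open>n\<close> agree; \<open>Whl m n a\<close> loops as long as they differ.
  The loop head is the least line of the loop, so it is the active line at every limit of iterations.\<close>

fun csz :: "com \<Rightarrow> nat" where
  "csz (Bas i) = 1"
| "csz (a ;; b) = csz a + csz b"
| "csz (IfE m n a b) = 2 + csz a + csz b"
| "csz (Whl m n a) = 2 + csz a"

text \<open>\<open>Jump 0 0 l\<close> is the unconditional jump, since a register agrees with
  itself. A conditional falls through to its else branch, and the code of the then branch stands
  last.\<close>

fun cmp :: "com \<Rightarrow> nat \<Rightarrow> instr list" where
  "cmp (Bas i) l = [i]"
| "cmp (a ;; b) l = cmp a l @ cmp b (l + csz a)"
| "cmp (IfE m n a b) l =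
     Jump m n (l + 2 + csz b) # cmp b (l + 1) @ Jump 0 0 (l + 2 + csz a + csz b) # cmp a (l + 2 + csz b)"
| "cmp (Whl m n a) l = Jump m n (l + 2 + csz a) # cmp a (l + 1) @ [Jump 0 0 l]"

lemma length_cmp [simp]: "length (cmp c l) = csz c"
  by (induction c arbitrary: l) auto

definition code_at :: "program \<Rightarrow> nat \<Rightarrow> instr list \<Rightarrow> bool" where
  "code_at P l xs \<longleftrightarrow> (\<exists>pre post. P = pre @ xs @ post \<and> length pre = l)"

lemma code_at_append: "code_at P l (xs @ ys) \<Longrightarrow> code_at P l xs \<and> code_at P (l + length xs) ys"
  unfolding code_at_def
proof (elim exE conjE, intro conjI)
  fix pre post assume P: "P = pre @ (xs @ ys) @ post" "length pre = l"
  show "\<exists>pre post. P = pre @ xs @ post \<and> length pre = l"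
    using P by (intro exI[of _ pre] exI[of _ "ys @ post"]) simp
  show "\<exists>pre post. P = pre @ ys @ post \<and> length pre = l + length xs"
    using P by (intro exI[of _ "pre @ xs"] exI[of _ post]) simp
qed

lemma code_at_Cons: "code_at P l (x # xs) \<Longrightarrow> P ! l = x \<and> l < length P \<and> code_at P (Suc l) xs"
proof -
  assume *: "code_at P l (x # xs)"
  then have 1: "code_at P (Suc l) xs" using code_at_append[of P l "[x]" xs] by simp
  obtain pre post where "P = pre @ (x # xs) @ post" "length pre = l" using * unfolding code_at_def by blast
  then have "P ! l = x" "l < length P" by auto
  then show ?thesis using 1 by blast
qed

text \<open>All visited configurations are confined, not only the last one. Limits of loop
  iterations need both confinements: that of the lines to identify the loop head as liminf, that of
  the states to bound the registers from below.\<close>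

definition ex :: "program \<Rightarrow> creal \<Rightarrow> nat \<Rightarrow> com \<Rightarrow> (nat \<Rightarrow> nat) \<Rightarrow> (nat \<Rightarrow> nat) set \<Rightarrow> (nat \<Rightarrow> nat) \<Rightarrow> bool" where
  "ex P z l c \<sigma> S \<tau> \<longleftrightarrow> (\<exists>V. run P z (l, \<sigma>) V (l + csz c, \<tau>) \<and> V \<subseteq> {l..<l + csz c} \<times> S)"

lemma run_exec: "P ! l = i \<Longrightarrow> l < length P \<Longrightarrow> run P z (l, \<sigma>) {(l, \<sigma>)} (exec z i (l, \<sigma>))"
  using run_step[of "(l, \<sigma>)" P z] by (simp add: step_def)

lemma ex_mono: "ex P z l c \<sigma> S \<tau> \<Longrightarrow> S \<subseteq> S' \<Longrightarrow> ex P z l c \<sigma> S' \<tau>"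
  unfolding ex_def by (meson Sigma_mono order_trans order_refl)

lemma ex_Seq: "ex P z l a \<sigma> S \<rho> \<Longrightarrow> ex P z (l + csz a) b \<rho> S \<tau> \<Longrightarrow> ex P z l (a ;; b) \<sigma> S \<tau>"
proof -
  assume "ex P z l a \<sigma> S \<rho>" "ex P z (l + csz a) b \<rho> S \<tau>"
  then obtain V V' where V: "run P z (l, \<sigma>) V (l + csz a, \<rho>)" "V \<subseteq> {l..<l + csz a} \<times> S"
    "run P z (l + csz a, \<rho>) V' (l + csz a + csz b, \<tau>)" "V' \<subseteq> {l + csz a..<l + csz a + csz b} \<times> S"
    unfolding ex_def by blast
  have "run P z (l, \<sigma>) (V \<union> V') (l + csz (a ;; b), \<tau>)"
    using run_trans[OF V(1,3)] by (simp add: add.assoc)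
  moreover have "V \<union> V' \<subseteq> {l..<l + csz (a ;; b)} \<times> S" using V(2,4) by fastforce
  ultimately show ?thesis unfolding ex_def by blast
qed

fun nojump :: "instr \<Rightarrow> bool" where
  "nojump (Jump m n q) = False"
| "nojump _ = True"

lemma ex_Bas:
  assumes "code_at P l (cmp (Bas i) l)" "nojump i" "\<sigma> \<in> S"
  shows "ex P z l (Bas i) \<sigma> S (snd (exec z i (0, \<sigma>)))"
proof -
  have "run P z (l, \<sigma>) {(l, \<sigma>)} (exec z i (l, \<sigma>))"
    using assms(1) by (intro run_exec) (auto dest: code_at_Cons)
  moreover have "exec z i (l, \<sigma>) = (l + csz (Bas i), snd (exec z i (0, \<sigma>)))"
    using assms(2) by (cases i) auto
  ultimately show ?thesis using assms(3) unfolding ex_def by (intro exI[of _ "{(l, \<sigma>)}"]) auto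
qed

lemma code_at_IfE:
  assumes "code_at P l (cmp (IfE m n a b) l)"
  shows "P ! l = Jump m n (l + 2 + csz b)" "l < length P" "code_at P (Suc l) (cmp b (Suc l))"
    "P ! (l + 1 + csz b) = Jump 0 0 (l + 2 + csz a + csz b)" "l + 1 + csz b < length P"
    "code_at P (l + 2 + csz b) (cmp a (l + 2 + csz b))"
proof -
  have 1: "P ! l = Jump m n (l + 2 + csz b) \<and> l < length P \<and> code_at P (Suc l)
     (cmp b (Suc l) @ Jump 0 0 (l + 2 + csz a + csz b) # cmp a (l + 2 + csz b))"
    using code_at_Cons[of P l] assms by simp
  have 2: "code_at P (Suc l) (cmp b (Suc l)) \<and>
     code_at P (Suc l + csz b) (Jump 0 0 (l + 2 + csz a + csz b) # cmp a (l + 2 + csz b))"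
    using 1 code_at_append[of P "Suc l" "cmp b (Suc l)", unfolded length_cmp] by blast
  have 3: "P ! (Suc l + csz b) = Jump 0 0 (l + 2 + csz a + csz b) \<and> Suc l + csz b < length P \<and>
      code_at P (Suc (Suc l + csz b)) (cmp a (l + 2 + csz b))"
    using 2 code_at_Cons by blast
  show "P ! l = Jump m n (l + 2 + csz b)" "l < length P" "code_at P (Suc l) (cmp b (Suc l))"
    "P ! (l + 1 + csz b) = Jump 0 0 (l + 2 + csz a + csz b)" "l + 1 + csz b < length P"
    "code_at P (l + 2 + csz b) (cmp a (l + 2 + csz b))"
    using 1 2 3 by simp_all
qed

lemma code_at_Whl:
  assumes "code_at P l (cmp (Whl m n a) l)"
  shows "P ! l = Jump m n (l + 2 + csz a)" "l < length P" "code_at P (Suc l) (cmp a (Suc l))"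
    "P ! (l + 1 + csz a) = Jump 0 0 l" "l + 1 + csz a < length P"
proof -
  have 1: "P ! l = Jump m n (l + 2 + csz a) \<and> l < length P \<and> code_at P (Suc l)
     (cmp a (Suc l) @ [Jump 0 0 l])"
    using code_at_Cons[of P l] assms by simp
  have 2: "code_at P (Suc l) (cmp a (Suc l)) \<and> code_at P (Suc l + csz a) [Jump 0 0 l]"
    using 1 code_at_append[of P "Suc l" "cmp a (Suc l)", unfolded length_cmp] by blast
  have 3: "P ! (Suc l + csz a) = Jump 0 0 l \<and> Suc l + csz a < length P"
    using 2 code_at_Cons by blast
  show "P ! l = Jump m n (l + 2 + csz a)" "l < length P" "code_at P (Suc l) (cmp a (Suc l))"
    "P ! (l + 1 + csz a) = Jump 0 0 l" "l + 1 + csz a < length P"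
    using 1 2 3 by simp_all
qed

lemma ex_IfE_eq:
  assumes c: "code_at P l (cmp (IfE m n a b) l)" and "\<sigma> m = \<sigma> n" "\<sigma> \<in> S"
    and a: "ex P z (l + 2 + csz b) a \<sigma> S \<tau>"
  shows "ex P z l (IfE m n a b) \<sigma> S \<tau>"
proof -
  obtain V where V: "run P z (l + 2 + csz b, \<sigma>) V (l + 2 + csz b + csz a, \<tau>)"
     "V \<subseteq> {l + 2 + csz b..<l + 2 + csz b + csz a} \<times> S" using a unfolding ex_def by blast
  have "run P z (l, \<sigma>) {(l, \<sigma>)} (l + 2 + csz b, \<sigma>)"
    using run_exec[OF code_at_IfE(1,2)[OF c], of z \<sigma>] assms(2) by simp
  then have "run P z (l, \<sigma>) ({(l, \<sigma>)} \<union> V) (l + csz (IfE m n a b), \<tau>)"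
    using run_trans V(1) by (fastforce simp: ac_simps)
  moreover have "{(l, \<sigma>)} \<union> V \<subseteq> {l..<l + csz (IfE m n a b)} \<times> S" using V(2) assms(3) by fastforce
  ultimately show ?thesis unfolding ex_def by blast
qed

lemma ex_IfE_neq:
  assumes c: "code_at P l (cmp (IfE m n a b) l)" and "\<sigma> m \<noteq> \<sigma> n" "\<sigma> \<in> S" "\<tau> \<in> S"
    and b: "ex P z (Suc l) b \<sigma> S \<tau>"
  shows "ex P z l (IfE m n a b) \<sigma> S \<tau>"
proof -
  obtain V where V: "run P z (Suc l, \<sigma>) V (l + 1 + csz b, \<tau>)"
     "V \<subseteq> {Suc l..<Suc l + csz b} \<times> S" using b unfolding ex_def by auto
  have 1: "run P z (l, \<sigma>) {(l, \<sigma>)} (Suc l, \<sigma>)"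
    using run_exec[OF code_at_IfE(1,2)[OF c], of z \<sigma>] assms(2) by simp
  have 2: "run P z (l + 1 + csz b, \<tau>) {(l + 1 + csz b, \<tau>)} (l + csz (IfE m n a b), \<tau>)"
    using run_exec[OF code_at_IfE(4,5)[OF c], of z \<tau>] by (simp add: ac_simps)
  have "run P z (l, \<sigma>) ({(l, \<sigma>)} \<union> V \<union> {(l + 1 + csz b, \<tau>)}) (l + csz (IfE m n a b), \<tau>)"
    using run_trans[OF run_trans[OF 1 V(1)] 2] .
  moreover have "{(l, \<sigma>)} \<union> V \<union> {(l + 1 + csz b, \<tau>)} \<subseteq> {l..<l + csz (IfE m n a b)} \<times> S"
    using V(2) assms(3,4) by fastforce
  ultimately show ?thesis unfolding ex_def by blast
qed

lemma ex_Whl_exit: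
  assumes c: "code_at P l (cmp (Whl m n a) l)" and "\<sigma> m = \<sigma> n" "\<sigma> \<in> S"
  shows "ex P z l (Whl m n a) \<sigma> S \<sigma>"
proof -
  have "run P z (l, \<sigma>) {(l, \<sigma>)} (l + csz (Whl m n a), \<sigma>)"
    using run_exec[OF code_at_Whl(1,2)[OF c], of z \<sigma>] assms(2) by simp
  then show ?thesis using assms(3) unfolding ex_def by (intro exI[of _ "{(l, \<sigma>)}"]) auto
qed

text \<open>Runs from loop head to loop head. Register \<open>F\<close> serves as a limit detector: it is required to
  vanish at some point of the segment, hence it is \<open>0\<close> at limits.\<close>

definition hr :: "program \<Rightarrow> creal \<Rightarrow> nat \<Rightarrow> com \<Rightarrow> (nat \<Rightarrow> nat) set \<Rightarrow> nat \<Rightarrow> (nat \<Rightarrow> nat) \<Rightarrow> (nat \<Rightarrow> nat) \<Rightarrow> bool" where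
  "hr P z l a S F \<sigma> \<tau> \<longleftrightarrow>
    (\<exists>V. run P z (l, \<sigma>) V (l, \<tau>) \<and> V \<subseteq> {l..<l + 2 + csz a} \<times> S \<and> (\<exists>q\<in>V. snd q F = 0))"

lemma run_iteration:
  assumes c: "code_at P l (cmp (Whl m n a) l)" and "\<sigma> m \<noteq> \<sigma> n"
    and V: "run P z (Suc l, \<sigma>) V (Suc l + csz a, \<tau>)" "V \<subseteq> {Suc l..<Suc l + csz a} \<times> S"
    and "\<sigma> \<in> S" "\<tau> \<in> S"
  shows "\<exists>V'. run P z (l, \<sigma>) V' (l, \<tau>) \<and> V' \<subseteq> {l..<l + 2 + csz a} \<times> S \<and> V \<subseteq> V'"
proof -
  have 1: "run P z (l, \<sigma>) {(l, \<sigma>)} (Suc l, \<sigma>)"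
    using run_exec[OF code_at_Whl(1,2)[OF c], of z \<sigma>] assms(2) by simp
  have 2: "run P z (Suc l + csz a, \<tau>) {(Suc l + csz a, \<tau>)} (l, \<tau>)"
    using run_exec[OF code_at_Whl(4,5)[OF c], of z \<tau>] by simp
  have "run P z (l, \<sigma>) ({(l, \<sigma>)} \<union> V \<union> {(Suc l + csz a, \<tau>)}) (l, \<tau>)"
    by (rule run_trans[OF run_trans[OF 1 V(1)] 2])
  moreover have "{(l, \<sigma>)} \<union> V \<union> {(Suc l + csz a, \<tau>)} \<subseteq> {l..<l + 2 + csz a} \<times> S"
    using V(2) assms(5,6) by fastforce
  ultimately show ?thesis by blast
qed

lemma ex_Whl_iter:
  assumes c: "code_at P l (cmp (Whl m n a) l)" and "\<sigma> m \<noteq> \<sigma> n"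
    and a: "ex P z (Suc l) a \<sigma> S \<rho>" and w: "ex P z l (Whl m n a) \<rho> S \<tau>" and "\<sigma> \<in> S" "\<rho> \<in> S"
  shows "ex P z l (Whl m n a) \<sigma> S \<tau>"
proof -
  obtain V where V: "run P z (Suc l, \<sigma>) V (Suc l + csz a, \<rho>)" "V \<subseteq> {Suc l..<Suc l + csz a} \<times> S"
    using a unfolding ex_def by blast
  obtain V' where V': "run P z (l, \<sigma>) V' (l, \<rho>)" "V' \<subseteq> {l..<l + 2 + csz a} \<times> S"
    using run_iteration[OF c assms(2) V assms(5,6)] by blast
  obtain W where W: "run P z (l, \<rho>) W (l + csz (Whl m n a), \<tau>)" "W \<subseteq> {l..<l + csz (Whl m n a)} \<times> S"
    using w unfolding ex_def by blast
  have "V' \<union> W \<subseteq> {l..<l + csz (Whl m n a)} \<times> S" using V'(2) W(2) by auto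
  then show ?thesis using run_trans[OF V'(1) W(1)] unfolding ex_def by blast
qed

lemma ex_Whl_hr:
  assumes "hr P z l a S F \<sigma> \<rho>" "ex P z l (Whl m n a) \<rho> S' \<tau>" "S \<subseteq> S'"
  shows "ex P z l (Whl m n a) \<sigma> S' \<tau>"
proof -
  obtain V where V: "run P z (l, \<sigma>) V (l, \<rho>)" "V \<subseteq> {l..<l + 2 + csz a} \<times> S"
    using assms(1) unfolding hr_def by blast
  obtain W where W: "run P z (l, \<rho>) W (l + csz (Whl m n a), \<tau>)" "W \<subseteq> {l..<l + csz (Whl m n a)} \<times> S'"
    using assms(2) unfolding ex_def by blast
  have "V \<union> W \<subseteq> {l..<l + csz (Whl m n a)} \<times> S'" using V(2) W(2) assms(3) by auto
  then show ?thesis using run_trans[OF V(1) W(1)] unfolding ex_def by blast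
qed

text \<open>The body is split in two because the state with \<open>F = 0\<close> occurs in its
  middle; back at the head \<open>F\<close> may be nonzero again.\<close>

lemma hr_iter:
  assumes c: "code_at P l (cmp (Whl m n (a ;; b)) l)" and "\<sigma> m \<noteq> \<sigma> n"
    and a: "ex P z (Suc l) a \<sigma> S \<rho>" and b: "ex P z (Suc l + csz a) b \<rho> S \<tau>"
    and "\<sigma> \<in> S" "\<tau> \<in> S" "\<rho> F = 0"
  shows "hr P z l (a ;; b) S F \<sigma> \<tau>"
proof -
  obtain V where V: "run P z (Suc l, \<sigma>) V (Suc l + csz a, \<rho>)" "V \<subseteq> {Suc l..<Suc l + csz a} \<times> S"
    using a unfolding ex_def by blast
  obtain W where W: "run P z (Suc l + csz a, \<rho>) W (Suc l + csz a + csz b, \<tau>)"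
      "W \<subseteq> {Suc l + csz a..<Suc l + csz a + csz b} \<times> S"
    using b unfolding ex_def by blast
  have 1: "run P z (Suc l, \<sigma>) (V \<union> W) (Suc l + csz (a ;; b), \<tau>)"
    using run_trans[OF V(1) W(1)] by (simp add: add.assoc)
  have 2: "V \<union> W \<subseteq> {Suc l..<Suc l + csz (a ;; b)} \<times> S" using V(2) W(2) by fastforce
  obtain V' where "run P z (l, \<sigma>) V' (l, \<tau>)" "V' \<subseteq> {l..<l + 2 + csz (a ;; b)} \<times> S" "V \<union> W \<subseteq> V'"
    using run_iteration[OF c assms(2) 1 2 assms(5,6)] by blast
  moreover have "(Suc l + csz a, \<rho>) \<in> W" using run_start[OF W(1)] .
  ultimately show ?thesis using assms(7) unfolding hr_def by (metis UnCI snd_conv subsetD)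
qed

lemma hr_trans: "hr P z l a S F \<sigma> \<rho> \<Longrightarrow> hr P z l a S F \<rho> \<tau> \<Longrightarrow> hr P z l a S F \<sigma> \<tau>"
proof -
  assume "hr P z l a S F \<sigma> \<rho>" "hr P z l a S F \<rho> \<tau>"
  then obtain V W where V: "run P z (l, \<sigma>) V (l, \<rho>)" "V \<subseteq> {l..<l + 2 + csz a} \<times> S" "\<exists>q\<in>V. snd q F = 0"
    and W: "run P z (l, \<rho>) W (l, \<tau>)" "W \<subseteq> {l..<l + 2 + csz a} \<times> S" unfolding hr_def by blast
  have "V \<union> W \<subseteq> {l..<l + 2 + csz a} \<times> S" "\<exists>q\<in>V \<union> W. snd q F = 0" using V W by auto
  then show ?thesis using run_trans[OF V(1) W(1)] unfolding hr_def by blast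
qed

lemma hr_mono: "hr P z l a S F \<sigma> \<tau> \<Longrightarrow> S \<subseteq> S' \<Longrightarrow> hr P z l a S' F \<sigma> \<tau>"
  unfolding hr_def by (meson Sigma_mono order_trans order_refl)

lemma inf0_eq:
  assumes "\<exists>\<^sub>\<infinity>i. v \<in> X i" "\<And>i k. i \<ge> j \<Longrightarrow> k \<in> X i \<Longrightarrow> v \<le> k"
  shows "inf0 X = v"
proof -
  have "(LEAST k. \<exists>\<^sub>\<infinity>i. k \<in> X i) = v"
  proof (rule Least_equality)
    show "\<exists>\<^sub>\<infinity>i. v \<in> X i" by fact
    fix k assume "\<exists>\<^sub>\<infinity>i. k \<in> X i"
    then obtain i where "i \<ge> j" "k \<in> X i" unfolding INFM_nat_le by blast
    then show "v \<le> k" using assms(2) by blast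
  qed
  moreover have "\<exists>k. \<exists>\<^sub>\<infinity>i. k \<in> X i" using assms(1) by blast
  ultimately show ?thesis unfolding inf0_def by presburger
qed

lemma inf0_zero:
  assumes "\<And>v. \<exists>j. \<forall>i\<ge>j. \<forall>k\<in>X i. v \<le> k"
  shows "inf0 X = 0"
proof -
  have "\<not> (\<exists>\<^sub>\<infinity>i. k \<in> X i)" for k
  proof
    assume *: "\<exists>\<^sub>\<infinity>i. k \<in> X i"
    obtain j where j: "\<forall>i\<ge>j. \<forall>k'\<in>X i. Suc k \<le> k'" using assms by blast
    obtain i where "i \<ge> j" "k \<in> X i" using * unfolding INFM_nat_le by blast
    then show False using j by fastforce
  qed
  then have "\<not> (\<exists>k. \<exists>\<^sub>\<infinity>i. k \<in> X i)" by blast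
  then show ?thesis unfolding inf0_def by presburger
qed

text \<open>Each segment starts at the loop head, the least line of the loop, so the limit is at the
  head again. The liminf of a register is \<open>v\<close> if \<open>v\<close> is eventually a lower
  bound and recurs at heads, and the overflow value \<open>0\<close> if its lower bounds tend to
  infinity. \<open>F\<close> vanishes within every segment, hence in the limit.\<close>

lemma hr_lim:
  assumes "\<And>i. hr P z l a (S i) F (x i) (x (Suc i))"
  obtains \<rho> where "hr P z l a (\<Union>i. S i) F (x 0) \<rho>" "\<rho> F = 0"
    "\<And>r v j. (\<And>i s. i \<ge> j \<Longrightarrow> s \<in> S i \<Longrightarrow> v \<le> s r) \<Longrightarrow> \<exists>\<^sub>\<infinity>i. x i r = v \<Longrightarrow> \<rho> r = v"
    "\<And>r. (\<And>v. \<exists>j. \<forall>i\<ge>j. \<forall>s\<in>S i. v \<le> s r) \<Longrightarrow> \<rho> r = 0"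
proof -
  obtain V where V: "\<And>i. run P z (l, x i) (V i) (l, x (Suc i))" "\<And>i. V i \<subseteq> {l..<l + 2 + csz a} \<times> S i"
    "\<And>i. \<exists>q\<in>V i. snd q F = 0"
    using assms unfolding hr_def by metis
  define \<rho> where "\<rho> = snd (limc V)"
  have st: "(l, x i) \<in> V i" for i using run_start[OF V(1)] .
  have "fst (limc V) = l"
    unfolding limc_def fst_conv
  proof (rule inf0_eq)
    show "\<exists>\<^sub>\<infinity>i. l \<in> fst ` V i" unfolding INFM_nat_le using st by force
    show "l \<le> k" if "k \<in> fst ` V i" for i k using that V(2)[of i] by fastforce
  qed
  then have lim: "limc V = (l, \<rho>)" unfolding \<rho>_def by (metis prod.collapse)
  have run: "run P z (l, x 0) (\<Union>i. V i) (l, \<rho>)"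
    using run_lim[of P z "\<lambda>i. (l, x i)" V, OF V(1)] lim by simp
  have \<rho>: "\<rho> r = inf0 (\<lambda>i. (\<lambda>q. snd q r) ` V i)" for r unfolding \<rho>_def limc_def by simp
  have VS: "snd q \<in> S i" if "q \<in> V i" for q i using that V(2)[of i] by auto
  show ?thesis
  proof
    show "hr P z l a (\<Union>i. S i) F (x 0) \<rho>"
      unfolding hr_def
    proof (intro exI conjI)
      show "run P z (l, x 0) (\<Union>i. V i) (l, \<rho>)" by (rule run)
      show "(\<Union>i. V i) \<subseteq> {l..<l + 2 + csz a} \<times> (\<Union>i. S i)" using V(2) by fastforce
      show "\<exists>q\<in>\<Union>i. V i. snd q F = 0" using V(3)[of 0] by blast
    qed
    show "\<rho> F = 0"
      unfolding \<rho>
    proof (rule inf0_eq)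
      show "\<exists>\<^sub>\<infinity>i. 0 \<in> (\<lambda>q. snd q F) ` V i"
        unfolding INFM_nat_le using V(3) by (metis image_eqI order_refl)
    qed simp
    show "\<rho> r = v" if lo: "\<And>i s. i \<ge> j \<Longrightarrow> s \<in> S i \<Longrightarrow> v \<le> s r" and inf: "\<exists>\<^sub>\<infinity>i. x i r = v" for r v j
      unfolding \<rho>
    proof (rule inf0_eq)
      show "\<exists>\<^sub>\<infinity>i. v \<in> (\<lambda>q. snd q r) ` V i"
        using inf st unfolding INFM_nat_le by (metis image_eqI snd_conv)
      show "v \<le> k" if "j \<le> i" "k \<in> (\<lambda>q. snd q r) ` V i" for i k using that lo VS by blast
    qed
    show "\<rho> r = 0" if lo: "\<And>v. \<exists>j. \<forall>i\<ge>j. \<forall>s\<in>S i. v \<le> s r" for r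
      unfolding \<rho>
    proof (rule inf0_zero)
      fix v
      obtain j where "\<forall>i\<ge>j. \<forall>s\<in>S i. v \<le> s r" using lo by blast
      then show "\<exists>j. \<forall>i\<ge>j. \<forall>k\<in>(\<lambda>q. snd q r) ` V i. v \<le> k" using VS by blast
    qed
  qed
qed

text \<open>Weakest preconditions for runs that leave the registers below \<open>k\<close> untouched throughout.\<close>

definition fr :: "nat \<Rightarrow> (nat \<Rightarrow> nat) \<Rightarrow> (nat \<Rightarrow> nat) set" where
  "fr k \<sigma> = {\<rho>. \<forall>i<k. \<rho> i = \<sigma> i}"

lemma fr_eq: "\<rho> \<in> fr k \<sigma> \<Longrightarrow> fr k \<rho> = fr k \<sigma>"
  unfolding fr_def by auto

lemma fr_refl: "\<sigma> \<in> fr k \<sigma>"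
  unfolding fr_def by auto

lemma fr_antimono: "k \<le> b \<Longrightarrow> fr b \<sigma> \<subseteq> fr k \<sigma>"
  unfolding fr_def by auto

text \<open>Quantifying over all surrounding programs and positions makes commands relocatable. The
  frame condition concerns every visited state, because a limit reads off intermediate
  values.\<close>

definition wps :: "creal \<Rightarrow> nat \<Rightarrow> com \<Rightarrow> ((nat \<Rightarrow> nat) \<Rightarrow> bool) \<Rightarrow> (nat \<Rightarrow> nat) \<Rightarrow> bool" where
  "wps z k c Q \<sigma> \<longleftrightarrow> (\<forall>P l. code_at P l (cmp c l) \<longrightarrow> (\<exists>\<tau>. Q \<tau> \<and> ex P z l c \<sigma> (fr k \<sigma>) \<tau> \<and> \<tau> \<in> fr k \<sigma>))"

lemma wpsE:
  assumes "wps z k c Q \<sigma>" "code_at P l (cmp c l)"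
  obtains \<tau> where "Q \<tau>" "ex P z l c \<sigma> (fr k \<sigma>) \<tau>" "\<tau> \<in> fr k \<sigma>"
  using assms unfolding wps_def by blast

lemma wpsI:
  assumes "\<And>P l. code_at P l (cmp c l) \<Longrightarrow> \<exists>\<tau>. Q \<tau> \<and> ex P z l c \<sigma> (fr k \<sigma>) \<tau> \<and> \<tau> \<in> fr k \<sigma>"
  shows "wps z k c Q \<sigma>"
  using assms unfolding wps_def by blast

lemma wps_weaken:
  assumes "wps z b c Q \<sigma>" "k \<le> b" "\<And>\<tau>. \<forall>i<b. \<tau> i = \<sigma> i \<Longrightarrow> Q \<tau> \<Longrightarrow> Q' \<tau>"
  shows "wps z k c Q' \<sigma>"
proof (rule wpsI)
  fix P l assume "code_at P l (cmp c l)"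
  then obtain \<tau> where \<tau>: "Q \<tau>" "ex P z l c \<sigma> (fr b \<sigma>) \<tau>" "\<tau> \<in> fr b \<sigma>"
    by (rule wpsE[OF assms(1)])
  then have "Q' \<tau>" using assms(3) by (simp add: fr_def)
  then show "\<exists>\<tau>. Q' \<tau> \<and> ex P z l c \<sigma> (fr k \<sigma>) \<tau> \<and> \<tau> \<in> fr k \<sigma>"
    using \<tau> fr_antimono[OF assms(2)] ex_mono by blast
qed

lemma wps_Bas:
  assumes "nojump i" "\<And>j. j < k \<Longrightarrow> snd (exec z i (0, \<sigma>)) j = \<sigma> j" "Q (snd (exec z i (0, \<sigma>)))"
  shows "wps z k (Bas i) Q \<sigma>"
proof (rule wpsI)
  fix P l assume c: "code_at P l (cmp (Bas i) l)"
  have "ex P z l (Bas i) \<sigma> (fr k \<sigma>) (snd (exec z i (0, \<sigma>)))"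
    by (rule ex_Bas[OF c assms(1) fr_refl])
  moreover have "snd (exec z i (0, \<sigma>)) \<in> fr k \<sigma>" using assms(2) by (simp add: fr_def)
  ultimately show "\<exists>\<tau>. Q \<tau> \<and> ex P z l (Bas i) \<sigma> (fr k \<sigma>) \<tau> \<and> \<tau> \<in> fr k \<sigma>"
    using assms(3) by blast
qed

lemma wps_Zero: "k \<le> n \<Longrightarrow> Q (\<sigma>(n := 0)) \<Longrightarrow> wps z k (Bas (Zero n)) Q \<sigma>"
  by (rule wps_Bas) auto

lemma wps_Inc: "k \<le> n \<Longrightarrow> Q (\<sigma>(n := Suc (\<sigma> n))) \<Longrightarrow> wps z k (Bas (Inc n)) Q \<sigma>"
  by (rule wps_Bas) auto

lemma wps_Copy: "k \<le> n \<Longrightarrow> Q (\<sigma>(n := \<sigma> m)) \<Longrightarrow> wps z k (Bas (Copy m n)) Q \<sigma>"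
  by (rule wps_Bas) auto

lemma wps_Oracle: "k \<le> n \<Longrightarrow> Q (\<sigma>(n := of_bool (z (\<sigma> n)))) \<Longrightarrow> wps z k (Bas (Oracle n)) Q \<sigma>"
  by (rule wps_Bas) (auto simp: of_bool_def)

lemma wps_Seq:
  assumes "wps z k a (wps z k b Q) \<sigma>"
  shows "wps z k (a ;; b) Q \<sigma>"
proof (rule wpsI)
  fix P l assume "code_at P l (cmp (a ;; b) l)"
  then have c: "code_at P l (cmp a l)" "code_at P (l + csz a) (cmp b (l + csz a))"
    using code_at_append[of P l "cmp a l"] by auto
  obtain \<rho> where \<rho>: "wps z k b Q \<rho>" "ex P z l a \<sigma> (fr k \<sigma>) \<rho>" "\<rho> \<in> fr k \<sigma>"
    by (rule wpsE[OF assms c(1)])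
  obtain \<tau> where \<tau>: "Q \<tau>" "ex P z (l + csz a) b \<rho> (fr k \<rho>) \<tau>" "\<tau> \<in> fr k \<rho>"
    by (rule wpsE[OF \<rho>(1) c(2)])
  note \<tau>' = \<tau>[unfolded fr_eq[OF \<rho>(3)]]
  show "\<exists>\<tau>. Q \<tau> \<and> ex P z l (a ;; b) \<sigma> (fr k \<sigma>) \<tau> \<and> \<tau> \<in> fr k \<sigma>"
    using ex_Seq[OF \<rho>(2) \<tau>'(2)] \<tau>' by blast
qed

lemma wps_IfE:
  assumes "\<sigma> m = \<sigma> n \<Longrightarrow> wps z k a Q \<sigma>" "\<sigma> m \<noteq> \<sigma> n \<Longrightarrow> wps z k b Q \<sigma>"
  shows "wps z k (IfE m n a b) Q \<sigma>"
proof (rule wpsI)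
  fix P l assume c: "code_at P l (cmp (IfE m n a b) l)"
  show "\<exists>\<tau>. Q \<tau> \<and> ex P z l (IfE m n a b) \<sigma> (fr k \<sigma>) \<tau> \<and> \<tau> \<in> fr k \<sigma>"
  proof (cases "\<sigma> m = \<sigma> n")
    case True
    obtain \<tau> where "Q \<tau>" "ex P z (l + 2 + csz b) a \<sigma> (fr k \<sigma>) \<tau>" "\<tau> \<in> fr k \<sigma>"
      by (rule wpsE[OF assms(1)[OF True] code_at_IfE(6)[OF c]])
    then show ?thesis using ex_IfE_eq[OF c True fr_refl] by blast
  next
    case False
    obtain \<tau> where "Q \<tau>" "ex P z (Suc l) b \<sigma> (fr k \<sigma>) \<tau>" "\<tau> \<in> fr k \<sigma>"
      by (rule wpsE[OF assms(2)[OF False] code_at_IfE(3)[OF c]])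
    then show ?thesis using ex_IfE_neq[OF c False fr_refl] by blast
  qed
qed

text \<open>The natural number measure restricts this rule to loops that end after finitely many
  rounds; loops through limits are handled by \<open>hr\<close>.\<close>

lemma wps_Whl:
  fixes \<mu> :: "(nat \<Rightarrow> nat) \<Rightarrow> nat"
  assumes body: "\<And>\<sigma>. I \<sigma> \<Longrightarrow> \<sigma> m \<noteq> \<sigma> n \<Longrightarrow> wps z k a (\<lambda>\<tau>. I \<tau> \<and> \<mu> \<tau> < \<mu> \<sigma>) \<sigma>"
    and exit: "\<And>\<tau>. I \<tau> \<Longrightarrow> \<tau> m = \<tau> n \<Longrightarrow> Q \<tau>" and "I \<sigma>"
  shows "wps z k (Whl m n a) Q \<sigma>"
proof (rule wpsI)
  fix P l assume c: "code_at P l (cmp (Whl m n a) l)"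
  show "\<exists>\<tau>. Q \<tau> \<and> ex P z l (Whl m n a) \<sigma> (fr k \<sigma>) \<tau> \<and> \<tau> \<in> fr k \<sigma>"
    using \<open>I \<sigma>\<close>
  proof (induction "\<mu> \<sigma>" arbitrary: \<sigma> rule: less_induct)
    case less
    show ?case
    proof (cases "\<sigma> m = \<sigma> n")
      case True
      then show ?thesis using ex_Whl_exit[OF c True fr_refl] exit less.prems fr_refl by blast
    next
      case False
      obtain \<rho> where \<rho>: "I \<rho> \<and> \<mu> \<rho> < \<mu> \<sigma>" "ex P z (Suc l) a \<sigma> (fr k \<sigma>) \<rho>" "\<rho> \<in> fr k \<sigma>"
        by (rule wpsE[OF body[OF less.prems False] code_at_Whl(3)[OF c]])
      obtain \<tau> where \<tau>: "Q \<tau>" "ex P z l (Whl m n a) \<rho> (fr k \<rho>) \<tau>" "\<tau> \<in> fr k \<rho>"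
        using less.hyps \<rho>(1) by blast
      note \<tau>' = \<tau>[unfolded fr_eq[OF \<rho>(3)]]
      show ?thesis using ex_Whl_iter[OF c False \<rho>(2) \<tau>'(2) fr_refl \<rho>(3)] \<tau>' by blast
    qed
  qed
qed

subsection \<open>Functions computed by infinite time register machines\<close>

text \<open>Argument and result share register \<open>k\<close>, everything below is preserved and
  everything above is scratch. Code for every \<open>k\<close> allows a subroutine to be placed
  above the live registers of its caller.\<close>

definition C :: "(creal \<Rightarrow> nat \<Rightarrow> nat) \<Rightarrow> bool" where
  "C f \<longleftrightarrow> (\<forall>k. \<exists>c. \<forall>z \<sigma>. wps z k c (\<lambda>\<tau>. \<tau> k = f z (\<sigma> k)) \<sigma>)"

lemma C_call:
  assumes "C f"
  obtains c where "\<And>z k Q \<sigma>. k \<le> b \<Longrightarrow>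
    (\<And>\<tau>. \<forall>i<b. \<tau> i = \<sigma> i \<Longrightarrow> \<tau> b = f z (\<sigma> b) \<Longrightarrow> Q \<tau>) \<Longrightarrow> wps z k c Q \<sigma>"
proof -
  obtain c where c: "\<And>z \<sigma>. wps z b c (\<lambda>\<tau>. \<tau> b = f z (\<sigma> b)) \<sigma>" using assms unfolding C_def by blast
  show ?thesis by (rule that) (rule wps_weaken[OF c])
qed

lemma C_I:
  assumes "\<And>k. \<exists>c. \<forall>z \<sigma>. wps z k c (\<lambda>\<tau>. \<tau> k = f z (\<sigma> k)) \<sigma>"
  shows "C f"
  using assms unfolding C_def by blast

lemma C_id: "C (\<lambda>z v. v)"
  by (rule C_I, rule exI, intro allI, rule wps_Copy[of _ _ _ _ _ k for k]) auto

lemma C_comp: "C g \<Longrightarrow> C f \<Longrightarrow> C (\<lambda>z v. g z (f z v))"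
proof (rule C_I)
  fix k assume g: "C g" and f: "C f"
  obtain cg where cg: "\<And>z j Q \<sigma>. j \<le> k \<Longrightarrow>
    (\<And>\<tau>. \<forall>i<k. \<tau> i = \<sigma> i \<Longrightarrow> \<tau> k = g z (\<sigma> k) \<Longrightarrow> Q \<tau>) \<Longrightarrow> wps z j cg Q \<sigma>"
    by (rule C_call[OF g, of k]) blast
  obtain cf where cf: "\<And>z j Q \<sigma>. j \<le> k \<Longrightarrow>
    (\<And>\<tau>. \<forall>i<k. \<tau> i = \<sigma> i \<Longrightarrow> \<tau> k = f z (\<sigma> k) \<Longrightarrow> Q \<tau>) \<Longrightarrow> wps z j cf Q \<sigma>"
    by (rule C_call[OF f, of k]) blast
  have "wps z k (cf ;; cg) (\<lambda>\<tau>. \<tau> k = g z (f z (\<sigma> k))) \<sigma>" for z \<sigma>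
    by (intro wps_Seq cf cg order_refl) simp
  then show "\<exists>c. \<forall>z \<sigma>. wps z k c (\<lambda>\<tau>. \<tau> k = g z (f z (\<sigma> k))) \<sigma>" by blast
qed

lemma C_Suc': "C (\<lambda>z v. Suc v)"
  by (rule C_I, rule exI, intro allI, rule wps_Inc[of _ k for k]) auto

lemma C_Suc: "C f \<Longrightarrow> C (\<lambda>z v. Suc (f z v))"
  by (rule C_comp[OF C_Suc'])

lemma C_const: "C (\<lambda>z v. n)"
proof (induction n)
  case 0
  show ?case by (rule C_I, rule exI, intro allI, rule wps_Zero[of _ k for k]) auto
next
  case (Suc n)
  then show ?case by (rule C_Suc)
qed

lemma C_oracle: "C (\<lambda>z v. of_bool (z v))"
  by (rule C_I, rule exI, intro allI, rule wps_Oracle[of _ k for k]) auto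

lemma C_if:
  assumes "C p" "C f" "C g"
  shows "C (\<lambda>z v. if p z v = 0 then f z v else g z v)"
proof (rule C_I)
  fix k
  obtain cp where cp: "\<And>z j Q \<sigma>. j \<le> Suc k \<Longrightarrow>
    (\<And>\<tau>. \<forall>i<Suc k. \<tau> i = \<sigma> i \<Longrightarrow> \<tau> (Suc k) = p z (\<sigma> (Suc k)) \<Longrightarrow> Q \<tau>) \<Longrightarrow> wps z j cp Q \<sigma>"
    by (rule C_call[OF assms(1), of "Suc k"]) blast
  obtain cg where cg: "\<And>z j Q \<sigma>. j \<le> k \<Longrightarrow>
    (\<And>\<tau>. \<forall>i<k. \<tau> i = \<sigma> i \<Longrightarrow> \<tau> k = g z (\<sigma> k) \<Longrightarrow> Q \<tau>) \<Longrightarrow> wps z j cg Q \<sigma>"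
    by (rule C_call[OF assms(3), of k]) blast
  obtain cf where cf: "\<And>z j Q \<sigma>. j \<le> k \<Longrightarrow>
    (\<And>\<tau>. \<forall>i<k. \<tau> i = \<sigma> i \<Longrightarrow> \<tau> k = f z (\<sigma> k) \<Longrightarrow> Q \<tau>) \<Longrightarrow> wps z j cf Q \<sigma>"
    by (rule C_call[OF assms(2), of k]) blast
  have "wps z k (Bas (Copy k (Suc k)) ;; cp ;; Bas (Zero (Suc (Suc k))) ;; IfE (Suc k) (Suc (Suc k)) cf cg)
     (\<lambda>\<tau>. \<tau> k = (if p z (\<sigma> k) = 0 then f z (\<sigma> k) else g z (\<sigma> k))) \<sigma>" for z \<sigma>
    by (intro wps_Seq wps_IfE wps_Copy wps_Zero cp cf cg) auto
  then show "\<exists>c. \<forall>z \<sigma>. wps z k c (\<lambda>\<tau>. \<tau> k = (if p z (\<sigma> k) = 0 then f z (\<sigma> k) else g z (\<sigma> k))) \<sigma>" by blast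
qed

section \<open>Pairing and unpairing on registers\<close>

definition addc :: "nat \<Rightarrow> nat \<Rightarrow> nat \<Rightarrow> com" where
  "addc i X Y = Bas (Zero i) ;; Whl i X (Bas (Inc i) ;; Bas (Inc Y))"

lemma wps_addc:
  assumes "k \<le> i" "k \<le> Y" "i \<noteq> X" "i \<noteq> Y" "X \<noteq> Y" "Q (\<sigma>(i := \<sigma> X, Y := \<sigma> Y + \<sigma> X))"
  shows "wps z k (addc i X Y) Q \<sigma>"
  unfolding addc_def
  apply (rule wps_Seq, rule wps_Zero[OF assms(1)])
  apply (rule wps_Whl[where I = "\<lambda>\<tau>. \<tau> i \<le> \<sigma> X \<and> \<tau> Y = \<sigma> Y + \<tau> i \<and> (\<forall>j. j \<noteq> i \<longrightarrow> j \<noteq> Y \<longrightarrow> \<tau> j = \<sigma> j)"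
        and \<mu> = "\<lambda>\<tau>. \<sigma> X - \<tau> i"])
  subgoal for \<rho>
    apply (intro wps_Seq wps_Inc assms(1,2))
    using assms(3-5) by auto
  subgoal for \<tau>
  proof -
    assume I: "\<tau> i \<le> \<sigma> X \<and> \<tau> Y = \<sigma> Y + \<tau> i \<and> (\<forall>j. j \<noteq> i \<longrightarrow> j \<noteq> Y \<longrightarrow> \<tau> j = \<sigma> j)" "\<tau> i = \<tau> X"
    then have "\<tau> = \<sigma>(i := \<sigma> X, Y := \<sigma> Y + \<sigma> X)" using assms(3,5) by (intro ext) auto
    then show ?thesis using assms(6) by simp
  qed
  subgoal using assms(3-5) by auto
  done

text \<open>Cantor pairing \<open>triangle (m + n) + m\<close>: register \<open>k+3\<close> holds
  \<open>m + n\<close>, the loop adds \<open>1, ..., m + n\<close> to register \<open>k\<close>, and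
  \<open>m\<close> is added last.\<close>

definition encc :: "nat \<Rightarrow> com" where
  "encc k = Bas (Copy (k+1) (k+3)) ;; addc (k+4) (k+2) (k+3) ;; Bas (Zero k) ;; Bas (Zero (k+5)) ;;
     Whl (k+5) (k+3) (Bas (Inc (k+5)) ;; addc (k+4) (k+5) k) ;; addc (k+4) (k+1) k"

lemma wps_encc:
  assumes "j \<le> k"
    and Q: "\<And>\<tau>. \<forall>i<k. \<tau> i = \<sigma> i \<Longrightarrow> \<tau> k = prod_encode (\<sigma> (k+1), \<sigma> (k+2)) \<Longrightarrow> Q \<tau>"
  shows "wps z j (encc k) Q \<sigma>"
proof (rule wps_weaken[OF _ assms(1)])
  let ?I = "\<lambda>\<tau>. \<tau> (k+1) = \<sigma> (k+1) \<and> \<tau> (k+2) = \<sigma> (k+2) \<and> \<tau> (k+3) = \<sigma> (k+1) + \<sigma> (k+2) \<and>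
     \<tau> (k+5) \<le> \<tau> (k+3) \<and> \<tau> k = triangle (\<tau> (k+5))"
  show "wps z k (encc k) (\<lambda>\<tau>. \<tau> k = prod_encode (\<sigma> (k+1), \<sigma> (k+2))) \<sigma>"
    unfolding encc_def
    apply ((rule wps_Seq | rule wps_Zero, (simp; fail) | rule wps_Copy, (simp; fail) | rule wps_Inc, (simp; fail) | rule wps_addc, (simp; fail), (simp; fail), (simp; fail), (simp; fail), (simp; fail))+)
    apply (rule wps_Whl[where I = ?I and \<mu> = "\<lambda>\<tau>. \<tau> (k+3) - \<tau> (k+5)"])
    subgoal for \<rho>
      by (intro wps_Seq wps_Inc wps_addc) auto
    subgoal for \<rho>
      by (intro wps_addc) (auto simp: prod_encode_def)
    subgoal by simp
    done
qed (use Q in auto)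

lemma C_pair:
  assumes "C f" "C g"
  shows "C (\<lambda>z v. prod_encode (f z v, g z v))"
proof (rule C_I)
  fix k
  obtain cf where cf: "\<And>z j Q \<sigma>. j \<le> k+1 \<Longrightarrow>
    (\<And>\<tau>. \<forall>i<k+1. \<tau> i = \<sigma> i \<Longrightarrow> \<tau> (k+1) = f z (\<sigma> (k+1)) \<Longrightarrow> Q \<tau>) \<Longrightarrow> wps z j cf Q \<sigma>"
    by (rule C_call[OF assms(1), of "k+1"]) blast
  obtain cg where cg: "\<And>z j Q \<sigma>. j \<le> k+2 \<Longrightarrow>
    (\<And>\<tau>. \<forall>i<k+2. \<tau> i = \<sigma> i \<Longrightarrow> \<tau> (k+2) = g z (\<sigma> (k+2)) \<Longrightarrow> Q \<tau>) \<Longrightarrow> wps z j cg Q \<sigma>"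
    by (rule C_call[OF assms(2), of "k+2"]) blast
  have "wps z k (Bas (Copy k (k+1)) ;; cf ;; Bas (Copy k (k+2)) ;; cg ;; encc k)
     (\<lambda>\<tau>. \<tau> k = prod_encode (f z (\<sigma> k), g z (\<sigma> k))) \<sigma>" for z \<sigma>
    by (intro wps_Seq wps_Copy cf cg wps_encc) auto
  then show "\<exists>c. \<forall>z \<sigma>. wps z k c (\<lambda>\<tau>. \<tau> k = prod_encode (f z (\<sigma> k), g z (\<sigma> k))) \<sigma>" by blast
qed

abbreviation "pfst v \<equiv> fst (prod_decode v)"
abbreviation "psnd v \<equiv> snd (prod_decode v)"

text \<open>Register \<open>k+1\<close> counts up to the code while the pair with that code is
  enumerated along the diagonals: \<open>k+2\<close> holds the first component and
  \<open>k+3\<close> the sum of both, so a diagonal ends when the two agree.\<close>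

definition decc :: "nat \<Rightarrow> com" where
  "decc k = Bas (Zero (k+1)) ;; Bas (Zero (k+2)) ;; Bas (Zero (k+3)) ;;
     Whl (k+1) k (Bas (Inc (k+1)) ;; IfE (k+2) (k+3) (Bas (Inc (k+3)) ;; Bas (Zero (k+2))) (Bas (Inc (k+2))))"

lemma wps_decc:
  assumes Q: "\<And>\<tau>. \<forall>i<k. \<tau> i = \<sigma> i \<Longrightarrow> \<tau> (k+2) = pfst (\<sigma> k) \<Longrightarrow> \<tau> (k+3) = pfst (\<sigma> k) + psnd (\<sigma> k) \<Longrightarrow> Q \<tau>"
  shows "wps z k (decc k) Q \<sigma>"
proof (rule wps_weaken[OF _ order_refl])
  let ?I = "\<lambda>\<tau>. \<tau> k = \<sigma> k \<and> \<tau> (k+1) \<le> \<sigma> k \<and> \<tau> (k+2) \<le> \<tau> (k+3) \<and> \<tau> (k+1) = triangle (\<tau> (k+3)) + \<tau> (k+2)"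
  let ?Q = "\<lambda>\<tau>. \<tau> (k+2) = pfst (\<sigma> k) \<and> \<tau> (k+3) = pfst (\<sigma> k) + psnd (\<sigma> k)"
  show "wps z k (decc k) ?Q \<sigma>"
    unfolding decc_def
    apply ((rule wps_Seq | rule wps_Zero, (simp; fail) | rule wps_Copy, (simp; fail) | rule wps_Inc, (simp; fail) | rule wps_addc, (simp; fail), (simp; fail), (simp; fail), (simp; fail), (simp; fail))+)
    apply (rule wps_Whl[where I = ?I and \<mu> = "\<lambda>\<tau>. \<sigma> k - \<tau> (k+1)"])
    subgoal for \<rho>
      by (intro wps_Seq wps_Inc wps_IfE wps_Zero) auto
    subgoal for \<rho>
    proof -
      assume I: "?I \<rho>" and e: "\<rho> (k+1) = \<rho> k"
      have "\<sigma> k = prod_encode (\<rho> (k+2), \<rho> (k+3) - \<rho> (k+2))"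
        using I e by (simp add: prod_encode_def)
      then have "prod_decode (\<sigma> k) = (\<rho> (k+2), \<rho> (k+3) - \<rho> (k+2))" by simp
      then show ?thesis using I by simp
    qed
    subgoal by simp
    done
qed (use Q in auto)

lemma C_pfst': "C (\<lambda>z v. pfst v)"
proof (rule C_I)
  fix k
  have "wps z k (decc k ;; Bas (Copy (k+2) k)) (\<lambda>\<tau>. \<tau> k = pfst (\<sigma> k)) \<sigma>" for z \<sigma>
    by (intro wps_Seq wps_decc wps_Copy) auto
  then show "\<exists>c. \<forall>z \<sigma>. wps z k c (\<lambda>\<tau>. \<tau> k = pfst (\<sigma> k)) \<sigma>" by blast
qed

lemma C_psnd': "C (\<lambda>z v. psnd v)"
proof (rule C_I)
  fix k
  let ?W = "Whl (k+2) (k+3) (Bas (Inc (k+2)) ;; Bas (Inc k))"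
  have "wps z k (decc k ;; Bas (Zero k) ;; ?W) (\<lambda>\<tau>. \<tau> k = psnd (\<sigma> k)) \<sigma>" for z \<sigma>
    apply (rule wps_Seq, rule wps_decc, rule wps_Seq, rule wps_Zero, rule order_refl)
    apply (rule wps_Whl[where I = "\<lambda>\<tau>. \<tau> (k+2) \<le> \<tau> (k+3) \<and> \<tau> k + pfst (\<sigma> k) = \<tau> (k+2) \<and>
       \<tau> (k+3) = pfst (\<sigma> k) + psnd (\<sigma> k)" and \<mu> = "\<lambda>\<tau>. \<tau> (k+3) - \<tau> (k+2)"])
    subgoal for \<tau> \<rho> by (intro wps_Seq wps_Inc) auto
    subgoal by auto
    subgoal by auto
    done
  then show "\<exists>c. \<forall>z \<sigma>. wps z k c (\<lambda>\<tau>. \<tau> k = psnd (\<sigma> k)) \<sigma>" by blast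
qed

lemma C_pfst: "C f \<Longrightarrow> C (\<lambda>z v. pfst (f z v))" by (rule C_comp[OF C_pfst'])
lemma C_psnd: "C f \<Longrightarrow> C (\<lambda>z v. psnd (f z v))" by (rule C_comp[OF C_psnd'])

text \<open>The machine can only increment, so the predecessor is a register trailing one step
  behind a counter; its initial value gives \<open>0 - 1 = 0\<close>.\<close>

lemma C_pred': "C (\<lambda>z v. v - 1)"
proof (rule C_I)
  fix k
  let ?W = "Whl (k+1) k (Bas (Copy (k+1) (k+2)) ;; Bas (Inc (k+1)))"
  have "wps z k (Bas (Zero (k+1)) ;; Bas (Zero (k+2)) ;; ?W ;; Bas (Copy (k+2) k)) (\<lambda>\<tau>. \<tau> k = \<sigma> k - 1) \<sigma>" for z \<sigma>
    apply ((rule wps_Seq | rule wps_Zero, (simp; fail) | rule wps_Copy, (simp; fail) | rule wps_Inc, (simp; fail) | rule wps_addc, (simp; fail), (simp; fail), (simp; fail), (simp; fail), (simp; fail))+)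
    apply (rule wps_Whl[where I = "\<lambda>\<tau>. \<tau> k = \<sigma> k \<and> \<tau> (k+1) \<le> \<sigma> k \<and> \<tau> (k+2) = \<tau> (k+1) - 1"
        and \<mu> = "\<lambda>\<tau>. \<sigma> k - \<tau> (k+1)"])
    subgoal for \<rho> by (intro wps_Seq wps_Inc wps_Copy) auto
    subgoal by (intro wps_Copy) auto
    subgoal by auto
    done
  then show "\<exists>c. \<forall>z \<sigma>. wps z k c (\<lambda>\<tau>. \<tau> k = \<sigma> k - 1) \<sigma>" by blast
qed

lemma C_pred: "C f \<Longrightarrow> C (\<lambda>z v. f z v - 1)" by (rule C_comp[OF C_pred'])

lemma C_iterate':
  assumes "C h"
  shows "C (\<lambda>z v. (h z ^^ psnd v) (pfst v))"
proof (rule C_I)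
  fix k
  obtain ch where ch: "\<And>z j Q \<sigma>. j \<le> k+3 \<Longrightarrow>
    (\<And>\<tau>. \<forall>i<k+3. \<tau> i = \<sigma> i \<Longrightarrow> \<tau> (k+3) = h z (\<sigma> (k+3)) \<Longrightarrow> Q \<tau>) \<Longrightarrow> wps z j ch Q \<sigma>"
    by (rule C_call[OF assms(1), of "k+3"]) blast
  obtain c1 where c1: "\<And>z j Q \<sigma>. j \<le> k+1 \<Longrightarrow>
    (\<And>\<tau>. \<forall>i<k+1. \<tau> i = \<sigma> i \<Longrightarrow> \<tau> (k+1) = psnd (\<sigma> (k+1)) \<Longrightarrow> Q \<tau>) \<Longrightarrow> wps z j c1 Q \<sigma>"
    by (rule C_call[OF C_psnd', of "k+1"]) blast
  obtain c2 where c2: "\<And>z j Q \<sigma>. j \<le> k+3 \<Longrightarrow>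
    (\<And>\<tau>. \<forall>i<k+3. \<tau> i = \<sigma> i \<Longrightarrow> \<tau> (k+3) = pfst (\<sigma> (k+3)) \<Longrightarrow> Q \<tau>) \<Longrightarrow> wps z j c2 Q \<sigma>"
    by (rule C_call[OF C_pfst', of "k+3"]) blast
  let ?W = "Whl (k+2) (k+1) (Bas (Inc (k+2)) ;; ch)"
  have "wps z k (Bas (Copy k (k+1)) ;; c1 ;; Bas (Copy k (k+3)) ;; c2 ;; Bas (Zero (k+2)) ;; ?W ;; Bas (Copy (k+3) k))
     (\<lambda>\<tau>. \<tau> k = (h z ^^ psnd (\<sigma> k)) (pfst (\<sigma> k))) \<sigma>" for z \<sigma>
    apply (rule wps_Seq, rule wps_Copy, simp, rule wps_Seq, rule c1, simp, rule wps_Seq, rule wps_Copy, simp,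
        rule wps_Seq, rule c2, simp, rule wps_Seq, rule wps_Zero, simp, rule wps_Seq)
    apply (rule wps_Whl[where I = "\<lambda>\<tau>. \<tau> (k+1) = psnd (\<sigma> k) \<and> \<tau> (k+2) \<le> \<tau> (k+1) \<and>
        \<tau> (k+3) = (h z ^^ \<tau> (k+2)) (pfst (\<sigma> k))" and \<mu> = "\<lambda>\<tau>. \<tau> (k+1) - \<tau> (k+2)"])
    subgoal for \<tau> \<tau>' \<rho> by (intro wps_Seq wps_Inc ch) auto
    subgoal by (intro wps_Copy) auto
    subgoal by auto
    done
  then show "\<exists>c. \<forall>z \<sigma>. wps z k c (\<lambda>\<tau>. \<tau> k = (h z ^^ psnd (\<sigma> k)) (pfst (\<sigma> k))) \<sigma>" by blast
qed

lemma C_iterate: "C h \<Longrightarrow> C f \<Longrightarrow> C g \<Longrightarrow> C (\<lambda>z v. (h z ^^ g z v) (f z v))"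
  using C_comp[OF C_iterate' C_pair[of f g], of h] by simp

subsection \<open>Iteration through limits\<close>

text \<open>States are triples of a flag, a main register \<open>s\<close> and an auxiliary register. The flag is \<open>0\<close> exactly
  upon arrival at a limit, and then the auxiliary register carries no information. The first argument
  of \<open>mr\<close> bounds \<open>s\<close> from below during the whole run.\<close>

definition hn :: "(nat \<Rightarrow> nat) \<Rightarrow> nat \<Rightarrow> nat \<times> nat \<times> nat \<Rightarrow> nat \<times> nat \<times> nat" where
  "hn H p x = (case x of (f, s, K) \<Rightarrow>
     let r = H (prod_encode (f, prod_encode (p, prod_encode (s, K)))) in (pfst r, pfst (psnd r), psnd (psnd r)))"

inductive mr :: "(nat \<times> nat \<times> nat \<Rightarrow> nat \<times> nat \<times> nat) \<Rightarrow> nat \<Rightarrow> nat \<times> nat \<times> nat \<Rightarrow> nat \<times> nat \<times> nat \<Rightarrow> bool" for h where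
  mr_step: "h (f, s, K) = (Suc d', s', K') \<Longrightarrow> lo \<le> s \<Longrightarrow> lo \<le> s' \<Longrightarrow> mr h lo (f, s, K) (1, s', K')"
| mr_trans: "mr h lo x y \<Longrightarrow> mr h lo y w \<Longrightarrow> mr h lo x w"
| mr_lim: "(\<And>i. mr h v (x i) (x (Suc i))) \<Longrightarrow> \<exists>\<^sub>\<infinity>i. fst (snd (x i)) = v \<Longrightarrow> lo \<le> v \<Longrightarrow> mr h lo (x 0) (0, v, 0)"
| mr_over: "(\<And>i. mr h (m i) (x i) (x (Suc i))) \<Longrightarrow> (\<And>v. \<exists>j. \<forall>i\<ge>j. v \<le> m i) \<Longrightarrow> mr h 0 (x 0) (0, 0, 0)"

lemma mr_mono: "mr h lo x y \<Longrightarrow> lo' \<le> lo \<Longrightarrow> mr h lo' x y"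
proof (induction arbitrary: lo' rule: mr.induct)
  case (mr_step f s K d' s' K' lo)
  then show ?case by (intro mr.mr_step) auto
next
  case (mr_trans lo x y w)
  then show ?case by (blast intro: mr.mr_trans)
next
  case (mr_lim v x lo)
  then show ?case by (intro mr.mr_lim) auto
next
  case (mr_over m x)
  then show ?case using mr.mr_over[of h m x] by simp
qed

lemma hr_limit:
  assumes "\<And>i. hr P z l a (S i) F (x i) (x (Suc i))"
  shows "\<exists>\<rho>. hr P z l a (\<Union>i. S i) F (x 0) \<rho> \<and> \<rho> F = 0 \<and>
    (\<forall>r v. (\<forall>i. \<forall>s\<in>S i. v \<le> s r) \<longrightarrow> (\<exists>\<^sub>\<infinity>i. x i r = v) \<longrightarrow> \<rho> r = v) \<and>
    (\<forall>r. (\<forall>v. \<exists>j. \<forall>i\<ge>j. \<forall>s\<in>S i. v \<le> s r) \<longrightarrow> \<rho> r = 0)"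
proof (rule hr_lim[of P z l a S F x])
  fix \<rho>
  assume \<rho>: "hr P z l a (\<Union>i. S i) F (x 0) \<rho>" "\<rho> F = 0"
    "\<And>r v j. (\<And>i s. i \<ge> j \<Longrightarrow> s \<in> S i \<Longrightarrow> v \<le> s r) \<Longrightarrow> \<exists>\<^sub>\<infinity>i. x i r = v \<Longrightarrow> \<rho> r = v"
    "\<And>r. (\<And>v. \<exists>j. \<forall>i\<ge>j. \<forall>s\<in>S i. v \<le> s r) \<Longrightarrow> \<rho> r = 0"
  have "\<rho> r = v" if "\<forall>i. \<forall>s\<in>S i. v \<le> s r" "\<exists>\<^sub>\<infinity>i. x i r = v" for r v
    by (rule \<rho>(3)[of 0, OF _ that(2)]) (use that(1) in blast)
  then show ?thesis using \<rho>(1,2,4) by blast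
qed (rule assms)

lemma calc_exists:
  assumes "C H"
  shows "\<exists>c. \<forall>z \<sigma>. wps z (k+6) c (\<lambda>\<tau>. (\<tau> (k+6), \<tau> (k+7), \<tau> (k+8)) = hn (H z) (\<sigma> k) (\<sigma> (k+5), \<sigma> (k+3), \<sigma> (k+4))) \<sigma>"
proof -
  obtain cH where cH: "\<And>z j Q \<sigma>. j \<le> k+6 \<Longrightarrow>
    (\<And>\<tau>. \<forall>i<k+6. \<tau> i = \<sigma> i \<Longrightarrow> \<tau> (k+6) = H z (\<sigma> (k+6)) \<Longrightarrow> Q \<tau>) \<Longrightarrow> wps z j cH Q \<sigma>"
    by (rule C_call[OF assms(1), of "k+6"]) blast
  let ?mk = "Bas (Copy (k+3) (k+7)) ;; Bas (Copy (k+4) (k+8)) ;; encc (k+6) ;;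
     Bas (Copy (k+6) (k+8)) ;; Bas (Copy k (k+7)) ;; encc (k+6) ;;
     Bas (Copy (k+6) (k+8)) ;; Bas (Copy (k+5) (k+7)) ;; encc (k+6)"
  have mk: "wps z (k+6) ?mk (\<lambda>\<tau>. \<tau> (k+6) = prod_encode (\<sigma> (k+5), prod_encode (\<sigma> k, prod_encode (\<sigma> (k+3), \<sigma> (k+4))))) \<sigma>" for z \<sigma>
    apply (rule wps_Seq, rule wps_Copy, simp, rule wps_Seq, rule wps_Copy, simp, rule wps_Seq, rule wps_encc, simp)
    apply (rule wps_Seq, rule wps_Copy, simp, rule wps_Seq, rule wps_Copy, simp, rule wps_Seq, rule wps_encc, simp)
    apply (rule wps_Seq, rule wps_Copy, simp, rule wps_Seq, rule wps_Copy, simp, rule wps_encc, simp)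
    by (simp add: add.commute[of _ k])
  let ?Q = "\<lambda>\<sigma> z \<tau>. (\<tau> (k+6), \<tau> (k+7), \<tau> (k+8)) = hn (H z) (\<sigma> k) (\<sigma> (k+5), \<sigma> (k+3), \<sigma> (k+4))"
  text \<open>Later components are extracted into higher registers first, each call being free to
    overwrite everything above its own base.\<close>
  obtain u where u: "\<And>z \<sigma>. wps z (k+6) u (\<lambda>\<tau>. \<tau> (k+6) = pfst (\<sigma> (k+6)) \<and> \<tau> (k+7) = pfst (psnd (\<sigma> (k+6)))
      \<and> \<tau> (k+8) = psnd (psnd (\<sigma> (k+6)))) \<sigma>"
  proof -
    obtain s8 where s8: "\<And>z j Q \<sigma>. j \<le> k+8 \<Longrightarrow>
      (\<And>\<tau>. \<forall>i<k+8. \<tau> i = \<sigma> i \<Longrightarrow> \<tau> (k+8) = psnd (psnd (\<sigma> (k+8))) \<Longrightarrow> Q \<tau>) \<Longrightarrow> wps z j s8 Q \<sigma>"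
      by (rule C_call[OF C_psnd[OF C_psnd'], of "k+8"]) blast
    obtain f10 where f10: "\<And>z j Q \<sigma>. j \<le> k+10 \<Longrightarrow>
      (\<And>\<tau>. \<forall>i<k+10. \<tau> i = \<sigma> i \<Longrightarrow> \<tau> (k+10) = pfst (\<sigma> (k+10)) \<Longrightarrow> Q \<tau>) \<Longrightarrow> wps z j f10 Q \<sigma>"
      by (rule C_call[OF C_pfst', of "k+10"]) blast
    obtain t9 where t9: "\<And>z j Q \<sigma>. j \<le> k+9 \<Longrightarrow>
      (\<And>\<tau>. \<forall>i<k+9. \<tau> i = \<sigma> i \<Longrightarrow> \<tau> (k+9) = pfst (psnd (\<sigma> (k+9))) \<Longrightarrow> Q \<tau>) \<Longrightarrow> wps z j t9 Q \<sigma>"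
      by (rule C_call[OF C_pfst[OF C_psnd'], of "k+9"]) blast
    let ?u = "Bas (Copy (k+6) (k+8)) ;; s8 ;; Bas (Copy (k+6) (k+9)) ;; t9 ;; Bas (Copy (k+6) (k+10)) ;; f10 ;;
       Bas (Copy (k+9) (k+7)) ;; Bas (Copy (k+10) (k+6))"
    have "wps z (k+6) ?u (\<lambda>\<tau>. \<tau> (k+6) = pfst (\<sigma> (k+6)) \<and> \<tau> (k+7) = pfst (psnd (\<sigma> (k+6)))
      \<and> \<tau> (k+8) = psnd (psnd (\<sigma> (k+6)))) \<sigma>" for z \<sigma>
      apply (rule wps_Seq, rule wps_Copy, simp, rule wps_Seq, rule s8, simp)
      apply (rule wps_Seq, rule wps_Copy, simp, rule wps_Seq, rule t9, simp)
      apply (rule wps_Seq, rule wps_Copy, simp, rule wps_Seq, rule f10, simp)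
      apply (rule wps_Seq, rule wps_Copy, simp, rule wps_Copy, simp)
      by simp
    then show ?thesis using that by blast
  qed
  have "wps z (k+6) (?mk ;; cH ;; u) (?Q \<sigma> z) \<sigma>" for z \<sigma>
    apply (rule wps_Seq, rule wps_weaken[OF mk order_refl])
    apply (rule wps_Seq, rule cH, rule order_refl)
    apply (rule wps_weaken[OF u order_refl])
    by (simp add: hn_def Let_def)
  then show ?thesis by blast
qed

text \<open>The next state is computed from register \<open>k+6\<close> upwards while the main
  register \<open>k+3\<close> keeps its old value, and then a single \<open>Copy\<close> installs
  the new one. So \<open>k+3\<close> takes only the values of the two states and lower bounds
  persist. The flag \<open>k+5\<close> is cleared once per round and set to \<open>1\<close> before
  the head, hence it is \<open>0\<close> exactly at limits. A computed flag \<open>0\<close> clears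
  \<open>k+2\<close> and ends the loop.\<close>

definition mbody :: "nat \<Rightarrow> com \<Rightarrow> com" where
  "mbody k c = (c ;; Bas (Zero (k+5))) ;; (Bas (Copy (k+7) (k+3)) ;;
     Bas (Copy (k+8) (k+4)) ;; Bas (Inc (k+5)) ;; IfE (k+6) (k+1) (Bas (Zero (k+2))) (Bas (Zero (k+6))))"

definition mrel :: "nat \<Rightarrow> (nat \<Rightarrow> nat) \<Rightarrow> (nat \<Rightarrow> nat) \<Rightarrow> nat \<times> nat \<times> nat \<Rightarrow> bool" where
  "mrel k \<sigma>0 \<sigma> x \<longleftrightarrow> (case x of (f, s, K) \<Rightarrow> (\<forall>i<k+3. \<sigma> i = \<sigma>0 i) \<and> \<sigma> (k+3) = s \<and> \<sigma> (k+5) = f \<and> (f = 0 \<or> \<sigma> (k+4) = K))"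

definition mst :: "nat \<Rightarrow> (nat \<Rightarrow> nat) \<Rightarrow> nat \<Rightarrow> (nat \<Rightarrow> nat) set" where
  "mst k \<sigma>0 lo = {\<rho>. (\<forall>i<k+3. \<rho> i = \<sigma>0 i) \<and> lo \<le> \<rho> (k+3)}"

text \<open>At a limit the auxiliary register \<open>k+4\<close> is the liminf of whatever passed
  through it and is out of control. Therefore \<open>mrel\<close> drops it when the flag is
  \<open>0\<close>, and \<open>indep\<close> makes the next state independent of it.\<close>

lemma mr_hr:
  assumes c: "\<And>z \<sigma>. wps z (k+6) c (\<lambda>\<tau>. (\<tau> (k+6), \<tau> (k+7), \<tau> (k+8)) = hn (H z) (\<sigma> k) (\<sigma> (k+5), \<sigma> (k+3), \<sigma> (k+4))) \<sigma>"
    and code: "code_at P l (cmp (Whl (k+2) (k+1) (mbody k c)) l)"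
    and indep: "\<And>s K. hn (H z) (\<sigma>0 k) (0, s, K) = hn (H z) (\<sigma>0 k) (0, s, 0)"
    and \<sigma>0: "\<sigma>0 (k+1) = 0" "\<sigma>0 (k+2) = 1"
    and mr: "mr (hn (H z) (\<sigma>0 k)) lo x y" and rel: "mrel k \<sigma>0 \<sigma> x"
  shows "\<exists>\<tau>. mrel k \<sigma>0 \<tau> y \<and> hr P z l (mbody k c) (mst k \<sigma>0 lo) (k+5) \<sigma> \<tau>"
  using mr rel
proof (induction arbitrary: \<sigma> rule: mr.induct)
  case (mr_step f s K d' s' K' lo)
  note rel = mr_step.prems[unfolded mrel_def prod.case]
  let ?c1 = "c ;; Bas (Zero (k+5))" and ?cp = "Bas (Copy (k+7) (k+3))"
  let ?r = "Bas (Copy (k+8) (k+4)) ;; Bas (Inc (k+5)) ;; IfE (k+6) (k+1) (Bas (Zero (k+2))) (Bas (Zero (k+6)))"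
  have code1: "code_at P (Suc l) (cmp ?c1 (Suc l))" "code_at P (Suc l + csz ?c1) (cmp (?cp ;; ?r) (Suc l + csz ?c1))"
    using code_at_append[of P "Suc l" "cmp ?c1 (Suc l)" "cmp (?cp ;; ?r) (Suc l + csz ?c1)"]
      code_at_Whl(3)[OF code] unfolding mbody_def length_cmp cmp.simps(2)[of ?c1] by blast+
  have code2: "code_at P (Suc l + csz ?c1) (cmp ?cp (Suc l + csz ?c1))"
     "code_at P (Suc l + csz ?c1 + csz ?cp) (cmp ?r (Suc l + csz ?c1 + csz ?cp))"
    using code_at_append[of P "Suc l + csz ?c1" "cmp ?cp (Suc l + csz ?c1)"] code1(2)
    unfolding length_cmp cmp.simps(2)[of ?cp] by blast+
  have h: "hn (H z) (\<sigma> k) (\<sigma> (k+5), \<sigma> (k+3), \<sigma> (k+4)) = (Suc d', s', K')"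
    using rel mr_step.hyps(1) indep by (metis less_add_same_cancel1 zero_less_numeral)
  have "wps z (k+5) ?c1 (\<lambda>\<tau>. \<tau> (k+5) = 0 \<and> \<tau> (k+6) = Suc d' \<and> \<tau> (k+7) = s' \<and> \<tau> (k+8) = K') \<sigma>"
    apply (rule wps_Seq, rule wps_weaken[OF c], simp, rule wps_Zero, simp)
    using h by simp
  then obtain \<rho> where \<rho>: "\<rho> (k+5) = 0 \<and> \<rho> (k+6) = Suc d' \<and> \<rho> (k+7) = s' \<and> \<rho> (k+8) = K'"
     "ex P z (Suc l) ?c1 \<sigma> (fr (k+5) \<sigma>) \<rho>" "\<rho> \<in> fr (k+5) \<sigma>"
    by (rule wpsE[OF _ code1(1)])
  define \<rho>' where "\<rho>' = \<rho>(k+3 := s')"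
  have \<rho>_eq: "\<rho> i = \<sigma> i" if "i < k+5" for i using \<rho>(3) that by (simp add: fr_def)
  have lt: "\<rho>' (k+1) = 0" using rel \<rho>_eq[of "k+1"] \<sigma>0 by (simp add: \<rho>'_def)
  have S: "fr (k+5) \<sigma> \<subseteq> mst k \<sigma>0 lo"
    using rel mr_step.hyps(2) by (auto simp: fr_def mst_def)
  have cp: "ex P z (Suc l + csz ?c1) ?cp \<rho> (mst k \<sigma>0 lo) \<rho>'"
    using ex_Bas[OF code2(1), of \<rho> "mst k \<sigma>0 lo" z] \<rho>(1,3) S by (simp add: \<rho>'_def subsetD)
  have "wps z (k+4) ?r (\<lambda>\<tau>. \<tau> (k+4) = K' \<and> \<tau> (k+5) = 1) \<rho>'"
    apply (rule wps_Seq, rule wps_Copy, simp, rule wps_Seq, rule wps_Inc, simp, rule wps_IfE)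
    subgoal using lt \<rho> by (simp add: \<rho>'_def)
    subgoal by (rule wps_Zero) (use \<rho> in \<open>simp_all add: \<rho>'_def\<close>)
    done
  then obtain \<tau> where \<tau>: "\<tau> (k+4) = K' \<and> \<tau> (k+5) = 1" "ex P z (Suc l + csz ?c1 + csz ?cp) ?r \<rho>' (fr (k+4) \<rho>') \<tau>"
      "\<tau> \<in> fr (k+4) \<rho>'"
    by (rule wpsE[OF _ code2(2)])
  have S': "fr (k+4) \<rho>' \<subseteq> mst k \<sigma>0 lo"
    using rel \<rho>_eq mr_step.hyps(3) by (auto simp: fr_def mst_def \<rho>'_def)
  have 2: "ex P z (Suc l + csz ?c1) (?cp ;; ?r) \<rho> (mst k \<sigma>0 lo) \<tau>"
    by (rule ex_Seq[OF cp ex_mono[OF \<tau>(2) S']])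
  have 1: "ex P z (Suc l) ?c1 \<sigma> (mst k \<sigma>0 lo) \<rho>" by (rule ex_mono[OF \<rho>(2) S])
  have "hr P z l (?c1 ;; (?cp ;; ?r)) (mst k \<sigma>0 lo) (k+5) \<sigma> \<tau>"
  proof (rule hr_iter[OF _ _ 1 2])
    show "code_at P l (cmp (Whl (k+2) (k+1) (?c1 ;; (?cp ;; ?r))) l)" using code unfolding mbody_def .
    show "\<sigma> (k+2) \<noteq> \<sigma> (k+1)" using rel \<sigma>0 by simp
    show "\<sigma> \<in> mst k \<sigma>0 lo" using fr_refl S by blast
    show "\<tau> \<in> mst k \<sigma>0 lo" using \<tau>(3) S' by blast
    show "\<rho> (k+5) = 0" using \<rho>(1) by blast
  qed
  moreover have "mrel k \<sigma>0 \<tau> (1, s', K')"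
    using \<tau>(1,3) rel \<rho>_eq unfolding mrel_def by (simp add: fr_def \<rho>'_def)
  ultimately show ?case unfolding mbody_def by blast
next
  case (mr_trans lo x y w)
  then obtain \<rho> where \<rho>: "mrel k \<sigma>0 \<rho> y" "hr P z l (mbody k c) (mst k \<sigma>0 lo) (k+5) \<sigma> \<rho>" by blast
  obtain \<tau> where "mrel k \<sigma>0 \<tau> w" "hr P z l (mbody k c) (mst k \<sigma>0 lo) (k+5) \<rho> \<tau>"
    using mr_trans.IH(2)[OF \<rho>(1)] by blast
  then show ?case using hr_trans[OF \<rho>(2)] by blast
next
  case (mr_lim v x lo)
  have "\<exists>g. \<forall>n. (mrel k \<sigma>0 (g n) (x n) \<and> (n = 0 \<longrightarrow> g n = \<sigma>)) \<and>
      hr P z l (mbody k c) (mst k \<sigma>0 v) (k+5) (g n) (g (Suc n))"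
    by (rule dependent_nat_choice) (use mr_lim in blast)+
  then obtain g where g: "\<And>n. mrel k \<sigma>0 (g n) (x n)" "g 0 = \<sigma>"
    "\<And>n. hr P z l (mbody k c) (mst k \<sigma>0 v) (k+5) (g n) (g (Suc n))" by blast
  obtain \<rho> where \<rho>: "hr P z l (mbody k c) (\<Union>i::nat. mst k \<sigma>0 v) (k+5) (g 0) \<rho>" "\<rho> (k+5) = 0"
    "\<forall>r u. (\<forall>i::nat. \<forall>s\<in>mst k \<sigma>0 v. u \<le> s r) \<longrightarrow> (\<exists>\<^sub>\<infinity>i. g i r = u) \<longrightarrow> \<rho> r = u"
    using hr_limit[of P z l "mbody k c" "\<lambda>_. mst k \<sigma>0 v" "k+5" g, OF g(3)] by blast
  have "\<rho> i = \<sigma>0 i" if "i < k+3" for i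
    using that by (intro \<rho>(3)[rule_format])
      (use g(1) in \<open>auto simp: mst_def mrel_def INFM_nat_le split: prod.splits\<close>)
  moreover have "\<rho> (k+3) = v"
  proof (rule \<rho>(3)[rule_format])
    have "g i (k+3) = fst (snd (x i))" for i using g(1)[of i] by (auto simp: mrel_def split: prod.splits)
    then show "\<exists>\<^sub>\<infinity>i. g i (k+3) = v" using mr_lim.hyps by simp
  qed (simp add: mst_def)
  ultimately have "mrel k \<sigma>0 \<rho> (0, v, 0)" using \<rho>(2) by (simp add: mrel_def)
  moreover have "(\<Union>i::nat. mst k \<sigma>0 v) \<subseteq> mst k \<sigma>0 lo" using mr_lim.hyps by (auto simp: mst_def)
  ultimately show ?case using hr_mono[OF \<rho>(1)] g(2) by blast
next
  case (mr_over m x)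
  have "\<exists>g. \<forall>n. (mrel k \<sigma>0 (g n) (x n) \<and> (n = 0 \<longrightarrow> g n = \<sigma>)) \<and>
      hr P z l (mbody k c) (mst k \<sigma>0 (m n)) (k+5) (g n) (g (Suc n))"
    by (rule dependent_nat_choice) (use mr_over in blast)+
  then obtain g where g: "\<And>n. mrel k \<sigma>0 (g n) (x n)" "g 0 = \<sigma>"
    "\<And>n. hr P z l (mbody k c) (mst k \<sigma>0 (m n)) (k+5) (g n) (g (Suc n))" by blast
  obtain \<rho> where \<rho>: "hr P z l (mbody k c) (\<Union>i. mst k \<sigma>0 (m i)) (k+5) (g 0) \<rho>" "\<rho> (k+5) = 0"
    "\<forall>r u. (\<forall>i. \<forall>s\<in>mst k \<sigma>0 (m i). u \<le> s r) \<longrightarrow> (\<exists>\<^sub>\<infinity>i. g i r = u) \<longrightarrow> \<rho> r = u"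
    "\<forall>r. (\<forall>v. \<exists>j. \<forall>i\<ge>j. \<forall>s\<in>mst k \<sigma>0 (m i). v \<le> s r) \<longrightarrow> \<rho> r = 0"
    using hr_limit[of P z l "mbody k c" "\<lambda>i. mst k \<sigma>0 (m i)" "k+5" g, OF g(3)] by blast
  have "\<rho> i = \<sigma>0 i" if "i < k+3" for i
    using that by (intro \<rho>(3)[rule_format])
      (use g(1) in \<open>auto simp: mst_def mrel_def INFM_nat_le split: prod.splits\<close>)
  moreover have "\<rho> (k+3) = 0"
  proof (rule \<rho>(4)[rule_format])
    fix v
    obtain j where "\<forall>i\<ge>j. v \<le> m i" using mr_over.hyps by blast
    then show "\<exists>j. \<forall>i\<ge>j. \<forall>s\<in>mst k \<sigma>0 (m i). v \<le> s (k+3)" by (force simp: mst_def)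
  qed
  ultimately have "mrel k \<sigma>0 \<rho> (0, 0, 0)" using \<rho>(2) by (simp add: mrel_def)
  moreover have "(\<Union>i. mst k \<sigma>0 (m i)) \<subseteq> mst k \<sigma>0 0" by (auto simp: mst_def)
  ultimately show ?case using hr_mono[OF \<rho>(1)] g(2) by blast
qed

text \<open>A next state with flag \<open>0\<close> is the signal to stop, with the result as its
  main component. The start state \<open>(1, 1, 0)\<close> has flag \<open>1\<close>, as no limit
  has been passed yet.\<close>

lemma C_mach:
  assumes "C H"
    and indep: "\<And>z p s K. hn (H z) p (0, s, K) = hn (H z) p (0, s, 0)"
    and run: "\<And>z p. \<exists>lo y K. mr (hn (H z) p) lo (1, 1, 0) y \<and> hn (H z) p y = (0, g z p, K)"
  shows "C g"
proof (rule C_I)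
  fix k
  obtain c where c: "\<And>z \<sigma>. wps z (k+6) c (\<lambda>\<tau>. (\<tau> (k+6), \<tau> (k+7), \<tau> (k+8)) = hn (H z) (\<sigma> k) (\<sigma> (k+5), \<sigma> (k+3), \<sigma> (k+4))) \<sigma>"
    using calc_exists[OF assms(1), of k] by blast
  let ?W = "Whl (k+2) (k+1) (mbody k c)"
  have W: "wps z k ?W (\<lambda>\<tau>. \<tau> (k+3) = g z (\<sigma> k)) \<sigma>"
    if \<sigma>: "\<sigma> (k+1) = 0" "\<sigma> (k+2) = 1" "\<sigma> (k+3) = 1" "\<sigma> (k+4) = 0" "\<sigma> (k+5) = 1" for z \<sigma>
  proof (rule wpsI)
    fix P l assume code: "code_at P l (cmp ?W l)"
    obtain lo y K where y: "mr (hn (H z) (\<sigma> k)) lo (1, 1, 0) y" "hn (H z) (\<sigma> k) y = (0, g z (\<sigma> k), K)"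
      using run by blast
    have "mrel k \<sigma> \<sigma> (1, 1, 0)" using \<sigma> by (simp add: mrel_def)
    have "\<exists>\<rho>. mrel k \<sigma> \<rho> y \<and> hr P z l (mbody k c) (mst k \<sigma> lo) (k+5) \<sigma> \<rho>"
      by (rule mr_hr[where H = H and x = "(1, 1, 0)"]) fact+
    then obtain \<rho> where \<rho>: "mrel k \<sigma> \<rho> y" "hr P z l (mbody k c) (mst k \<sigma> lo) (k+5) \<sigma> \<rho>" by blast
    obtain f s K' where y': "y = (f, s, K')" by (cases y)
    have rel: "\<forall>i<k+3. \<rho> i = \<sigma> i" "\<rho> (k+3) = s" "\<rho> (k+5) = f" "f = 0 \<or> \<rho> (k+4) = K'"
      using \<rho>(1) unfolding y' mrel_def by auto
    have h: "hn (H z) (\<rho> k) (\<rho> (k+5), \<rho> (k+3), \<rho> (k+4)) = (0, g z (\<sigma> k), K)"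
      using rel y(2) indep unfolding y' by (metis less_add_same_cancel1 zero_less_numeral)
    have "\<rho> (k+1) = 0" "\<rho> (k+2) = 1" using rel(1) \<sigma> by auto
    have "wps z k (mbody k c) (\<lambda>\<tau>. \<tau> (k+3) = g z (\<sigma> k) \<and> \<tau> (k+2) = \<tau> (k+1)) \<rho>"
      unfolding mbody_def
      apply (rule wps_Seq, rule wps_Seq, rule wps_weaken[OF c], simp, rule wps_Zero, simp)
      apply (rule wps_Seq, rule wps_Copy, simp, rule wps_Seq, rule wps_Copy, simp, rule wps_Seq, rule wps_Inc, simp,
         rule wps_IfE)
      subgoal using h \<open>\<rho> (k+1) = 0\<close> by (intro wps_Zero) auto
      subgoal using h \<open>\<rho> (k+1) = 0\<close> by simp
      done
    then obtain \<tau> where \<tau>: "\<tau> (k+3) = g z (\<sigma> k) \<and> \<tau> (k+2) = \<tau> (k+1)"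
       "ex P z (Suc l) (mbody k c) \<rho> (fr k \<rho>) \<tau>" "\<tau> \<in> fr k \<rho>"
      by (rule wpsE[OF _ code_at_Whl(3)[OF code]])
    have ne: "\<rho> (k+2) \<noteq> \<rho> (k+1)" using \<open>\<rho> (k+1) = 0\<close> \<open>\<rho> (k+2) = 1\<close> by simp
    have "ex P z l ?W \<tau> (fr k \<rho>) \<tau>" using ex_Whl_exit[OF code _ \<tau>(3)] \<tau>(1) by blast
    then have "ex P z l ?W \<rho> (fr k \<rho>) \<tau>"
      using ex_Whl_iter[OF code ne \<tau>(2) _ fr_refl \<tau>(3)] by blast
    moreover have eq: "fr k \<rho> = fr k \<sigma>" using rel(1) by (intro fr_eq) (simp add: fr_def)
    moreover have "mst k \<sigma> lo \<subseteq> fr k \<sigma>" by (auto simp: mst_def fr_def)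
    ultimately have "ex P z l ?W \<sigma> (fr k \<sigma>) \<tau>" using ex_Whl_hr[OF \<rho>(2)] by simp
    then show "\<exists>\<tau>. \<tau> (k+3) = g z (\<sigma> k) \<and> ex P z l ?W \<sigma> (fr k \<sigma>) \<tau> \<and> \<tau> \<in> fr k \<sigma>"
      using \<tau>(1,3) eq by blast
  qed
  let ?c = "Bas (Zero (k+1)) ;; Bas (Zero (k+2)) ;; Bas (Inc (k+2)) ;; Bas (Zero (k+3)) ;; Bas (Inc (k+3)) ;;
     Bas (Zero (k+4)) ;; Bas (Zero (k+5)) ;; Bas (Inc (k+5)) ;; ?W ;; Bas (Copy (k+3) k)"
  have "wps z k ?c (\<lambda>\<tau>. \<tau> k = g z (\<sigma> k)) \<sigma>" for z \<sigma>
    apply (rule wps_Seq, rule wps_Zero, simp, rule wps_Seq, rule wps_Zero, simp, rule wps_Seq, rule wps_Inc, simp)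
    apply (rule wps_Seq, rule wps_Zero, simp, rule wps_Seq, rule wps_Inc, simp, rule wps_Seq, rule wps_Zero, simp)
    apply (rule wps_Seq, rule wps_Zero, simp, rule wps_Seq, rule wps_Inc, simp, rule wps_Seq)
    apply (rule wps_weaken[OF W order_refl])
    apply simp_all[5]
    by (rule wps_Copy) simp_all
  then show "\<exists>c. \<forall>z \<sigma>. wps z k c (\<lambda>\<tau>. \<tau> k = g z (\<sigma> k)) \<sigma>" by blast
qed

text \<open>The main register stays at \<open>1\<close> and the counter is auxiliary. If omega
  rounds bring no witness, the flag reveals the limit and the search has failed; this decides an
  unbounded existential quantifier. Successful results are shifted by one to keep \<open>0\<close>
  for failure.\<close>

lemma C_search:
  assumes p: "C p"
  shows "C (\<lambda>z n. if \<exists>m. p z (prod_encode (n, m)) \<noteq> 0 then Suc (LEAST m. p z (prod_encode (n, m)) \<noteq> 0) else 0)"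
proof (rule C_mach)
  let ?H = "\<lambda>z x. if pfst x = 0 then prod_encode (0, prod_encode (0, 0))
    else if psnd (psnd (psnd x)) = 0 then prod_encode (1, prod_encode (1, 1))
    else if p z (prod_encode (pfst (psnd x), psnd (psnd (psnd x)) - 1)) = 0
      then prod_encode (1, prod_encode (1, Suc (psnd (psnd (psnd x)))))
    else prod_encode (0, prod_encode (psnd (psnd (psnd x)), 0))"
  show "C ?H"
    by (intro C_if C_pair C_pfst C_psnd C_Suc C_pred C_comp[OF p] C_id C_const)
  show "hn (?H z) n (0, s, K) = hn (?H z) n (0, s, 0)" for z n s K
    by (simp add: hn_def)
  fix z n
  let ?h = "hn (?H z) n"
  have h: "?h (1, s, K) = (if K = 0 then (1, 1, 1) else if p z (prod_encode (n, K - 1)) = 0 then (1, 1, Suc K) else (0, K, 0))"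
    for s K by (simp add: hn_def)
  have h0: "?h (0, s, K) = (0, 0, 0)" for s K by (simp add: hn_def)
  have st: "mr ?h 1 (1, 1, K) (1, 1, Suc K)" if "K > 0 \<Longrightarrow> p z (prod_encode (n, K - 1)) = 0" for K
    by (rule mr_step[of _ _ _ _ 0]) (use h that in auto)
  show "\<exists>lo y K. mr ?h lo (1, 1, 0) y \<and> ?h y =
     (0, if \<exists>m. p z (prod_encode (n, m)) \<noteq> 0 then Suc (LEAST m. p z (prod_encode (n, m)) \<noteq> 0) else 0, K)"
  proof (cases "\<exists>m. p z (prod_encode (n, m)) \<noteq> 0")
    case True
    define m where "m = (LEAST m. p z (prod_encode (n, m)) \<noteq> 0)"
    have m: "p z (prod_encode (n, m)) \<noteq> 0" unfolding m_def using True by (rule LeastI_ex)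
    have lt: "p z (prod_encode (n, j)) = 0" if "j < m" for j
      using not_less_Least[OF that[unfolded m_def]] by simp
    have "j \<le> m \<Longrightarrow> mr ?h 1 (1, 1, 0) (1, 1, Suc j)" for j
    proof (induction j)
      case 0
      show ?case using st[of 0] by simp
    next
      case (Suc j)
      then have "mr ?h 1 (1, 1, Suc j) (1, 1, Suc (Suc j))" using lt[of j] by (intro st) simp
      then show ?case using Suc by (blast intro: mr_trans Suc_leD)
    qed
    then have "mr ?h 1 (1, 1, 0) (1, 1, Suc m)" by simp
    moreover have "?h (1, 1, Suc m) = (0, Suc m, 0)" using h m by simp
    moreover have "(if \<exists>m. p z (prod_encode (n, m)) \<noteq> 0 then Suc (LEAST m. p z (prod_encode (n, m)) \<noteq> 0) else 0) = Suc m"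
      using True m_def by (simp only: if_True)
    ultimately show ?thesis by (intro exI conjI) (simp_all only:)
  next
    case False
    have "mr ?h 1 ((\<lambda>i. (1, 1, i)) 0) (0, 1, 0)"
    proof (rule mr_lim[of ?h 1 "\<lambda>i. (1, 1, i)"])
      show "mr ?h 1 (1, 1, i) (1, 1, Suc i)" for i by (rule st) (use False in blast)
    qed (simp_all add: INFM_nat_le)
    then show ?thesis using False by (intro exI conjI) (assumption, simp only: h0 if_False)
  qed
qed

text \<open>Depth first search for an infinite branch. The current node, a list with the latest entry in front,
  is kept in the main register. If all children of a node have been exhausted, the node itself is the
  limit inferior of the nodes visited; along an infinite branch the register overflows.\<close>

inductive dead :: "(nat list \<Rightarrow> bool) \<Rightarrow> nat list \<Rightarrow> bool" for T where
  deadI: "(\<And>j. T (j # L) \<Longrightarrow> dead T (j # L)) \<Longrightarrow> dead T L"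

text \<open>Not being dead passes on to some child in the tree, and dependent choice produces a
  branch; conversely no node on a branch is dead. Initial segments appear reversed because nodes
  carry their latest entry in front.\<close>

lemma dead_Nil_iff: "\<not> dead T [] \<longleftrightarrow> (\<exists>\<sigma>. \<forall>n. T (rev (map \<sigma> [0..<Suc n])))"
proof
  assume nd: "\<not> dead T []"
  have "\<exists>f. \<forall>n. (\<not> dead T (f n) \<and> (n = 0 \<longrightarrow> f n = [])) \<and> (\<exists>j. f (Suc n) = j # f n \<and> T (j # f n))"
    by (rule dependent_nat_choice) (use nd deadI[of T] in blast)+
  then obtain f where f: "f 0 = []" "\<And>n. \<exists>j. f (Suc n) = j # f n \<and> T (j # f n)" by blast
  define \<sigma> where "\<sigma> n = hd (f (Suc n))" for n
  have "f n = rev (map \<sigma> [0..<n])" for n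
  proof (induction n)
    case (Suc n)
    then show ?case using f(2)[of n] by (auto simp: \<sigma>_def)
  qed (simp add: f(1))
  then show "\<exists>\<sigma>. \<forall>n. T (rev (map \<sigma> [0..<Suc n]))" using f(2) by metis
next
  assume "\<exists>\<sigma>. \<forall>n. T (rev (map \<sigma> [0..<Suc n]))"
  then obtain \<sigma> where \<sigma>: "\<And>n. T (rev (map \<sigma> [0..<Suc n]))" by blast
  have "dead T L \<Longrightarrow> L \<noteq> rev (map \<sigma> [0..<m])" for L m
  proof (induction arbitrary: m rule: dead.induct)
    case (deadI L)
    show ?case
    proof
      assume "L = rev (map \<sigma> [0..<m])"
      then have "\<sigma> m # L = rev (map \<sigma> [0..<Suc m])" by simp
      then show False using deadI(2)[of "\<sigma> m" "Suc m"] \<sigma>[of m] by simp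
    qed
  qed
  from this[of "[]" 0] show "\<not> dead T []" by auto
qed

text \<open>The shift by one reserves \<open>0\<close> for overflow, so a limit with main register
  \<open>0\<close> comes from an infinite branch.\<close>

abbreviation "sc L \<equiv> Suc (list_encode L)"

text \<open>Descendants have larger codes: while the search stays in the subtree of
  \<open>L\<close>, the main register is at least \<open>sc L\<close>, and infinitely many returns
  to \<open>L\<close> make \<open>sc L\<close> the liminf.\<close>

lemma sc_le: "sc L < sc (j # L)"
  using le_prod_encode_2[of "list_encode L" j] by simp

locale dfs =
  fixes h :: "nat \<times> nat \<times> nat \<Rightarrow> nat \<times> nat \<times> nat" and T :: "nat list \<Rightarrow> bool"
  assumes next_step: "h (1, sc L, K) = (if T (K # L) then (1, sc (K # L), 0) else (1, sc L, Suc K))"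
    and pop: "h (0, sc (j # L), K) = (1, sc L, Suc j)"
begin

lemma sweep:
  assumes "T (j # L) \<Longrightarrow> mr h (sc (j # L)) (1, sc (j # L), 0) (0, sc (j # L), 0)"
  shows "mr h (sc L) (1, sc L, j) (1, sc L, Suc j)"
proof (cases "T (j # L)")
  case True
  have le: "sc L \<le> sc (j # L)" using sc_le by (rule less_imp_le)
  have "mr h (sc L) (1, sc L, j) (1, sc (j # L), 0)"
    using le True by (intro mr_step[of _ _ _ _ 0]) (auto simp: next_step simp del: list_encode.simps One_nat_def)
  moreover have "mr h (sc L) (1, sc (j # L), 0) (0, sc (j # L), 0)"
    by (rule mr_mono[OF assms[OF True] le])
  moreover have "mr h (sc L) (0, sc (j # L), 0) (1, sc L, Suc j)"
    using le pop[of j L 0] by (intro mr_step[of _ _ _ _ 0]) (auto simp del: list_encode.simps)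
  ultimately show ?thesis by (blast intro: mr_trans)
next
  case False
  then show ?thesis by (intro mr_step[of _ _ _ _ 0]) (auto simp: next_step simp del: list_encode.simps One_nat_def)
qed

text \<open>By induction the search through the subtree of a child ends in a limit at that child,
  and \<open>pop\<close> leads on to the next sibling. After omega siblings the liminf is
  \<open>sc L\<close>.\<close>

lemma dead_run: "dead T L \<Longrightarrow> mr h (sc L) (1, sc L, 0) (0, sc L, 0)"
proof (induction rule: dead.induct)
  case (deadI L)
  have "mr h (sc L) (1, sc L, j) (1, sc L, Suc j)" for j by (rule sweep) (rule deadI(2))
  then show ?case
    using mr_lim[of h "sc L" "\<lambda>i. (1, sc L, i)" "sc L"] by (simp add: INFM_nat_le del: list_encode.simps)
qed

text \<open>The leftmost child that is in the tree and not dead is reached after finitely many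
  sweeps, since each sibling before it is outside the tree or dead.\<close>

lemma alive_step:
  assumes "\<not> dead T L"
  shows "\<exists>j. T (j # L) \<and> \<not> dead T (j # L) \<and> mr h (sc L) (1, sc L, 0) (1, sc (j # L), 0)"
proof -
  have ex: "\<exists>j. T (j # L) \<and> \<not> dead T (j # L)" using assms deadI[of T L] by blast
  define j where "j = (LEAST j. T (j # L) \<and> \<not> dead T (j # L))"
  have j: "T (j # L) \<and> \<not> dead T (j # L)" unfolding j_def using ex by (rule LeastI_ex)
  have lt: "dead T (i # L)" if "i < j" "T (i # L)" for i
    using not_less_Least[OF that(1)[unfolded j_def]] that(2) by blast
  have push: "mr h (sc L) (1, sc L, j) (1, sc (j # L), 0)"
    using sc_le[of L j] j by (intro mr_step[of _ _ _ _ 0]) (auto simp: next_step simp del: list_encode.simps One_nat_def)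
  have "i < j \<Longrightarrow> mr h (sc L) (1, sc L, 0) (1, sc L, Suc i)" for i
  proof (induction i)
    case 0
    show ?case by (rule sweep) (use dead_run lt 0 in blast)
  next
    case (Suc i)
    have "mr h (sc L) (1, sc L, Suc i) (1, sc L, Suc (Suc i))"
      by (rule sweep) (use dead_run lt Suc in blast)
    then show ?case using Suc mr_trans Suc_lessD by blast
  qed
  then have "j = 0 \<or> mr h (sc L) (1, sc L, 0) (1, sc L, j)"
    by (cases j) (auto simp del: list_encode.simps)
  then have "mr h (sc L) (1, sc L, 0) (1, sc (j # L), 0)" using push mr_trans by blast
  then show ?thesis using j by blast
qed

lemma alive_run:
  assumes "\<not> dead T []"
  shows "mr h 0 (1, 1, 0) (0, 0, 0)"
proof -
  have "\<exists>f. \<forall>n. (\<not> dead T (f n) \<and> (n = 0 \<longrightarrow> f n = [])) \<and>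
      (sc (f n) < sc (f (Suc n)) \<and> mr h (sc (f n)) (1, sc (f n), 0) (1, sc (f (Suc n)), 0))"
  proof (rule dependent_nat_choice)
    show "\<exists>x. \<not> dead T x \<and> ((0::nat) = 0 \<longrightarrow> x = [])" using assms by blast
    fix L and n :: nat assume "\<not> dead T L \<and> (n = 0 \<longrightarrow> L = [])"
    then obtain j where "\<not> dead T (j # L)" "mr h (sc L) (1, sc L, 0) (1, sc (j # L), 0)"
      using alive_step by blast
    then show "\<exists>y. (\<not> dead T y \<and> (Suc n = 0 \<longrightarrow> y = [])) \<and> sc L < sc y \<and> mr h (sc L) (1, sc L, 0) (1, sc y, 0)"
      using sc_le[of L j] by blast
  qed
  then obtain f where f: "f 0 = []" "\<And>n. sc (f n) < sc (f (Suc n))"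
    "\<And>n. mr h (sc (f n)) (1, sc (f n), 0) (1, sc (f (Suc n)), 0)" by blast
  have ge: "n \<le> sc (f n)" for n
  proof (induction n)
    case (Suc n)
    then show ?case using f(2)[of n] by linarith
  qed simp
  have "mr h 0 ((\<lambda>n. (1, sc (f n), 0)) 0) (0, 0, 0)"
  proof (rule mr_over[of h "\<lambda>n. sc (f n)" "\<lambda>n. (1, sc (f n), 0)"])
    show "\<exists>j. \<forall>i\<ge>j. v \<le> sc (f i)" for v using ge by (meson order_trans)
  qed (rule f(3))
  then show ?thesis by (simp add: f(1))
qed

end

lemma C_souslin:
  assumes A: "C A"
  shows "C (\<lambda>z p. of_bool (\<exists>\<sigma>. \<forall>n. A z (prod_encode (p, list_encode (rev (map \<sigma> [0..<Suc n])))) \<noteq> 0))"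
proof (rule C_mach)
  let ?K = "\<lambda>x. psnd (psnd (psnd x))" and ?s = "\<lambda>x. pfst (psnd (psnd x))" and ?p = "\<lambda>x. pfst (psnd x)"
  \<comment> \<open>For \<open>s = sc L\<close> this is the code of the child
    \<open>K # L\<close>.\<close>
  let ?q = "\<lambda>x. Suc (prod_encode (?K x, ?s x - 1))"
  \<comment> \<open>On flag \<open>0\<close>, main value \<open>0\<close> is an overflow, that is,
    an infinite branch; value \<open>1 = sc []\<close> means that the root is exhausted; otherwise
    \<open>s - 2\<close> is the pair of \<open>j\<close> and the code of \<open>L\<close>, and the
    search goes on at \<open>L\<close> with child \<open>Suc j\<close>.\<close>
  let ?H = "\<lambda>z x. if pfst x = 0
     then (if ?s x = 0 then prod_encode (0, prod_encode (1, 0))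
       else if ?s x - 1 = 0 then prod_encode (0, prod_encode (0, 0))
       else prod_encode (1, prod_encode (Suc (psnd (?s x - 1 - 1)), Suc (pfst (?s x - 1 - 1)))))
     else if A z (prod_encode (?p x, ?q x)) = 0 then prod_encode (1, prod_encode (?s x, Suc (?K x)))
     else prod_encode (1, prod_encode (Suc (?q x), 0))"
  show "C ?H"
    by (intro C_if C_pair C_pfst C_psnd C_Suc C_pred C_comp[OF A] C_id C_const)
  show "hn (?H z) p (0, s, K) = hn (?H z) p (0, s, 0)" for z p s K
    by (simp add: hn_def Let_def)
  fix z p
  let ?h = "hn (?H z) p"
  let ?T = "\<lambda>L. A z (prod_encode (p, list_encode L)) \<noteq> 0"
  interpret dfs ?h ?T
    by unfold_locales (simp_all add: hn_def Let_def)
  have end1: "?h (0, 0, 0) = (0, 1, 0)" and end0: "?h (0, sc [], 0) = (0, 0, 0)"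
    by (simp_all add: hn_def Let_def)
  show "\<exists>lo y K. mr ?h lo (1, 1, 0) y \<and> ?h y =
     (0, of_bool (\<exists>\<sigma>. \<forall>n. A z (prod_encode (p, list_encode (rev (map \<sigma> [0..<Suc n])))) \<noteq> 0), K)"
    unfolding dead_Nil_iff[of ?T, symmetric]
  proof (cases "dead ?T []")
    case True
    have "mr ?h 1 (1, 1, 0) (0, 1, 0)" using dead_run[OF True] by simp
    moreover have "?h (0, 1, 0) = (0, of_bool (\<not> dead ?T []), 0)" using end0 True
      by (simp only: list_encode.simps One_nat_def of_bool_eq simp_thms)
    ultimately show "\<exists>lo y K. mr ?h lo (1, 1, 0) y \<and> ?h y = (0, of_bool (\<not> dead ?T []), K)"
      by (intro exI conjI)
  next
    case False
    have "?h (0, 0, 0) = (0, of_bool (\<not> dead ?T []), 0)" using end1 False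
      by (simp only: of_bool_eq simp_thms)
    then show "\<exists>lo y K. mr ?h lo (1, 1, 0) y \<and> ?h y = (0, of_bool (\<not> dead ?T []), K)"
      by (intro exI conjI) (rule alive_run[OF False])
  qed
qed

subsection \<open>Decidable relations on coded objects\<close>

text \<open>With a bijection every number is a code, so quantifiers over the type are number
  quantifiers, which search can decide.\<close>

class enc =
  fixes enc :: "'a \<Rightarrow> nat"
  assumes bij_enc: "bij enc"

instantiation nat :: enc
begin
definition "enc (n :: nat) = n"
instance by standard (simp add: enc_nat_def[abs_def] bij_id[unfolded id_def])
end

instantiation prod :: (enc, enc) enc
begin
definition "enc p = prod_encode (enc (fst p), enc (snd p))"
instance
proof
  have "bij (map_prod (enc :: 'a \<Rightarrow> nat) (enc :: 'b \<Rightarrow> nat))"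
    using bij_betw_map_prod[OF bij_enc bij_enc] by simp
  then have "bij (prod_encode \<circ> map_prod (enc :: 'a \<Rightarrow> nat) (enc :: 'b \<Rightarrow> nat))"
    using bij_prod_encode by (rule bij_comp)
  moreover have "(enc :: 'a \<times> 'b \<Rightarrow> nat) = prod_encode \<circ> map_prod enc enc"
    by (auto simp: enc_prod_def fun_eq_iff)
  ultimately show "bij (enc :: 'a \<times> 'b \<Rightarrow> nat)" by simp
qed
end

instantiation list :: (enc) enc
begin
definition "enc l = list_encode (map enc l)"
instance
proof
  have "bij (map (enc :: 'a \<Rightarrow> nat))"
  proof (rule bijI)
    show "inj (map (enc :: 'a \<Rightarrow> nat))" by (rule inj_mapI[OF bij_is_inj[OF bij_enc]])
    have "map enc (map (inv (enc :: 'a \<Rightarrow> nat)) l) = l" for l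
      by (simp add: map_idI surj_f_inv_f[OF bij_is_surj[OF bij_enc]])
    then show "surj (map (enc :: 'a \<Rightarrow> nat))" by (metis surjI)
  qed
  then have "bij (list_encode \<circ> map (enc :: 'a \<Rightarrow> nat))"
    using bij_list_encode by (rule bij_comp)
  moreover have "(enc :: 'a list \<Rightarrow> nat) = list_encode \<circ> map enc"
    by (auto simp: enc_list_def fun_eq_iff)
  ultimately show "bij (enc :: 'a list \<Rightarrow> nat)" by simp
qed
end

definition dcd :: "nat \<Rightarrow> 'a::enc" where "dcd = inv enc"

lemma dcd_enc [simp]: "dcd (enc x) = x"
  unfolding dcd_def by (rule inv_f_f[OF bij_is_inj[OF bij_enc]])

lemma enc_dcd [simp]: "enc (dcd n :: 'a::enc) = n"
  unfolding dcd_def by (rule surj_f_inv_f[OF bij_is_surj[OF bij_enc]])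

lemma enc_eq_iff: "enc x = enc y \<longleftrightarrow> x = y"
  by (rule inj_eq[OF bij_is_inj[OF bij_enc]])

lemma dcd_nat [simp]: "dcd n = (n :: nat)"
  using enc_dcd[of n, where 'a = nat] unfolding enc_nat_def .

lemma dcd_prod: "dcd n = (dcd (pfst n), dcd (psnd n))"
proof -
  have "enc (dcd (pfst n) :: 'a, dcd (psnd n) :: 'b) = n"
    by (simp add: enc_prod_def)
  then show ?thesis by (metis (full_types) dcd_enc)
qed

lemma ex_dcd: "(\<exists>y. P y) \<longleftrightarrow> (\<exists>n. P (dcd n))"
proof
  assume "\<exists>y. P y"
  then obtain y where "P y" by blast
  then have "P (dcd (enc y))" by simp
  then show "\<exists>n. P (dcd n)" by blast
qed blast

definition cpt :: "('a::enc \<Rightarrow> 'b::enc) \<Rightarrow> bool" where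
  "cpt f \<longleftrightarrow> C (\<lambda>z n. enc (f (dcd n)))"

text \<open>The relation makes no reference to the oracle. Forcing relations are of this kind, as
  they speak of finite conditions only.\<close>

definition dec :: "('a::enc \<Rightarrow> bool) \<Rightarrow> bool" where
  "dec A \<longleftrightarrow> C (\<lambda>z n. of_bool (A (dcd n)))"

lemma cpt_id: "cpt (\<lambda>x. x)"
  unfolding cpt_def by (simp add: C_id)

lemma cpt_const: "cpt (\<lambda>x. c)"
  unfolding cpt_def by (rule C_const)

lemma cpt_comp: "cpt g \<Longrightarrow> cpt f \<Longrightarrow> cpt (\<lambda>x. g (f x))"
  unfolding cpt_def using C_comp[of "\<lambda>z n. enc (g (dcd n))" "\<lambda>z n. enc (f (dcd n))"] by simp

lemma cpt_Pair: "cpt f \<Longrightarrow> cpt g \<Longrightarrow> cpt (\<lambda>x. (f x, g x))"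
  unfolding cpt_def enc_prod_def fst_conv snd_conv by (rule C_pair)

lemma cpt_fst: "cpt f \<Longrightarrow> cpt (\<lambda>x. fst (f x))"
proof -
  have "cpt (fst :: 'b \<times> 'c \<Rightarrow> 'b)" unfolding cpt_def by (simp add: dcd_prod C_pfst')
  then show "cpt f \<Longrightarrow> cpt (\<lambda>x. fst (f x))" by (rule cpt_comp)
qed

lemma cpt_snd: "cpt f \<Longrightarrow> cpt (\<lambda>x. snd (f x))"
proof -
  have "cpt (snd :: 'b \<times> 'c \<Rightarrow> 'c)" unfolding cpt_def by (simp add: dcd_prod C_psnd')
  then show "cpt f \<Longrightarrow> cpt (\<lambda>x. snd (f x))" by (rule cpt_comp)
qed

lemma cpt_Suc: "cpt f \<Longrightarrow> cpt (\<lambda>x. Suc (f x))"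
  unfolding cpt_def enc_nat_def by (rule C_Suc)

lemma cpt_enc: "cpt f \<Longrightarrow> cpt (\<lambda>x. enc (f x))"
  unfolding cpt_def enc_nat_def by simp

lemma cpt_funpow: "cpt (h :: 'c::enc \<Rightarrow> 'c) \<Longrightarrow> cpt f \<Longrightarrow> cpt g \<Longrightarrow> cpt (\<lambda>x. (h ^^ g x) (f x))"
proof -
  assume *: "cpt h" "cpt f" "cpt g"
  have eq: "((\<lambda>n. enc (h (dcd n))) ^^ m) (enc y) = enc ((h ^^ m) y)" for m y
    by (induction m) auto
  show ?thesis
    using C_iterate[OF *[unfolded cpt_def]] unfolding cpt_def enc_nat_def eq .
qed

lemma cpt_pred: "cpt f \<Longrightarrow> cpt (\<lambda>x. f x - Suc 0)"
  unfolding cpt_def enc_nat_def using C_pred by simp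

lemma cpt_minus: "cpt f \<Longrightarrow> cpt g \<Longrightarrow> cpt (\<lambda>x. f x - (g x :: nat))"
proof -
  have "((\<lambda>n. n - Suc 0) ^^ m) n = n - m" for m n :: nat by (induction m) auto
  then show "cpt f \<Longrightarrow> cpt g \<Longrightarrow> cpt (\<lambda>x. f x - g x)"
    using cpt_funpow[OF cpt_pred[OF cpt_id], of f g] by simp
qed

lemma dec_sub: "dec A \<Longrightarrow> cpt f \<Longrightarrow> dec (\<lambda>x. A (f x))"
  unfolding dec_def cpt_def using C_comp[of "\<lambda>z n. of_bool (A (dcd n))" "\<lambda>z n. enc (f (dcd n))"] by simp

lemma dec_const: "dec (\<lambda>x. P)"
  unfolding dec_def by (rule C_const)

lemma cpt_if: "dec P \<Longrightarrow> cpt f \<Longrightarrow> cpt g \<Longrightarrow> cpt (\<lambda>x. if P x then f x else g x)"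
proof -
  assume "dec P" "cpt f" "cpt g"
  then have "C (\<lambda>z n. if of_bool (P (dcd n)) = (0 :: nat) then enc (g (dcd n)) else enc (f (dcd n)))"
    unfolding dec_def cpt_def by (intro C_if)
  note C = this
  have eq: "(if of_bool (P (dcd n)) = (0 :: nat) then enc (g (dcd n)) else enc (f (dcd n))) =
    enc (if P (dcd n) then f (dcd n) else g (dcd n))" for n by simp
  show ?thesis using C unfolding eq cpt_def .
qed

lemma dec_not: "dec A \<Longrightarrow> dec (\<lambda>x. \<not> A x)"
proof -
  assume "dec A"
  then have "C (\<lambda>z n. if of_bool (A (dcd n)) = (0 :: nat) then 1 else 0)"
    unfolding dec_def by (intro C_if C_const)
  note C = this
  have eq: "(if of_bool (A (dcd n)) = (0 :: nat) then 1 else 0) = (of_bool (\<not> A (dcd n)) :: nat)" for n by simp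
  show ?thesis using C unfolding eq dec_def .
qed

lemma dec_conj: "dec A \<Longrightarrow> dec B \<Longrightarrow> dec (\<lambda>x. A x \<and> B x)"
proof -
  assume "dec A" "dec B"
  then have "C (\<lambda>z n. if of_bool (A (dcd n)) = (0 :: nat) then 0 else of_bool (B (dcd n)))"
    unfolding dec_def by (intro C_if C_const)
  note C = this
  have eq: "(if of_bool (A (dcd n)) = (0 :: nat) then 0 else of_bool (B (dcd n))) =
     (of_bool (A (dcd n) \<and> B (dcd n)) :: nat)" for n by simp
  show ?thesis using C unfolding eq dec_def .
qed

lemma dec_disj: "dec A \<Longrightarrow> dec B \<Longrightarrow> dec (\<lambda>x. A x \<or> B x)"
proof -
  assume "dec A" "dec B"
  then have "dec (\<lambda>x. \<not> (\<not> A x \<and> \<not> B x))" by (intro dec_not dec_conj)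
  then show ?thesis by simp
qed

lemma dec_imp: "dec A \<Longrightarrow> dec B \<Longrightarrow> dec (\<lambda>x. A x \<longrightarrow> B x)"
  unfolding imp_conv_disj by (intro dec_disj dec_not)

lemma C_search_dec:
  assumes "dec (\<lambda>p. A (fst p) (snd p))"
  shows "C (\<lambda>z n. if \<exists>m. A (dcd n) (dcd m) then Suc (LEAST m. A (dcd n) (dcd m)) else 0)"
proof -
  have eq: "(of_bool (A (fst (dcd (prod_encode (n, m)))) (snd (dcd (prod_encode (n, m))))) \<noteq> (0 :: nat))
    \<longleftrightarrow> A (dcd n) (dcd m)" for n m
    by (simp add: dcd_prod)
  show ?thesis using C_search[OF assms[unfolded dec_def]] unfolding eq .
qed

text \<open>Search through a limit makes decidability closed under number quantifiers, so
  arithmetical definitions from decidable relations stay decidable.\<close>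

lemma dec_ex: "dec (\<lambda>p. A (fst p) (snd p)) \<Longrightarrow> dec (\<lambda>x. \<exists>y. A x y)"
proof -
  assume "dec (\<lambda>p. A (fst p) (snd p))"
  then have "C (\<lambda>z n. if (if \<exists>m. A (dcd n) (dcd m) then Suc (LEAST m. A (dcd n) (dcd m)) else 0) = 0 then 0 else 1)"
    by (rule C_if[OF C_search_dec C_const C_const])
  note C = this
  have eq: "(if (if \<exists>m. A (dcd n) (dcd m) then Suc (LEAST m. A (dcd n) (dcd m)) else 0) = 0 then 0 else 1)
    = (of_bool (\<exists>y. A (dcd n) y) :: nat)" for n
  proof -
    have "(\<exists>y. A (dcd n) y) \<longleftrightarrow> (\<exists>m. A (dcd n) (dcd m))" by (rule ex_dcd)
    then show ?thesis by (cases "\<exists>m. A (dcd n) (dcd m)") (simp_all only: if_True if_False of_bool_eq simp_thms nat.distinct)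
  qed
  show ?thesis using C unfolding eq dec_def .
qed

lemma dec_all: "dec (\<lambda>p. A (fst p) (snd p)) \<Longrightarrow> dec (\<lambda>x. \<forall>y. A x y)"
proof -
  assume "dec (\<lambda>p. A (fst p) (snd p))"
  then have "dec (\<lambda>x. \<not> (\<exists>y. \<not> A x y))" by (intro dec_not dec_ex)
  then show ?thesis by simp
qed

lemma cpt_Least:
  assumes "dec (\<lambda>p. A (fst p) (snd p))" "\<And>x. \<exists>n. A x n"
  shows "cpt (\<lambda>x. LEAST n::nat. A x n)"
proof -
  have "C (\<lambda>z n. (if \<exists>m::nat. A (dcd n) (dcd m) then Suc (LEAST m. A (dcd n) (dcd m)) else 0) - 1)"
    by (rule C_pred[OF C_search_dec[OF assms(1)]])
  moreover have "\<exists>m. A (dcd n) m" for n by (rule assms(2))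
  ultimately show ?thesis unfolding cpt_def enc_nat_def dcd_nat by simp
qed

lemma dec_le: "cpt f \<Longrightarrow> cpt g \<Longrightarrow> dec (\<lambda>x. f x \<le> (g x :: nat))"
proof -
  assume "cpt f" "cpt g"
  then have "C (\<lambda>z n. f (dcd n) - g (dcd n))" using cpt_minus unfolding cpt_def enc_nat_def by blast
  then have "C (\<lambda>z n. if f (dcd n) - g (dcd n) = 0 then 1 else 0)" by (intro C_if C_const)
  note C = this
  have eq: "(if f (dcd n) - g (dcd n) = 0 then 1 else 0) = (of_bool (f (dcd n) \<le> g (dcd n)) :: nat)" for n by simp
  show ?thesis using C unfolding eq dec_def .
qed

lemma dec_less: "cpt f \<Longrightarrow> cpt g \<Longrightarrow> dec (\<lambda>x. f x < (g x :: nat))"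
  unfolding Suc_le_eq[symmetric] by (intro dec_le cpt_Suc)

lemma dec_eq: "cpt f \<Longrightarrow> cpt g \<Longrightarrow> dec (\<lambda>x. f x = g x)"
proof -
  assume "cpt f" "cpt g"
  then have D: "dec (\<lambda>x. enc (f x) \<le> enc (g x) \<and> enc (g x) \<le> enc (f x))"
    by (intro dec_conj dec_le cpt_enc)
  have eq: "enc a \<le> enc b \<and> enc b \<le> enc a \<longleftrightarrow> a = b" for a b :: 'b
    by (metis antisym enc_eq_iff order_refl)
  show ?thesis using D unfolding eq .
qed

lemmas cpt_intros = cpt_id cpt_const cpt_Pair cpt_fst cpt_snd cpt_Suc cpt_enc cpt_minus

lemmas dec_intros = dec_const dec_not dec_conj dec_disj dec_imp dec_ex dec_all dec_le dec_less dec_eq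

section \<open>Computable operations on lists\<close>

lemma enc_Nil: "enc ([] :: 'a::enc list) = 0"
  by (simp add: enc_list_def)

lemma enc_Cons: "enc (x # xs) = Suc (prod_encode (enc x, enc xs))"
  by (simp add: enc_list_def)

text \<open>The default \<open>0\<close> is what unpairing yields on the code of the empty
  list.\<close>

definition hd0 :: "nat list \<Rightarrow> nat" where "hd0 l = (case l of [] \<Rightarrow> 0 | x # _ \<Rightarrow> x)"

definition nth0 :: "nat list \<Rightarrow> nat \<Rightarrow> nat" where "nth0 l i = hd0 ((tl ^^ i) l)"

lemma funpow_tl: "(tl ^^ i) l = drop i l"
  by (induction i arbitrary: l) (auto simp: funpow_swap1 drop_Suc simp del: funpow.simps(2) simp: funpow_Suc_right)

lemma nth0_eq: "nth0 l i = (if i < length l then l ! i else 0)"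
  unfolding nth0_def funpow_tl hd0_def
  by (auto split: list.splits simp: not_less) (metis Cons_nth_drop_Suc list.inject)

lemma prod_decode_0: "prod_decode 0 = (0, 0)"
proof -
  have "prod_encode (0, 0) = 0" by (simp add: prod_encode_def)
  then show ?thesis by (metis prod_encode_inverse)
qed

lemma cpt_tl: "cpt f \<Longrightarrow> cpt (\<lambda>x. tl (f x))"
proof -
  have "enc (tl l) = psnd (enc l - 1)" for l :: "'b list"
    by (cases l) (simp_all add: enc_Nil enc_Cons prod_decode_0)
  then have "cpt (tl :: 'b list \<Rightarrow> 'b list)"
    unfolding cpt_def by (simp add: C_psnd[OF C_pred'[unfolded One_nat_def]])
  then show "cpt f \<Longrightarrow> cpt (\<lambda>x. tl (f x))" by (rule cpt_comp)
qed

lemma cpt_hd0: "cpt f \<Longrightarrow> cpt (\<lambda>x. hd0 (f x))"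
proof -
  have "enc (hd0 l) = pfst (enc l - 1)" for l :: "nat list"
    by (cases l) (simp_all add: enc_Nil enc_Cons prod_decode_0 hd0_def, simp_all add: enc_nat_def)
  then have "cpt hd0"
    unfolding cpt_def by (simp add: C_pfst[OF C_pred'[unfolded One_nat_def]])
  then show "cpt f \<Longrightarrow> cpt (\<lambda>x. hd0 (f x))" by (rule cpt_comp)
qed

lemma cpt_nth0: "cpt f \<Longrightarrow> cpt g \<Longrightarrow> cpt (\<lambda>x. nth0 (f x) (g x))"
  unfolding nth0_def by (intro cpt_hd0 cpt_funpow cpt_tl cpt_id)

lemma cpt_length: "cpt f \<Longrightarrow> cpt (\<lambda>x. length (f x))"
proof -
  have "length l = (LEAST n. (tl ^^ n) l = [])" for l :: "'b list"
    by (rule Least_equality[symmetric]) (auto simp: funpow_tl)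
  then have len: "(length :: 'b list \<Rightarrow> nat) = (\<lambda>l. LEAST n. (tl ^^ n) l = [])" by (rule ext)
  have "cpt (\<lambda>l :: 'b list. LEAST n. (tl ^^ n) l = [])"
    by (intro cpt_Least dec_eq cpt_funpow cpt_tl cpt_intros) (auto simp: funpow_tl)
  then have "cpt (length :: 'b list \<Rightarrow> nat)" unfolding len .
  then show "cpt f \<Longrightarrow> cpt (\<lambda>x. length (f x))" by (rule cpt_comp)
qed

text \<open>The step beyond arithmetic: a function quantifier over a matrix that inspects finite
  initial segments.\<close>

lemma dec_souslin:
  assumes "dec (\<lambda>p. A (fst p) (snd p))"
  shows "dec (\<lambda>x. \<exists>\<sigma> :: nat \<Rightarrow> nat. \<forall>n. A x (rev (map \<sigma> [0..<Suc n])))"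
proof -
  have l: "dcd (list_encode l) = l" for l :: "nat list"
    using dcd_enc[of l] by (simp add: enc_list_def enc_nat_def[abs_def])
  have eq: "(of_bool (A (fst (dcd (prod_encode (p, list_encode L)))) (snd (dcd (prod_encode (p, list_encode L))))) \<noteq> (0 :: nat))
    \<longleftrightarrow> A (dcd p) L" for p L
    by (simp add: dcd_prod l)
  show ?thesis using C_souslin[OF assms[unfolded dec_def]] unfolding eq dec_def .
qed

subsection \<open>Inductive definitions and comparison of their stages\<close>

text \<open>General form of a definition by rules: \<open>V a i\<close> says that rule instance
  \<open>i\<close> may derive \<open>a\<close>, and \<open>M a i b\<close> that \<open>b\<close> is
  one of its premises.\<close>

inductive ind :: "('a \<Rightarrow> 'b \<Rightarrow> bool) \<Rightarrow> ('a \<Rightarrow> 'b \<Rightarrow> 'a \<Rightarrow> bool) \<Rightarrow> 'a \<Rightarrow> bool" for V M where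
  indI: "V a i \<Longrightarrow> (\<And>b. M a i b \<Longrightarrow> ind V M b) \<Longrightarrow> ind V M a"

lemma ind_iff: "ind V M a \<longleftrightarrow> (\<exists>i. V a i \<and> (\<forall>b. M a i b \<longrightarrow> ind V M b))"
  by (subst ind.simps) blast

text \<open>Nodes of the search tree carry the latest value in front, so the value at
  \<open>i\<close> is counted from the end.\<close>

definition ent :: "nat list \<Rightarrow> nat \<Rightarrow> nat" where
  "ent L i = nth0 L (length L - Suc i)"

lemma ent_rev: "i < n \<Longrightarrow> ent (rev (map \<sigma> [0..<n])) i = \<sigma> i"
  by (simp add: ent_def nth0_eq rev_nth)

text \<open>A strategy witnessing that \<open>a\<close> is not in the inductively defined set: at \<open>(x, i)\<close> it returns \<open>0\<close> if
  \<open>x\<close> is not claimed to lie outside the set, \<open>1\<close> if the rule instance \<open>i\<close> is not applicable to \<open>x\<close>, and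
  otherwise a premise (shifted by 2) that again lies outside.\<close>

definition strat :: "('a::enc \<Rightarrow> 'b::enc \<Rightarrow> bool) \<Rightarrow> ('a \<Rightarrow> 'b \<Rightarrow> 'a \<Rightarrow> bool) \<Rightarrow> 'a \<Rightarrow> nat list \<Rightarrow> bool" where
  "strat V M a L \<longleftrightarrow> (\<forall>y :: 'b. enc (a, y) < length L \<longrightarrow> ent L (enc (a, y)) \<noteq> 0) \<and>
     (\<forall>x y. enc (x, y) < length L \<longrightarrow> (ent L (enc (x, y)) = 1 \<longrightarrow> \<not> V x y) \<and>
        (\<forall>b. ent L (enc (x, y)) = Suc (Suc (enc b)) \<longrightarrow>
           M x y b \<and> (\<forall>y' :: 'b. enc (b, y') < length L \<longrightarrow> ent L (enc (b, y')) \<noteq> 0)))"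

text \<open>The complement of the least fixed point is the largest set in which every applicable
  rule instance has a premise in the set again. One function codes such a set together with the
  chosen premises, and its correctness is visible on finite initial segments; this is the form that
  branch search decides.\<close>

lemma not_ind_iff_strat:
  "\<not> ind V M a \<longleftrightarrow> (\<exists>\<sigma>. \<forall>n. strat V M a (rev (map \<sigma> [0..<Suc n])))"
proof
  assume a: "\<not> ind V M a"
  define \<sigma> where "\<sigma> n = (case dcd n of (x, y) \<Rightarrow> if ind V M x then 0 else if \<not> V x y then 1
      else Suc (Suc (enc (SOME b. M x y b \<and> \<not> ind V M b))))" for n
  have \<sigma>: "\<sigma> (enc (x, y)) = (if ind V M x then 0 else if \<not> V x y then 1
      else Suc (Suc (enc (SOME b. M x y b \<and> \<not> ind V M b))))" for x y
    unfolding \<sigma>_def by simp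
  have ch: "M x y b \<and> \<not> ind V M b" if "\<sigma> (enc (x, y)) = Suc (Suc (enc b))" for x y b
  proof -
    have "\<not> ind V M x" "V x y" and b: "b = (SOME b. M x y b \<and> \<not> ind V M b)"
      using that unfolding \<sigma> by (auto split: if_splits simp: enc_eq_iff)
    then have "\<exists>b. M x y b \<and> \<not> ind V M b" using indI[of V x y M] by blast
    then show ?thesis unfolding b by (rule someI_ex)
  qed
  have "strat V M a (rev (map \<sigma> [0..<Suc n]))" for n
    unfolding strat_def
  proof (intro conjI allI impI)
    fix y :: 'b assume "enc (a, y) < length (rev (map \<sigma> [0..<Suc n]))"
    then have "ent (rev (map \<sigma> [0..<Suc n])) (enc (a, y)) = \<sigma> (enc (a, y))"
      by (intro ent_rev) simp
    then show "ent (rev (map \<sigma> [0..<Suc n])) (enc (a, y)) \<noteq> 0" using a by (simp add: \<sigma>)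
  next
    fix x :: 'a and y :: 'b assume "enc (x, y) < length (rev (map \<sigma> [0..<Suc n]))"
    then have e: "ent (rev (map \<sigma> [0..<Suc n])) (enc (x, y)) = \<sigma> (enc (x, y))"
      by (intro ent_rev) simp
    { assume "ent (rev (map \<sigma> [0..<Suc n])) (enc (x, y)) = 1"
      then show "\<not> V x y" unfolding e \<sigma> by (auto split: if_splits) }
    fix b :: 'a assume *: "ent (rev (map \<sigma> [0..<Suc n])) (enc (x, y)) = Suc (Suc (enc b))"
    show "M x y b" using ch * unfolding e by blast
    have nb: "\<not> ind V M b" using ch * unfolding e by blast
    fix y' :: 'b assume "enc (b, y') < length (rev (map \<sigma> [0..<Suc n]))"
    then have "ent (rev (map \<sigma> [0..<Suc n])) (enc (b, y')) = \<sigma> (enc (b, y'))"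
      by (intro ent_rev) simp
    then show "ent (rev (map \<sigma> [0..<Suc n])) (enc (b, y')) \<noteq> 0" using nb by (simp add: \<sigma>)
  qed
  then show "\<exists>\<sigma>. \<forall>n. strat V M a (rev (map \<sigma> [0..<Suc n]))" by blast
next
  assume "\<exists>\<sigma>. \<forall>n. strat V M a (rev (map \<sigma> [0..<Suc n]))"
  then obtain \<sigma> where \<sigma>: "\<And>n. strat V M a (rev (map \<sigma> [0..<Suc n]))" by blast
  have e: "ent (rev (map \<sigma> [0..<Suc n])) i = \<sigma> i" if "i \<le> n" for i n
    by (rule ent_rev) (use that in simp)
  have len: "i < length (rev (map \<sigma> [0..<Suc n]))" if "i \<le> n" for i n
    using that by simp
  note \<sigma>1 = conjunct1[OF \<sigma>[unfolded strat_def], rule_format]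
  note \<sigma>2 = conjunct2[OF \<sigma>[unfolded strat_def], rule_format]
  have 1: "\<sigma> (enc (a, y)) \<noteq> 0" for y :: 'b
    using \<sigma>1[OF len[OF order_refl], of y] unfolding e[OF order_refl] .
  have 2: "\<not> V x y" if "\<sigma> (enc (x, y)) = 1" for x y
    using \<sigma>2[OF len[OF order_refl], of x y] that unfolding e[OF order_refl] by blast
  have 3: "M x y b" "\<sigma> (enc (b, y')) \<noteq> 0" if "\<sigma> (enc (x, y)) = Suc (Suc (enc b))" for x b :: 'a and y y' :: 'b
  proof -
    let ?n = "max (enc (x, y)) (enc (b, y'))"
    have le: "enc (x, y) \<le> ?n" "enc (b, y') \<le> ?n" by auto
    show "M x y b" using \<sigma>2[OF len[OF le(1)]] that unfolding e[OF le(1)] by blast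
    show "\<sigma> (enc (b, y')) \<noteq> 0"
      using \<sigma>2[OF len[OF le(1)]] that len[OF le(2)] unfolding e[OF le(1)] e[OF le(2), symmetric] by blast
  qed
  have "ind V M x \<Longrightarrow> (\<And>y :: 'b. \<sigma> (enc (x, y)) \<noteq> 0) \<Longrightarrow> False" for x
  proof (induction rule: ind.induct)
    case (indI x i)
    show False
    proof (cases "\<sigma> (enc (x, i)) = 1")
      case True
      then show False using 2 indI by blast
    next
      case False
      then obtain m where m: "\<sigma> (enc (x, i)) = Suc (Suc m)"
        using indI.prems[of i] by (metis One_nat_def not0_implies_Suc)
      define b where "b = (dcd m :: 'a)"
      have eb: "\<sigma> (enc (x, i)) = Suc (Suc (enc b))" using m by (simp add: b_def)
      show False by (rule indI.IH[OF 3(1)[OF eb]]) (rule 3(2)[OF eb])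
    qed
  qed
  then show "\<not> ind V M a" using 1 by blast
qed

lemma dec_sub2: "dec (\<lambda>p. A (fst p) (snd p)) \<Longrightarrow> cpt f \<Longrightarrow> cpt g \<Longrightarrow> dec (\<lambda>x. A (f x) (g x))"
  using dec_sub[OF _ cpt_Pair, of "\<lambda>p. A (fst p) (snd p)" f g] by simp

lemma dec_sub3: "dec (\<lambda>p. A (fst p) (fst (snd p)) (snd (snd p))) \<Longrightarrow> cpt f \<Longrightarrow> cpt g \<Longrightarrow> cpt h \<Longrightarrow>
   dec (\<lambda>x. A (f x) (g x) (h x))"
  using dec_sub[OF _ cpt_Pair[OF _ cpt_Pair], of "\<lambda>p. A (fst p) (fst (snd p)) (snd (snd p))" f g h] by simp

lemma dec_ind:
  assumes V: "dec (\<lambda>p. V (fst p) (snd p))" and M: "dec (\<lambda>p. M (fst p) (fst (snd p)) (snd (snd p)))"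
  shows "dec (ind V M)"
proof -
  have "dec (\<lambda>p. strat V M (fst p) (snd p))"
    unfolding strat_def ent_def
    by (intro dec_intros dec_sub2[OF V] dec_sub3[OF M] cpt_intros cpt_nth0 cpt_length)
  then have "dec (\<lambda>a. \<exists>\<sigma>. \<forall>n. strat V M a (rev (map \<sigma> [0..<Suc n])))" by (rule dec_souslin)
  then have "dec (\<lambda>a. \<not> ind V M a)" unfolding not_ind_iff_strat .
  then have "dec (\<lambda>a. \<not> \<not> ind V M a)" by (rule dec_not)
  then show ?thesis by simp
qed

text \<open>\<open>Lt V M c a\<close>: the element \<open>c\<close> is generated at an earlier stage than \<open>a\<close>. Positions \<open>(0, a, c, _, _)\<close> stand
  for this statement, positions \<open>(1, a, c, i, j)\<close> for: some \<open>i\<close>-premise of \<open>a\<close> is later than all \<open>j\<close>-premises of \<open>c\<close>.\<close>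

definition VLt :: "('a::enc \<Rightarrow> 'b::enc \<Rightarrow> bool) \<Rightarrow> ('a \<Rightarrow> 'b \<Rightarrow> 'a \<Rightarrow> bool) \<Rightarrow> nat \<times> 'a \<times> 'a \<times> 'b \<times> 'b \<Rightarrow> 'b \<times> 'a \<Rightarrow> bool" where
  "VLt V M x r \<longleftrightarrow> fst x = 0 \<and> V (fst (snd (snd x))) (fst r) \<or>
     fst x \<noteq> 0 \<and> M (fst (snd x)) (fst (snd (snd (snd x)))) (snd r)"

definition MLt :: "('a::enc \<Rightarrow> 'b::enc \<Rightarrow> bool) \<Rightarrow> ('a \<Rightarrow> 'b \<Rightarrow> 'a \<Rightarrow> bool) \<Rightarrow> nat \<times> 'a \<times> 'a \<times> 'b \<times> 'b \<Rightarrow> 'b \<times> 'a \<Rightarrow>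
    nat \<times> 'a \<times> 'a \<times> 'b \<times> 'b \<Rightarrow> bool" where
  "MLt V M x r y \<longleftrightarrow>
     fst x = 0 \<and> (\<exists>i. V (fst (snd x)) i \<and> y = (1, fst (snd x), fst (snd (snd x)), i, fst r)) \<or>
     fst x \<noteq> 0 \<and> (\<exists>b'. M (fst (snd (snd x))) (snd (snd (snd (snd x)))) b' \<and> y = (0, snd r, b', dcd 0, dcd 0))"

definition Lt :: "('a::enc \<Rightarrow> 'b::enc \<Rightarrow> bool) \<Rightarrow> ('a \<Rightarrow> 'b \<Rightarrow> 'a \<Rightarrow> bool) \<Rightarrow> 'a \<Rightarrow> 'a \<Rightarrow> bool" where
  "Lt V M c a \<longleftrightarrow> ind (VLt V M) (MLt V M) (0, a, c, dcd 0, dcd 0)"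

lemma dec_Lt:
  assumes V: "dec (\<lambda>p. V (fst p) (snd p))" and M: "dec (\<lambda>p. M (fst p) (fst (snd p)) (snd (snd p)))"
  shows "dec (\<lambda>p. Lt V M (fst p) (snd p))"
proof -
  have "dec (ind (VLt V M) (MLt V M))"
  proof (rule dec_ind)
    show "dec (\<lambda>p. VLt V M (fst p) (snd p))"
      unfolding VLt_def by (intro dec_intros dec_sub2[OF V] dec_sub3[OF M] cpt_intros)
    show "dec (\<lambda>p. MLt V M (fst p) (fst (snd p)) (snd (snd p)))"
      unfolding MLt_def by (intro dec_intros dec_sub2[OF V] dec_sub3[OF M] cpt_intros)
  qed
  then show ?thesis unfolding Lt_def by (rule dec_sub) (intro cpt_intros)
qed

text \<open>The stage of an element is the minimum over its rule instances of the strict supremum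
  over the premises; unfolding \<open>stage c < stage a\<close> accordingly gives this recursion.
  The reading as stages presupposes that \<open>a\<close> is generated: if no rule instance applies
  to \<open>a\<close>, then every \<open>c\<close> with an applicable one satisfies
  \<open>Lt V M c a\<close>.\<close>

lemma Lt_iff:
  "Lt V M c a \<longleftrightarrow> (\<exists>j. V c j \<and> (\<forall>i. V a i \<longrightarrow> (\<exists>b. M a i b \<and> (\<forall>b'. M c j b' \<longrightarrow> Lt V M b' b))))"
proof -
  let ?I = "ind (VLt V M) (MLt V M)"
  have 1: "?I (1, a, c, i, j) \<longleftrightarrow> (\<exists>b. M a i b \<and> (\<forall>b'. M c j b' \<longrightarrow> Lt V M b' b))" for i j
    unfolding Lt_def by (subst ind_iff) (auto simp: VLt_def MLt_def)
  have "?I (0, a, c, dcd 0, dcd 0) \<longleftrightarrow> (\<exists>j. V c j \<and> (\<forall>i. V a i \<longrightarrow> ?I (1, a, c, i, j)))"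
    by (subst ind_iff) (auto simp: VLt_def MLt_def)
  then show ?thesis unfolding 1 unfolding Lt_def .
qed

text \<open>The negation of \<open>Lt\<close>, to be read as \<open>a\<close> is not later than
  \<open>c\<close>, is a greatest fixed point. So it contains every simulation that answers each
  rule instance for \<open>c\<close> by one for \<open>a\<close> whose premises are matched
  again.\<close>

lemma not_Lt_coinduct:
  assumes X: "\<And>a c j. X a c \<Longrightarrow> V c j \<Longrightarrow> \<exists>i. V a i \<and> (\<forall>b. M a i b \<longrightarrow> (\<exists>b'. M c j b' \<and> X b b'))"
    and "X a c"
  shows "\<not> Lt V M c a"
proof -
  have "ind (VLt V M) (MLt V M) q \<Longrightarrow> (\<forall>a c i j. (q = (0, a, c, i, j) \<longrightarrow> \<not> X a c) \<and>
     (q = (1, a, c, i, j) \<longrightarrow> \<not> (\<forall>b. M a i b \<longrightarrow> (\<exists>b'. M c j b' \<and> X b b'))))" for q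
  proof (induction rule: ind.induct)
    case (indI q r)
    show ?case
    proof (intro allI conjI impI)
      fix a c i j assume q: "q = (0, a, c, i, j)"
      show "\<not> X a c"
      proof
        assume "X a c"
        moreover have "V c (fst r)" using indI(1) by (simp add: q VLt_def)
        ultimately obtain i' where i': "V a i'" "\<forall>b. M a i' b \<longrightarrow> (\<exists>b'. M c (fst r) b' \<and> X b b')"
          using X by blast
        have "MLt V M q r (1, a, c, i', fst r)" using i'(1) by (simp add: q MLt_def)
        then show False using indI.IH i'(2) by blast
      qed
    next
      fix a c i j assume q: "q = (1, a, c, i, j)"
      show "\<not> (\<forall>b. M a i b \<longrightarrow> (\<exists>b'. M c j b' \<and> X b b'))"
      proof
        assume *: "\<forall>b. M a i b \<longrightarrow> (\<exists>b'. M c j b' \<and> X b b')"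
        have "M a i (snd r)" using indI(1) by (simp add: q VLt_def)
        then obtain b' where b': "M c j b'" "X (snd r) b'" using * by blast
        have "MLt V M q r (0, snd r, b', dcd 0, dcd 0)" using b'(1) by (simp add: q MLt_def)
        then show False using indI.IH b'(2) by blast
      qed
    qed
  qed
  then show ?thesis using assms(2) unfolding Lt_def by blast
qed

lemma not_LtD:
  "\<not> Lt V M c a \<Longrightarrow> V c j \<Longrightarrow> \<exists>i. V a i \<and> (\<forall>b. M a i b \<longrightarrow> (\<exists>b'. M c j b' \<and> \<not> Lt V M b' b))"
  using Lt_iff[of V M c a] by blast

lemma Lt_irrefl: "\<not> Lt V M a a"
  by (rule not_Lt_coinduct[where X = "(=)"]) auto

lemma not_Lt_trans:
  assumes "\<not> Lt V M b a" "\<not> Lt V M c b"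
  shows "\<not> Lt V M c a"
proof (rule not_Lt_coinduct[where X = "\<lambda>a c. \<exists>b. \<not> Lt V M b a \<and> \<not> Lt V M c b"])
  fix a c j assume "\<exists>b. \<not> Lt V M b a \<and> \<not> Lt V M c b" and j: "V c j"
  then obtain b where b: "\<not> Lt V M b a" "\<not> Lt V M c b" by blast
  obtain i where i: "V b i" "\<forall>x. M b i x \<longrightarrow> (\<exists>x'. M c j x' \<and> \<not> Lt V M x' x)"
    using not_LtD[OF b(2) j] by blast
  obtain k where k: "V a k" "\<forall>x. M a k x \<longrightarrow> (\<exists>x'. M b i x' \<and> \<not> Lt V M x' x)"
    using not_LtD[OF b(1) i(1)] by blast
  show "\<exists>i. V a i \<and> (\<forall>x. M a i x \<longrightarrow> (\<exists>x'. M c j x' \<and> (\<exists>b. \<not> Lt V M b x \<and> \<not> Lt V M x' b)))"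
    using k i(2) by meson
qed (use assms in blast)

lemma Lt_ind: "ind V M a \<Longrightarrow> Lt V M c a \<Longrightarrow> ind V M c"
proof (induction arbitrary: c rule: ind.induct)
  case (indI a i)
  then obtain j where j: "V c j" "\<exists>b. M a i b \<and> (\<forall>b'. M c j b' \<longrightarrow> Lt V M b' b)"
    unfolding Lt_iff[of V M c a] by blast
  then show ?case using indI.IH ind.indI[of V c j M] by blast
qed

text \<open>Otherwise every rule instance for \<open>a\<close> has a premise not earlier than
  \<open>a\<close>. Matching such an instance with the last rule in a derivation of an element not
  earlier than \<open>a\<close> gives a premise inside that derivation that is still not earlier
  than \<open>a\<close>: an infinite descent.\<close>

lemma ind_Lt_step:
  assumes "ind V M a"
  shows "\<exists>i. V a i \<and> (\<forall>b. M a i b \<longrightarrow> ind V M b \<and> Lt V M b a)"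
proof -
  have "ind V M a \<Longrightarrow> \<not> Lt V M a a' \<Longrightarrow> \<forall>i. V a' i \<longrightarrow> (\<exists>b. M a' i b \<and> \<not> Lt V M b a') \<Longrightarrow> False" for a a'
  proof (induction rule: ind.induct)
    case (indI a j)
    obtain i where i: "V a' i" "\<forall>b. M a' i b \<longrightarrow> (\<exists>b'. M a j b' \<and> \<not> Lt V M b' b)"
      using not_LtD[OF indI.prems(1) indI(1)] by blast
    then obtain b where b: "M a' i b" "\<not> Lt V M b a'" using indI.prems(2) by blast
    then obtain b' where b': "M a j b'" "\<not> Lt V M b' b" using i by blast
    show False
      by (rule indI.IH[OF b'(1) not_Lt_trans[OF b(2) b'(2)] indI.prems(2)])
  qed
  then have "\<exists>i. V a i \<and> (\<forall>b. M a i b \<longrightarrow> Lt V M b a)" using assms Lt_irrefl[of V M a] by blast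
  then show ?thesis using Lt_ind[OF assms] by blast
qed

text \<open>Ordinals are avoided: \<open>Z\<close> stands for the statement that an element of stage
  at most that of an accessible \<open>b\<close> is accessible.\<close>

lemma wfp_Lt: "wfp (\<lambda>c a. Lt V M c a \<and> ind V M a)"
proof -
  let ?acc = "Wellfounded.accp (\<lambda>c a. Lt V M c a)"
  have Z: "?acc b \<Longrightarrow> V c j \<Longrightarrow> \<forall>b'. M c j b' \<longrightarrow> Lt V M b' b \<Longrightarrow> ?acc c" for b c j
  proof (induction arbitrary: c j rule: accp.induct)
    case (accI b)
    show ?case
    proof (rule accp.accI)
      fix e assume "Lt V M e c"
      then obtain k b' where "V e k" "M c j b'" "\<forall>e'. M e k e' \<longrightarrow> Lt V M e' b'"
        using accI.prems(1) unfolding Lt_iff[of V M e c] by blast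
      then show "?acc e" using accI.IH accI.prems(2) by blast
    qed
  qed
  have A: "ind V M a \<Longrightarrow> ?acc a" for a
  proof (induction rule: ind.induct)
    case (indI a i)
    show ?case
    proof (rule accp.accI)
      fix c assume "Lt V M c a"
      then obtain j b where "V c j" "M a i b" "\<forall>b'. M c j b' \<longrightarrow> Lt V M b' b"
        using indI(1) unfolding Lt_iff[of V M c a] by blast
      then show "?acc c" using Z indI.IH by blast
    qed
  qed
  have "Wellfounded.accp (\<lambda>c a. Lt V M c a \<and> ind V M a) a" for a
  proof (cases "ind V M a")
    case True
    show ?thesis using A[OF True]
    proof (induction rule: accp.induct)
      case (accI a)
      show ?case by (rule accp.accI) (use accI.IH in blast)
    qed
  next
    case False
    show ?thesis by (rule accp.accI) (use False in blast)
  qed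
  then show ?thesis by (rule accp_wfpI[rule_format])
qed

subsection \<open>Cohen conditions\<close>

text \<open>Finite bit strings are coded as the nodes of the binary tree on the naturals in which \<open>s\<close> has the
  children \<open>2s+1\<close> and \<open>2s+2\<close>.\<close>

definition par :: "nat \<Rightarrow> nat" where "par s = (s - 1) div 2"

definition ext :: "nat \<Rightarrow> nat \<Rightarrow> bool" where "ext t s \<longleftrightarrow> (\<exists>k. (par ^^ k) t = s)"

fun pre :: "creal \<Rightarrow> nat \<Rightarrow> nat" where
  "pre z 0 = 0"
| "pre z (Suc m) = Suc (2 * pre z m + of_bool (z m))"

lemma ext_refl: "ext s s"
  unfolding ext_def by (rule exI[of _ 0]) simp

lemma ext_trans: "ext u t \<Longrightarrow> ext t s \<Longrightarrow> ext u s"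
  unfolding ext_def by (metis funpow_add comp_apply)

lemma par_pre: "par (pre z (Suc m)) = pre z m"
  by (simp add: par_def)

lemma funpow_par_pre: "(par ^^ k) (pre z n) = pre z (n - k)"
proof (induction k)
  case (Suc k)
  have "par (pre z (n - k)) = pre z (n - Suc k)"
  proof (cases "n - k")
    case 0
    then show ?thesis by (simp add: par_def)
  next
    case (Suc m)
    then have "n - Suc k = m" by simp
    then show ?thesis using Suc par_pre by metis
  qed
  then show ?case using Suc by simp
qed simp

lemma ext_pre: "m \<le> n \<Longrightarrow> ext (pre z n) (pre z m)"
  unfolding ext_def by (rule exI[of _ "n - m"]) (simp add: funpow_par_pre)

lemma ext_preD: "ext (pre z n) s \<Longrightarrow> \<exists>m\<le>n. s = pre z m"
  unfolding ext_def funpow_par_pre using diff_le_self by blast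

lemma cpt_add: "cpt f \<Longrightarrow> cpt g \<Longrightarrow> cpt (\<lambda>x. f x + (g x :: nat))"
proof -
  assume "cpt f" "cpt g"
  then have "cpt (\<lambda>x. (Suc ^^ g x) (f x))" by (intro cpt_funpow cpt_Suc cpt_id)
  then show ?thesis by (simp add: add.commute)
qed

lemma cpt_par: "cpt f \<Longrightarrow> cpt (\<lambda>x. par (f x))"
proof -
  \<comment> \<open>Iterating the map from \<open>(a, b)\<close> to \<open>(b, a + 1)\<close> lets
    the components grow alternately, which halves the number of iterations.\<close>
  have half: "((\<lambda>p. (snd p, Suc (fst p))) ^^ n) (0, 0) = (n div 2, n - n div 2)" for n :: nat
    by (induction n) auto
  have "cpt (\<lambda>n. fst (((\<lambda>p. (snd p, Suc (fst p))) ^^ (n - 1)) (0, 0 :: nat)))"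
    by (intro cpt_fst cpt_funpow cpt_intros)
  then have "cpt par" unfolding half fst_conv par_def[abs_def] .
  then show "cpt f \<Longrightarrow> cpt (\<lambda>x. par (f x))" by (rule cpt_comp)
qed

lemma dec_ext: "cpt f \<Longrightarrow> cpt g \<Longrightarrow> dec (\<lambda>x. ext (f x) (g x))"
proof -
  have "dec (\<lambda>p. ext (fst p) (snd p))"
    unfolding ext_def by (intro dec_intros cpt_funpow cpt_par cpt_intros)
  then show "cpt f \<Longrightarrow> cpt g \<Longrightarrow> dec (\<lambda>x. ext (f x) (g x))" by (rule dec_sub2)
qed

lemma cpt_dcd: "cpt f \<Longrightarrow> cpt (\<lambda>x. dcd (f x))"
proof -
  have "cpt (dcd :: nat \<Rightarrow> 'b)" unfolding cpt_def by (simp add: C_id)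
  then show "cpt f \<Longrightarrow> cpt (\<lambda>x. dcd (f x) :: 'b)" by (rule cpt_comp)
qed

text \<open>The meet-or-avoid form of 1-genericity, for one family of sets in place of all
  computably enumerable ones. The parameter \<open>i\<close> allows a single \<open>A\<close> to
  carry infinitely many requirements.\<close>

definition gen :: "('i \<times> nat \<Rightarrow> bool) \<Rightarrow> creal \<Rightarrow> bool" where
  "gen A z \<longleftrightarrow> (\<forall>i. (\<exists>m. A (i, pre z m)) \<or> (\<exists>m. \<forall>t. ext t (pre z m) \<longrightarrow> \<not> A (i, t)))"

lemma genE:
  assumes "gen A z"
  obtains m where "A (i, pre z m)" | m where "\<And>t. ext t (pre z m) \<Longrightarrow> \<not> A (i, t)"
  using assms unfolding gen_def by blast

definition join :: "('i \<times> nat \<Rightarrow> bool) \<Rightarrow> ('j \<times> nat \<Rightarrow> bool) \<Rightarrow> (nat \<times> 'i \<times> 'j) \<times> nat \<Rightarrow> bool" where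
  "join A B p \<longleftrightarrow> fst (fst p) = 0 \<and> A (fst (snd (fst p)), snd p) \<or> fst (fst p) \<noteq> 0 \<and> B (snd (snd (fst p)), snd p)"

lemma gen_join: "gen (join A B) z \<Longrightarrow> gen A z \<and> gen B z"
proof -
  assume g: "gen (join A B) z"
  have "gen A z" unfolding gen_def
  proof
    fix i
    show "(\<exists>m. A (i, pre z m)) \<or> (\<exists>m. \<forall>t. ext t (pre z m) \<longrightarrow> \<not> A (i, t))"
      using g[unfolded gen_def, rule_format, of "(0, i, undefined)"] by (simp add: join_def)
  qed
  moreover have "gen B z" unfolding gen_def
  proof
    fix j
    show "(\<exists>m. B (j, pre z m)) \<or> (\<exists>m. \<forall>t. ext t (pre z m) \<longrightarrow> \<not> B (j, t))"
      using g[unfolded gen_def, rule_format, of "(1, undefined, j)"] by (simp add: join_def)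
  qed
  ultimately show ?thesis ..
qed

lemma dec_join:
  assumes A: "dec A" and B: "dec B"
  shows "dec (join A B)"
  unfolding join_def[abs_def]
  by (intro dec_intros dec_sub[OF A] dec_sub[OF B] cpt_intros)

subsection \<open>Relations that are generically open with decidable code\<close>

text \<open>The truth of \<open>R\<close> on generic reals is forced by initial segments, with the decidable forcing relation \<open>F\<close>.\<close>

definition nice :: "('a::enc \<Rightarrow> creal \<Rightarrow> bool) \<Rightarrow> bool" where
  "nice R \<longleftrightarrow> (\<exists>F (A :: nat \<times> nat \<Rightarrow> bool). dec F \<and> dec A \<and> (\<forall>a s t. F (a, s) \<longrightarrow> ext t s \<longrightarrow> F (a, t)) \<and>
     (\<forall>z. gen A z \<longrightarrow> (\<forall>a. R a z \<longleftrightarrow> (\<exists>m. F (a, pre z m)))))"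

lemma niceI:
  fixes A :: "'i::enc \<times> nat \<Rightarrow> bool"
  assumes "dec F" "dec A" "\<And>a s t. F (a, s) \<Longrightarrow> ext t s \<Longrightarrow> F (a, t)"
    "\<And>z a. gen A z \<Longrightarrow> R a z \<longleftrightarrow> (\<exists>m. F (a, pre z m))"
  shows "nice R"
proof -
  let ?A = "\<lambda>p. A (dcd (fst p), snd p)"
  have d: "dec ?A" by (intro dec_sub[OF assms(2)] cpt_intros cpt_dcd)
  have g: "gen A z" if "gen ?A z" for z
    unfolding gen_def
  proof
    fix i
    show "(\<exists>m. A (i, pre z m)) \<or> (\<exists>m. \<forall>t. ext t (pre z m) \<longrightarrow> \<not> A (i, t))"
      using that[unfolded gen_def, rule_format, of "enc i"] by simp
  qed
  show ?thesis unfolding nice_def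
    by (intro exI[of _ F] exI[of _ ?A]) (use assms d g in blast)
qed

lemma nice_dec:
  assumes P: "dec P"
  shows "nice (\<lambda>a z. P a)"
proof (rule niceI[of "\<lambda>p. P (fst p)" "\<lambda>p :: nat \<times> nat. False"])
  show "dec (\<lambda>p. P (fst p))" by (intro dec_sub[OF P] cpt_intros)
qed (auto intro: dec_const)

lemma nice_sub: "nice R \<Longrightarrow> cpt f \<Longrightarrow> nice (\<lambda>x z. R (f x) z)"
proof -
  assume "nice R" and f: "cpt f"
  then obtain F and A :: "nat \<times> nat \<Rightarrow> bool" where F0: "dec F" "dec A" "\<forall>a s t. F (a, s) \<longrightarrow> ext t s \<longrightarrow> F (a, t)"
    "\<forall>z. gen A z \<longrightarrow> (\<forall>a. R a z \<longleftrightarrow> (\<exists>m. F (a, pre z m)))" unfolding nice_def by blast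
  note F = F0[rule_format]
  show ?thesis
  proof (rule niceI[of "\<lambda>p. F (f (fst p), snd p)" A])
    show "dec (\<lambda>p. F (f (fst p), snd p))"
      by (intro dec_sub[OF F(1)] cpt_intros cpt_comp[OF f])
  qed (use F in auto)
qed

text \<open>A condition forces the negation if none of its extensions is in \<open>F\<close>. That
  one of the two sides is decided along \<open>z\<close> is genericity for \<open>F\<close> itself,
  so \<open>F\<close> joins the sets to be met or avoided.\<close>

lemma nice_not: "nice R \<Longrightarrow> nice (\<lambda>x z. \<not> R x z)"
proof -
  assume "nice R"
  then obtain F and A :: "nat \<times> nat \<Rightarrow> bool" where F0: "dec F" "dec A" "\<forall>a s t. F (a, s) \<longrightarrow> ext t s \<longrightarrow> F (a, t)"
    "\<forall>z. gen A z \<longrightarrow> (\<forall>a. R a z \<longleftrightarrow> (\<exists>m. F (a, pre z m)))" unfolding nice_def by blast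
  note F = F0[rule_format]
  show ?thesis
  proof (rule niceI[of "\<lambda>p. \<forall>t. ext t (snd p) \<longrightarrow> \<not> F (fst p, t)" "join A F"])
    show "dec (\<lambda>p. \<forall>t. ext t (snd p) \<longrightarrow> \<not> F (fst p, t))"
      by (intro dec_intros dec_ext dec_sub[OF F(1)] cpt_intros)
    show "dec (join A F)" by (rule dec_join) fact+
    show "\<forall>t'. ext t' (snd (a, t)) \<longrightarrow> \<not> F (fst (a, t), t')"
      if "\<forall>t'. ext t' (snd (a, s)) \<longrightarrow> \<not> F (fst (a, s), t')" "ext t s" for a s t
      using that ext_trans by auto
    fix z a assume "gen (join A F) z"
    then have g: "gen A z" "gen F z" using gen_join by blast+
    show "\<not> R a z \<longleftrightarrow> (\<exists>m. \<forall>t. ext t (snd (a, pre z m)) \<longrightarrow> \<not> F (fst (a, pre z m), t))"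
    proof
      assume "\<not> R a z"
      then have "\<not> F (a, pre z m)" for m using F(4)[OF g(1)] by blast
      then show "\<exists>m. \<forall>t. ext t (snd (a, pre z m)) \<longrightarrow> \<not> F (fst (a, pre z m), t)"
        using g(2)[unfolded gen_def, rule_format, of a] by simp
    next
      assume "\<exists>m. \<forall>t. ext t (snd (a, pre z m)) \<longrightarrow> \<not> F (fst (a, pre z m), t)"
      then obtain m where m: "\<And>t. ext t (pre z m) \<Longrightarrow> \<not> F (a, t)" by auto
      show "\<not> R a z"
      proof
        assume "R a z"
        then obtain n where "F (a, pre z n)" using F(4)[OF g(1)] by blast
        then have "F (a, pre z (max m n))" using F(3) ext_pre[of n "max m n" z] by auto
        then show False using m ext_pre[of m "max m n" z] by auto
      qed
    qed
  qed
qed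

lemma nice_conj: "nice R \<Longrightarrow> nice Q \<Longrightarrow> nice (\<lambda>x z. R x z \<and> Q x z)"
proof -
  assume "nice R" "nice Q"
  obtain F and A :: "nat \<times> nat \<Rightarrow> bool" where F0: "dec F" "dec A" "\<forall>a s t. F (a, s) \<longrightarrow> ext t s \<longrightarrow> F (a, t)"
    "\<forall>z. gen A z \<longrightarrow> (\<forall>a. R a z \<longleftrightarrow> (\<exists>m. F (a, pre z m)))" using \<open>nice R\<close> unfolding nice_def by blast
  note F = F0[rule_format]
  obtain G and B :: "nat \<times> nat \<Rightarrow> bool" where G0: "dec G" "dec B" "\<forall>a s t. G (a, s) \<longrightarrow> ext t s \<longrightarrow> G (a, t)"
    "\<forall>z. gen B z \<longrightarrow> (\<forall>a. Q a z \<longleftrightarrow> (\<exists>m. G (a, pre z m)))" using \<open>nice Q\<close> unfolding nice_def by blast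
  note G = G0[rule_format]
  show ?thesis
  proof (rule niceI[of "\<lambda>p. F p \<and> G p" "join A B"])
    show "dec (\<lambda>p. F p \<and> G p)" by (rule dec_conj) fact+
    show "dec (join A B)" by (rule dec_join) fact+
    fix z a assume "gen (join A B) z"
    then have g: "gen A z" "gen B z" using gen_join by blast+
    show "R a z \<and> Q a z \<longleftrightarrow> (\<exists>m. F (a, pre z m) \<and> G (a, pre z m))"
      unfolding F(4)[OF g(1)] G(4)[OF g(2)]
    proof safe
      fix m n assume "F (a, pre z m)" "G (a, pre z n)"
      then have "F (a, pre z (max m n)) \<and> G (a, pre z (max m n))"
        using F(3) G(3) ext_pre[of m "max m n" z] ext_pre[of n "max m n" z] by auto
      then show "\<exists>m. F (a, pre z m) \<and> G (a, pre z m)" by blast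
    qed auto
  qed (use F(3) G(3) in blast)
qed

text \<open>A true instance is forced by an initial segment, and this condition already forces the
  quantified statement; the generic family stays the same.\<close>

lemma nice_ex: "nice (\<lambda>p z. R (fst p) (snd p) z) \<Longrightarrow> nice (\<lambda>x z. \<exists>y. R x y z)"
proof -
  assume "nice (\<lambda>p z. R (fst p) (snd p) z)"
  then obtain F and A :: "nat \<times> nat \<Rightarrow> bool" where F0: "dec F" "dec A" "\<forall>a s t. F (a, s) \<longrightarrow> ext t s \<longrightarrow> F (a, t)"
    "\<forall>z. gen A z \<longrightarrow> (\<forall>a. R (fst a) (snd a) z \<longleftrightarrow> (\<exists>m. F (a, pre z m)))" unfolding nice_def by blast
  note F = F0[rule_format]
  show ?thesis
  proof (rule niceI[of "\<lambda>p. \<exists>y. F ((fst p, y), snd p)" A])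
    show "dec (\<lambda>p. \<exists>y. F ((fst p, y), snd p))"
      by (intro dec_intros dec_sub[OF F(1)] cpt_intros)
    show "\<exists>y. F ((fst (a, t), y), snd (a, t))" if "\<exists>y. F ((fst (a, s), y), snd (a, s))" "ext t s" for a s t
      using F(3)[OF _ that(2)] that(1) unfolding fst_conv snd_conv by blast
    fix z a assume g: "gen A z"
    have "R a y z \<longleftrightarrow> (\<exists>m. F ((a, y), pre z m))" for y using F(4)[OF g, of "(a, y)"] by simp
    then show "(\<exists>y. R a y z) \<longleftrightarrow> (\<exists>m. \<exists>y. F ((fst (a, pre z m), y), snd (a, pre z m)))" by auto
  qed (rule F(2))
qed

lemma nice_disj: "nice R \<Longrightarrow> nice Q \<Longrightarrow> nice (\<lambda>x z. R x z \<or> Q x z)"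
proof -
  assume "nice R" "nice Q"
  then have "nice (\<lambda>x z. \<not> (\<not> R x z \<and> \<not> Q x z))" by (intro nice_not nice_conj)
  then show ?thesis by simp
qed

lemma nice_imp: "nice R \<Longrightarrow> nice Q \<Longrightarrow> nice (\<lambda>x z. R x z \<longrightarrow> Q x z)"
  unfolding imp_conv_disj by (intro nice_disj nice_not)

lemma nice_all: "nice (\<lambda>p z. R (fst p) (snd p) z) \<Longrightarrow> nice (\<lambda>x z. \<forall>y. R x y z)"
proof -
  assume "nice (\<lambda>p z. R (fst p) (snd p) z)"
  then have "nice (\<lambda>x z. \<not> (\<exists>y. \<not> R x y z))" by (intro nice_not nice_ex)
  then show ?thesis by simp
qed

definition len :: "nat \<Rightarrow> nat" where "len t = (LEAST k. (par ^^ k) t = 0)"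

lemma len_pre: "len (pre z m) = m"
  unfolding len_def funpow_par_pre
proof (rule Least_equality)
  fix k assume "pre z (m - k) = 0"
  then show "m \<le> k" by (cases "m - k") auto
qed simp

text \<open>Right children are the nodes of the form \<open>2p + 2\<close>, so bit \<open>n\<close>
  is \<open>1\<close> iff the ancestor of length \<open>n + 1\<close> has this form. Positions
  beyond the length of \<open>s\<close> read as \<open>0\<close>.\<close>

definition bit :: "nat \<Rightarrow> nat \<Rightarrow> bool" where
  "bit s n \<longleftrightarrow> (\<exists>t. ext s t \<and> len t = Suc n \<and> t = Suc (Suc (par t + par t)))"

lemma bit_pre: "bit (pre z m) n \<longleftrightarrow> n < m \<and> z n"
proof
  assume "bit (pre z m) n"
  then obtain t where t: "ext (pre z m) t" "len t = Suc n" "t = Suc (Suc (par t + par t))"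
    unfolding bit_def by blast
  obtain k where k: "k \<le> m" "t = pre z k" using ext_preD[OF t(1)] by blast
  then have "k = Suc n" using t(2) len_pre by simp
  then have "t = pre z (Suc n)" "n < m" using k by simp_all
  moreover have "pre z (Suc n) = Suc (Suc (pre z n + pre z n))"
    using t(3) unfolding \<open>t = pre z (Suc n)\<close> par_pre .
  ultimately show "n < m \<and> z n" by (cases "z n") simp_all
next
  assume *: "n < m \<and> z n"
  show "bit (pre z m) n" unfolding bit_def
    by (rule exI[of _ "pre z (Suc n)"]) (use * ext_pre[of "Suc n" m z] par_pre[of z n] len_pre[of z "Suc n"] in simp)
qed

lemma cpt_len: "cpt f \<Longrightarrow> cpt (\<lambda>x. len (f x))"
proof -
  have "\<exists>k. (par ^^ k) t = 0" for t
  proof (induction t rule: less_induct)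
    case (less t)
    show ?case
    proof (cases "t = 0")
      case True
      then show ?thesis by (intro exI[of _ 0]) simp
    next
      case False
      then have "par t < t" by (auto simp: par_def)
      then obtain k where "(par ^^ k) (par t) = 0" using less by blast
      then show ?thesis by (intro exI[of _ "Suc k"]) (simp add: funpow_swap1)
    qed
  qed
  then have "cpt len" unfolding len_def[abs_def]
    by (intro cpt_Least dec_eq cpt_funpow cpt_par cpt_intros)
  then show "cpt f \<Longrightarrow> cpt (\<lambda>x. len (f x))" by (rule cpt_comp)
qed

lemma dec_bit: "cpt f \<Longrightarrow> cpt g \<Longrightarrow> dec (\<lambda>x. bit (f x) (g x))"
proof -
  have "dec (\<lambda>p. bit (fst p) (snd p))"
    unfolding bit_def by (intro dec_intros dec_ext cpt_len cpt_add cpt_par cpt_intros)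
  then show "cpt f \<Longrightarrow> cpt g \<Longrightarrow> dec (\<lambda>x. bit (f x) (g x))" by (rule dec_sub2)
qed

lemma bit_mono: "bit s n \<Longrightarrow> ext t s \<Longrightarrow> bit t n"
  unfolding bit_def using ext_trans by blast

lemma nice_oracle: "cpt f \<Longrightarrow> nice (\<lambda>x z. z (f x))"
proof -
  have "nice (\<lambda>n z. z n)"
  proof (rule niceI[of "\<lambda>p. bit (snd p) (fst p)" "\<lambda>p :: nat \<times> nat. False"])
    show "dec (\<lambda>p. bit (snd p) (fst p))" by (intro dec_bit cpt_intros)
    show "z n \<longleftrightarrow> (\<exists>m. bit (snd (n, pre z m)) (fst (n, pre z m)))" for z n
      by (auto simp: bit_pre intro: exI[of _ "Suc n"])
  qed (auto intro: dec_const bit_mono)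
  then show "cpt f \<Longrightarrow> nice (\<lambda>x z. z (f x))" by (rule nice_sub)
qed

text \<open>If a premise \<open>b\<close> is forced only densely below a condition, the initial
  segment of \<open>z\<close> that finally forces \<open>b\<close> may do so at a stage as late as
  that of \<open>a\<close>. So \<open>D3\<close> asks for conditions that force \<open>b\<close> at
  an earlier stage than \<open>a\<close>. Stage comparison makes this a decidable requirement, and
  truth follows from forcing by induction on stages.\<close>

lemma nice_ind:
  fixes V :: "creal \<Rightarrow> 'a::enc \<Rightarrow> 'b::enc \<Rightarrow> bool"
  assumes "nice (\<lambda>p z. V z (fst p) (snd p))" "nice (\<lambda>p z. M z (fst p) (fst (snd p)) (snd (snd p)))"
  shows "nice (\<lambda>a z. ind (V z) (M z) a)"
proof -
  obtain FV and AV :: "nat \<times> nat \<Rightarrow> bool" where FV0: "dec FV" "dec AV"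
    "\<forall>a s t. FV (a, s) \<longrightarrow> ext t s \<longrightarrow> FV (a, t)"
    "\<forall>z. gen AV z \<longrightarrow> (\<forall>a. V z (fst a) (snd a) \<longleftrightarrow> (\<exists>m. FV (a, pre z m)))"
    using assms(1) unfolding nice_def by blast
  note FV = FV0[rule_format]
  obtain FM and AM :: "nat \<times> nat \<Rightarrow> bool" where FM0: "dec FM" "dec AM"
    "\<forall>a s t. FM (a, s) \<longrightarrow> ext t s \<longrightarrow> FM (a, t)"
    "\<forall>z. gen AM z \<longrightarrow> (\<forall>a. M z (fst a) (fst (snd a)) (snd (snd a)) \<longleftrightarrow> (\<exists>m. FM (a, pre z m)))"
    using assms(2) unfolding nice_def by blast
  note FM = FM0[rule_format]
  text \<open>Forcing is again inductively defined: a position \<open>(0, a, s)\<close> stands for \<open>s\<close> forcing \<open>a\<close> into the set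
    by means of a fixed rule instance, a position \<open>(1, b, t)\<close> for some extension of \<open>t\<close> forcing \<open>b\<close>.\<close>
  define V1 :: "nat \<times> 'a \<times> nat \<Rightarrow> 'b \<times> nat \<Rightarrow> bool" where
    "V1 x r \<longleftrightarrow> fst x = 0 \<and> FV ((fst (snd x), fst r), snd (snd x)) \<or> fst x \<noteq> 0 \<and> ext (snd r) (snd (snd x))" for x r
  define M1 :: "nat \<times> 'a \<times> nat \<Rightarrow> 'b \<times> nat \<Rightarrow> nat \<times> 'a \<times> nat \<Rightarrow> bool" where
    "M1 x r y \<longleftrightarrow> fst x = 0 \<and> (\<exists>b t. ext t (snd (snd x)) \<and> FM ((fst (snd x), fst r, b), t) \<and> y = (1, b, t)) \<or>
       fst x \<noteq> 0 \<and> y = (0, fst (snd x), snd r)" for x r y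
  have dV1: "dec (\<lambda>p. V1 (fst p) (snd p))"
    unfolding V1_def by (intro dec_intros dec_ext dec_sub[OF FV(1)] cpt_intros)
  have dM1: "dec (\<lambda>p. M1 (fst p) (fst (snd p)) (snd (snd p)))"
    unfolding M1_def by (intro dec_intros dec_ext dec_sub[OF FM(1)] cpt_intros)
  define FN where "FN p \<longleftrightarrow> ind V1 M1 (0, fst p, snd p)" for p
  have dFN: "dec FN"
    unfolding FN_def[abs_def] by (intro dec_sub[OF dec_ind[OF dV1 dM1]] cpt_intros)
  have i1: "ind V1 M1 (1, b, t) \<longleftrightarrow> (\<exists>t'. ext t' t \<and> FN (b, t'))" for b t
    unfolding FN_def by (subst ind_iff) (auto simp: V1_def M1_def)
  have FN_iff: "FN (a, s) \<longleftrightarrow> (\<exists>i. FV ((a, i), s) \<and>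
     (\<forall>b t. ext t s \<longrightarrow> FM ((a, i, b), t) \<longrightarrow> (\<exists>t'. ext t' t \<and> FN (b, t'))))" for a s
  proof -
    have "FN (a, s) \<longleftrightarrow> (\<exists>r. V1 (0, a, s) r \<and> (\<forall>y. M1 (0, a, s) r y \<longrightarrow> ind V1 M1 y))"
      unfolding FN_def fst_conv snd_conv by (rule ind_iff)
    also have "\<dots> \<longleftrightarrow> (\<exists>i. FV ((a, i), s) \<and> (\<forall>b t. ext t s \<longrightarrow> FM ((a, i, b), t) \<longrightarrow> ind V1 M1 (1, b, t)))"
      by (auto simp: V1_def M1_def)
    finally show ?thesis unfolding i1 .
  qed
  have FN_mono: "FN (a, t)" if "FN (a, s)" "ext t s" for a s t
    using that FV(3) ext_trans unfolding FN_iff[of a] by blast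
  let ?Lt = "Lt V1 M1"
  \<comment> \<open>The condition makes \<open>b\<close> a premise, but no extension forces
    \<open>b\<close> into the set. Meeting \<open>D2\<close> contradicts the induction hypothesis
    for \<open>b\<close>; avoiding it turns the rule instance into a forcing derivation.\<close>
  define D2 where "D2 p \<longleftrightarrow> (\<exists>b. FM ((fst (fst p), snd (fst p), b), snd p) \<and>
     (\<forall>t'. ext t' (snd p) \<longrightarrow> \<not> FN (b, t')))" for p :: "('a \<times> 'b) \<times> nat"
  \<comment> \<open>The comparison passes through the position \<open>(1, b, t)\<close>, since this
    one, and not \<open>(0, b, _)\<close>, is a premise of the position of \<open>a\<close>.\<close>
  define D3 where "D3 p \<longleftrightarrow> (\<exists>t. ext (snd p) t \<and> ?Lt (0, fst (fst p), snd p) (1, fst (fst p), t) \<and>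
     ?Lt (1, fst (fst p), t) (0, snd (fst p)))" for p :: "('a \<times> 'a \<times> nat) \<times> nat"
  have dD2: "dec D2" unfolding D2_def[abs_def]
    by (intro dec_intros dec_ext dec_sub[OF FM(1)] dec_sub[OF dFN] cpt_intros)
  have dD3: "dec D3" unfolding D3_def[abs_def]
    by (intro dec_intros dec_ext dec_sub2[OF dec_Lt[OF dV1 dM1]] cpt_intros)
  show ?thesis
  proof (rule niceI[of FN "join (join AV AM) (join FN (join D2 D3))"])
    show "dec (join (join AV AM) (join FN (join D2 D3)))"
      by (intro dec_join FV(2) FM(2) dFN dD2 dD3)
    fix z a assume "gen (join (join AV AM) (join FN (join D2 D3))) z"
    then have g: "gen AV z" "gen AM z" "gen FN z" "gen D2 z" "gen D3 z"
      by (auto dest!: gen_join)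
    have Vz: "V z a i \<longleftrightarrow> (\<exists>m. FV ((a, i), pre z m))" for a i using FV(4)[OF g(1), of "(a, i)"] by simp
    have Mz: "M z a i b \<longleftrightarrow> (\<exists>m. FM ((a, i, b), pre z m))" for a i b
      using FM(4)[OF g(2), of "(a, i, b)"] by simp
    have 1: "ind (V z) (M z) a \<Longrightarrow> \<exists>m. FN (a, pre z m)" for a
    proof (induction rule: ind.induct)
      case (indI a i)
      obtain m0 where m0: "FV ((a, i), pre z m0)" using indI(1) Vz by blast
      show ?case
      proof (rule genE[OF g(3), of a])
        fix m1 assume m1: "\<And>t. ext t (pre z m1) \<Longrightarrow> \<not> FN (a, t)"
        show ?case
        proof (rule genE[OF g(4), of "(a, i)"])
          fix m assume "D2 ((a, i), pre z m)"
          then obtain b where b: "FM ((a, i, b), pre z m)" "\<forall>t'. ext t' (pre z m) \<longrightarrow> \<not> FN (b, t')"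
            unfolding D2_def fst_conv snd_conv by blast
          then obtain m' where "FN (b, pre z m')" using indI.IH Mz by blast
          moreover have "ext (pre z (max m m')) (pre z m')" "ext (pre z (max m m')) (pre z m)"
            by (intro ext_pre; simp)+
          ultimately show ?case using FN_mono b(2) by blast
        next
          fix m2 assume m2: "\<And>t. ext t (pre z m2) \<Longrightarrow> \<not> D2 ((a, i), t)"
          define s where "s = pre z (max m0 (max m1 m2))"
          have e: "ext s (pre z m0)" "ext s (pre z m1)" "ext s (pre z m2)"
            unfolding s_def by (intro ext_pre; simp)+
          have "FN (a, s)"
          proof (rule iffD2[OF FN_iff], intro exI[of _ i] conjI allI impI)
            show "FV ((a, i), s)" using FV(3)[OF m0 e(1)] .
            fix b t assume t: "ext t s" "FM ((a, i, b), t)"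
            then show "\<exists>t'. ext t' t \<and> FN (b, t')"
              using m2[OF ext_trans[OF t(1) e(3)]] unfolding D2_def fst_conv snd_conv by blast
          qed
          then show ?case using m1 e(2) by blast
        qed
      qed blast
    qed
    let ?r = "\<lambda>c a. ?Lt c a \<and> ind V1 M1 a"
    \<comment> \<open>Induction along the transitive closure, so that the two comparisons in
      \<open>D3\<close> count as one descent.\<close>
    have 2: "x = (0, a, pre z m) \<Longrightarrow> ind V1 M1 x \<Longrightarrow> ind (V z) (M z) a" for x a m
    proof (induction x arbitrary: a m rule: wfp_induct_rule[OF wfp_tranclp[OF wfp_Lt[of V1 M1]]])
      case (1 x)
      note x = 1(2)
      obtain r where r: "V1 x r" "\<And>y. M1 x r y \<Longrightarrow> ind V1 M1 y \<and> ?Lt y x"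
        using ind_Lt_step[OF 1(3)] by blast
      define i where "i = fst r"
      have "FV ((a, i), pre z m)" using r(1) unfolding x V1_def i_def by simp
      then have "V z a i" using Vz by blast
      moreover have "ind (V z) (M z) b" if mb: "M z a i b" for b
      proof -
        obtain m1 where m1: "FM ((a, i, b), pre z m1)" using mb Mz by blast
        show ?thesis
        proof (rule genE[OF g(5), of "(b, a, pre z m)"])
          fix k assume "D3 ((b, a, pre z m), pre z k)"
          then obtain t where t: "?Lt (0, b, pre z k) (1, b, t)" "?Lt (1, b, t) x"
            unfolding D3_def x fst_conv snd_conv by blast
          have i1: "ind V1 M1 (1, b, t)" by (rule Lt_ind[OF 1(3) t(2)])
          have i0: "ind V1 M1 (0, b, pre z k)" by (rule Lt_ind[OF i1 t(1)])
          have "?r\<^sup>+\<^sup>+ (0, b, pre z k) x"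
            using tranclp.trancl_into_trancl[OF tranclp.r_into_trancl[of ?r]] t i1 1(3) by blast
          then show ?thesis using 1(1) i0 by blast
        next
          \<comment> \<open>Avoiding \<open>D3\<close> is impossible: the rule deriving
            \<open>(1, b, t)\<close> with earlier premises names an extension of \<open>t\<close>
            that lies in \<open>D3\<close>.\<close>
          fix k assume k: "\<And>t. ext t (pre z k) \<Longrightarrow> \<not> D3 ((b, a, pre z m), t)"
          define t where "t = pre z (max k (max m m1))"
          have e: "ext t (pre z k)" "ext t (pre z m)" "ext t (pre z m1)"
            unfolding t_def by (intro ext_pre; simp)+
          have "M1 x r (1, b, t)" unfolding M1_def x using e FM(3)[OF m1 e(3)] i_def by simp
          then have t: "ind V1 M1 (1, b, t)" "?Lt (1, b, t) x" using r(2) by blast+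
          obtain r' where r': "V1 (1, b, t) r'" "\<And>y. M1 (1, b, t) r' y \<Longrightarrow> ind V1 M1 y \<and> ?Lt y (1, b, t)"
            using ind_Lt_step[OF t(1)] by blast
          have e': "ext (snd r') t" using r'(1) by (simp add: V1_def)
          have "M1 (1, b, t) r' (0, b, snd r')" by (simp add: M1_def)
          then have "?Lt (0, b, snd r') (1, b, t)" using r'(2) by blast
          then have "D3 ((b, a, pre z m), snd r')"
            using t(2) e' unfolding D3_def x fst_conv snd_conv by blast
          then show ?thesis using k ext_trans[OF e' e(1)] by blast
        qed
      qed
      ultimately show ?case by (rule ind.indI)
    qed
    show "ind (V z) (M z) a \<longleftrightarrow> (\<exists>m. FN (a, pre z m))"
      using 1 2 unfolding FN_def fst_conv snd_conv by blast
  qed (use dFN FN_mono in blast)+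
qed

subsection \<open>Generic reals and category\<close>

lemma pre_cong: "(\<And>i. i < m \<Longrightarrow> z i = y i) \<Longrightarrow> pre z m = pre y m"
  by (induction m) auto

lemma pre_eqD: "pre z m = pre y m \<Longrightarrow> i < m \<Longrightarrow> z i = y i"
  using bit_pre by metis

lemma pre_surj: "\<exists>z m. s = pre z m"
proof (induction s rule: less_induct)
  case (less s)
  show ?case
  proof (cases "s = 0")
    case True
    then show ?thesis by (metis pre.simps(1))
  next
    case False
    define p where "p = (s - 1) div 2"
    have "p < s" using False by (auto simp: p_def)
    then obtain z m where z: "p = pre z m" using less by blast
    define b where "b = odd (s - 1)"
    have s: "s = Suc (2 * p + of_bool b)"
      using False unfolding p_def b_def by (cases s) (auto simp: odd_two_times_div_two_succ)
    have "pre (z(m := b)) m = p" unfolding z by (rule pre_cong) simp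
    then have "s = pre (z(m := b)) (Suc m)" using s by (simp only: pre.simps fun_upd_same)
    then show ?thesis by blast
  qed
qed

lemma ext_len_le: "ext t s \<Longrightarrow> len s \<le> len t"
  by (metis pre_surj ext_preD len_pre)

lemma ext_child: "ext (Suc (t + t)) t"
  unfolding ext_def by (rule exI[of _ 1]) (simp add: par_def)

lemma len_child: "len (Suc (t + t)) = Suc (len t)"
proof -
  obtain z m where t: "t = pre z m" using pre_surj by blast
  have "pre (z(m := False)) m = t" unfolding t by (rule pre_cong) simp
  then have "Suc (t + t) = pre (z(m := False)) (Suc m)" by simp
  then show ?thesis using t len_pre by metis
qed

text \<open>Each bit is read off a condition long enough to contain it, and bits do not change along
  the chain.\<close>

lemma chain_limit:
  assumes e: "\<And>n. ext (s (Suc n)) (s n)" and l: "\<And>n. n \<le> len (s n)"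
  shows "pre (\<lambda>i. bit (s (Suc i)) i) (len (s n)) = s n"
proof -
  have ch: "ext (s n) (s m)" if "m \<le> n" for m n
    using that by (induction rule: dec_induct) (use ext_refl e ext_trans in blast)+
  obtain y m where y: "s n = pre y m" using pre_surj by blast
  have "bit (s (Suc i)) i = y i" if i: "i < m" for i
  proof -
    let ?N = "max n (Suc i)"
    obtain y' m' where y': "s ?N = pre y' m'" using pre_surj by blast
    obtain k where k: "s n = pre y' k" using ext_preD[of y' m' "s n"] ch[of n ?N] y' by auto
    obtain k' where k': "s (Suc i) = pre y' k'" using ext_preD[of y' m' "s (Suc i)"] ch[of "Suc i" ?N] y' by auto
    have "k = m" using y k len_pre by metis
    then have "y' i = y i" using y k i pre_eqD by metis
    moreover have "i < k'" using l[of "Suc i"] k' len_pre[of y' k'] by simp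
    ultimately show ?thesis unfolding k' bit_pre by blast
  qed
  then have "pre (\<lambda>i. bit (s (Suc i)) i) m = pre y m" by (rule pre_cong)
  then show ?thesis using y len_pre[of y m] by simp
qed

text \<open>Baire category on conditions. A zero bit is appended after each step so that the lengths
  grow and the chain determines a total real.\<close>

lemma dense_meet:
  assumes D: "\<And>j s. \<exists>t. ext t s \<and> D j t"
  shows "\<exists>z m. pre z m = s0 \<and> (\<forall>j::nat. \<exists>m. D j (pre z m))"
proof -
  have "\<exists>s. \<forall>n. (n \<le> len (s n) \<and> (n = 0 \<longrightarrow> s n = s0)) \<and> (\<exists>t. ext t (s n) \<and> D n t \<and> s (Suc n) = Suc (t + t))"
  proof (rule dependent_nat_choice)
    show "\<exists>x. 0 \<le> len x \<and> (0 = (0::nat) \<longrightarrow> x = s0)" by blast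
    fix x and n :: nat assume x: "n \<le> len x \<and> (n = 0 \<longrightarrow> x = s0)"
    obtain t where t: "ext t x" "D n t" using D by blast
    then have "Suc n \<le> len (Suc (t + t))" using x ext_len_le[OF t(1)] by (simp add: len_child)
    then show "\<exists>y. (Suc n \<le> len y \<and> (Suc n = 0 \<longrightarrow> y = s0)) \<and> (\<exists>t. ext t x \<and> D n t \<and> y = Suc (t + t))"
      using t by blast
  qed
  then obtain s where s: "\<And>n. n \<le> len (s n)" "s 0 = s0"
     "\<And>n. \<exists>t. ext t (s n) \<and> D n t \<and> s (Suc n) = Suc (t + t)" by blast
  have e: "ext (s (Suc n)) (s n)" for n using s(3)[of n] ext_child ext_trans by metis
  define z where "z i = bit (s (Suc i)) i" for i
  have z: "pre z (len (s n)) = s n" for n unfolding z_def by (rule chain_limit[OF e s(1)])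
  have "\<exists>m. D j (pre z m)" for j
  proof -
    obtain t where t: "D j t" "s (Suc j) = Suc (t + t)" using s(3) by blast
    then have "ext (pre z (len (s (Suc j)))) t" unfolding z using ext_child by simp
    then show ?thesis using t(1) ext_preD by metis
  qed
  then show ?thesis using z[of 0] s(2) by blast
qed

text \<open>It can be decided whether section \<open>j\<close> has an element extending
  \<open>s\<close>, which makes the usual construction of a generic real effective; the second
  clause keeps the function total.\<close>

definition pick :: "(nat \<times> nat \<Rightarrow> bool) \<Rightarrow> nat \<Rightarrow> nat \<Rightarrow> nat" where
  "pick A j s = (LEAST t. ext t s \<and> A (j, t) \<or> \<not> (\<exists>t. ext t s \<and> A (j, t)) \<and> t = s)"

definition gstep :: "(nat \<times> nat \<Rightarrow> bool) \<Rightarrow> nat \<times> nat \<Rightarrow> nat \<times> nat" where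
  "gstep A p = (Suc (fst p), Suc (pick A (fst p) (snd p) + pick A (fst p) (snd p)))"

lemma decidable_generic:
  fixes A :: "nat \<times> nat \<Rightarrow> bool"
  assumes A: "dec A"
  shows "\<exists>x. dec x \<and> gen A x"
proof -
  define s where "s n = snd ((gstep A ^^ n) (0, 0))" for n
  have fst: "fst ((gstep A ^^ n) (0, 0)) = n" for n by (induction n) (auto simp: gstep_def)
  have s0: "s 0 = 0" by (simp add: s_def)
  have sS: "s (Suc n) = Suc (pick A n (s n) + pick A n (s n))" for n
    by (simp add: s_def gstep_def fst)
  have ex: "\<exists>t. ext t s \<and> A (j, t) \<or> \<not> (\<exists>t. ext t s \<and> A (j, t)) \<and> t = s" for j s by blast
  have pick: "ext (pick A j s) s \<and> A (j, pick A j s) \<or> \<not> (\<exists>t. ext t s \<and> A (j, t)) \<and> pick A j s = s" for j s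
    unfolding pick_def by (rule LeastI_ex[OF ex])
  then have pe: "ext (pick A j s) s" for j s using ext_refl by metis
  have e: "ext (s (Suc n)) (s n)" for n unfolding sS using ext_child pe ext_trans by metis
  have l: "n \<le> len (s n)" for n
  proof (induction n)
    case (Suc n)
    then show ?case unfolding sS len_child using ext_len_le[OF pe[of n "s n"]] by linarith
  qed simp
  define x where "x i = bit (s (Suc i)) i" for i
  have x: "pre x (len (s n)) = s n" for n unfolding x_def by (rule chain_limit[OF e l])
  have "gen A x"
    unfolding gen_def
  proof
    fix j
    show "(\<exists>m. A (j, pre x m)) \<or> (\<exists>m. \<forall>t. ext t (pre x m) \<longrightarrow> \<not> A (j, t))"
    proof (cases "\<exists>t. ext t (s j) \<and> A (j, t)")
      case True
      then have a: "A (j, pick A j (s j))" using pick by blast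
      have "ext (pre x (len (s (Suc j)))) (pick A j (s j))" unfolding x unfolding sS by (rule ext_child)
      then show ?thesis using a ext_preD by metis
    next
      case False
      then have "\<forall>t. ext t (pre x (len (s j))) \<longrightarrow> \<not> A (j, t)" unfolding x by blast
      then show ?thesis by blast
    qed
  qed
  moreover have "dec x"
  proof -
    have "cpt (\<lambda>p. pick A (fst p) (snd p))"
      unfolding pick_def
      by (rule cpt_Least) (intro dec_intros dec_ext dec_sub[OF A] cpt_intros, rule ex)
    then have "cpt (gstep A)"
      unfolding gstep_def[abs_def] by (intro cpt_intros cpt_add)
    then show ?thesis
      unfolding x_def[abs_def] s_def by (intro dec_bit cpt_intros cpt_funpow)
  qed
  ultimately show ?thesis by blast
qed

section \<open>Cylinders and category in Cantor space\<close>

lemma vimage_coordinate: "open {y :: creal. y i = b}" "closed {y :: creal. y i = b}"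
proof -
  have c: "continuous_on UNIV (\<lambda>y :: creal. y i)" by (rule continuous_on_product_coordinates)
  have eq: "{y :: creal. y i = b} = (\<lambda>y. y i) -` {b}" by auto
  show "open {y :: creal. y i = b}" unfolding eq by (rule open_vimage[OF open_discrete c])
  show "closed {y :: creal. y i = b}" unfolding eq by (rule closed_vimage[OF _ c]) simp
qed

lemma open_cylinder: "open {y. pre y m = pre z m}"
proof -
  have "pre y m = pre z m \<longleftrightarrow> (\<forall>i<m. y i = z i)" for y
    using pre_eqD[of y m z] pre_cong[of m y z] by blast
  then have "{y. pre y m = pre z m} = (\<Inter>i\<in>{..<m}. {y. y i = z i})" by auto
  moreover have "open (\<Inter>i\<in>{..<m}. {y. y i = z i})"
    by (rule open_INT) (simp_all add: vimage_coordinate)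
  ultimately show ?thesis by simp
qed

lemma open_contains_cylinder:
  assumes U: "open U" "z \<in> U"
  shows "\<exists>m. \<forall>y. pre y m = pre z m \<longrightarrow> y \<in> U"
proof -
  have "openin (product_topology (\<lambda>i. euclidean) UNIV) U" using U(1) by (simp add: open_fun_def)
  then obtain X where X: "z \<in> (\<Pi>\<^sub>E i\<in>UNIV. X i)" "finite {i. X i \<noteq> topspace (euclidean :: bool topology)}"
     "(\<Pi>\<^sub>E i\<in>UNIV. X i) \<subseteq> U"
    using product_topology_open_contains_basis[OF _ U(2)] by blast
  obtain m where m: "\<And>i. X i \<noteq> UNIV \<Longrightarrow> i < m"
    using finite_nat_set_iff_bounded[of "{i. X i \<noteq> UNIV}"] X(2) by auto
  have "y \<in> U" if "pre y m = pre z m" for y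
  proof -
    have "y i \<in> X i" for i
    proof (cases "X i = UNIV")
      case False
      then have "y i = z i" using m that pre_eqD by blast
      then show ?thesis using X(1) by (simp add: PiE_iff)
    qed simp
    then show ?thesis using X(3) by (auto simp: PiE_iff)
  qed
  then show ?thesis by blast
qed

text \<open>No cylinder lies in the closure of \<open>F\<close>, and the open complement of the
  closure contains a cylinder around each of its points.\<close>

lemma nowhere_dense_avoid:
  assumes "nowhere_dense F"
  shows "\<exists>t. ext t s \<and> (\<forall>z m. pre z m = t \<longrightarrow> z \<notin> F)"
proof -
  obtain y k where y: "s = pre y k" using pre_surj by blast
  have "\<not> {z. pre z k = pre y k} \<subseteq> closure F"
    using assms interior_maximal[OF _ open_cylinder[of k y], of "closure F"] unfolding nowhere_dense_def by auto
  then obtain z where z: "pre z k = s" "z \<notin> closure F" using y by blast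
  obtain m where m: "\<And>u. pre u m = pre z m \<Longrightarrow> u \<notin> closure F"
    using open_contains_cylinder[of "- closure F" z] z(2) by auto
  define n where "n = max k m"
  have "ext (pre z n) s" using z(1) ext_pre[of k n z] by (simp add: n_def)
  moreover have "u \<notin> F" if "pre u j = pre z n" for u j
  proof -
    have "j = n" using that len_pre by metis
    then have "pre u m = pre z m"
      using that by (intro pre_cong) (metis pre_eqD n_def max.cobounded2 order_less_le_trans)
    then show ?thesis using m closure_subset by blast
  qed
  ultimately show ?thesis by blast
qed

lemma nowhere_dense_singleton: "nowhere_dense {x :: creal}"
proof -
  have "{x} = (\<Inter>i. {y. y i = x i})" by auto
  moreover have "closed (\<Inter>i. {y. y i = x i})"
    by (rule closed_INT) (simp add: vimage_coordinate)
  ultimately have "closed {x}" by simp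
  moreover have "interior {x} = {}"
  proof (rule ccontr)
    assume "interior {x} \<noteq> {}"
    then have "x \<in> interior {x}" using interior_subset by fastforce
    then obtain m where m: "\<And>y. pre y m = pre x m \<Longrightarrow> y \<in> interior {x}"
      using open_contains_cylinder[OF open_interior] by blast
    have "pre (x(m := \<not> x m)) m = pre x m" by (rule pre_cong) simp
    then have "x(m := \<not> x m) = x" using m interior_subset by blast
    then have "(x(m := \<not> x m)) m = x m" by (rule fun_cong)
    then show False by simp
  qed
  ultimately show ?thesis unfolding nowhere_dense_def by (simp add: closure_closed)
qed

lemma meager_UN:
  assumes "countable K" "\<And>X. X \<in> K \<Longrightarrow> meager X"
  shows "meager (\<Union>K)"
proof (cases "K = {}")
  case True
  have "nowhere_dense ({} :: 'a set)" by (simp add: nowhere_dense_def)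
  then show ?thesis unfolding meager_def using True by (intro exI[of _ "\<lambda>_. {}"]) auto
next
  case False
  define e where "e = from_nat_into K"
  have e: "range e = K" unfolding e_def using False assms(1) by (rule range_from_nat_into)
  have "\<exists>F :: nat \<Rightarrow> 'a set. (\<forall>n. nowhere_dense (F n)) \<and> e i \<subseteq> (\<Union>n. F n)" for i
    using assms(2)[of "e i"] e unfolding meager_def by blast
  then have "\<exists>F. \<forall>i. (\<forall>n :: nat. nowhere_dense (F i n :: 'a set)) \<and> e i \<subseteq> (\<Union>n. F i n)"
    by (intro choice) blast
  then obtain F where F: "\<And>i n. nowhere_dense (F i (n :: nat) :: 'a set)" "\<And>i. e i \<subseteq> (\<Union>n. F i n)" by blast
  show ?thesis unfolding meager_def
  proof (intro exI[of _ "\<lambda>n. F (pfst n) (psnd n)"] conjI allI)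
    show "\<Union>K \<subseteq> (\<Union>n. F (pfst n) (psnd n))"
    proof
      fix x assume "x \<in> \<Union>K"
      then obtain i where "x \<in> e i" using e by blast
      then obtain n where "x \<in> F i n" using F(2) by blast
      then show "x \<in> (\<Union>n. F (pfst n) (psnd n))" by (intro UN_I[of "prod_encode (i, n)"]) auto
    qed
  qed (rule F(1))
qed

text \<open>Each requirement asks at once to leave a nowhere dense set and to meet or avoid a
  section of \<open>A\<close>. Leaving the set persists under extension, so both can be achieved in
  turn.\<close>

lemma generic_avoiding_meager:
  fixes A :: "nat \<times> nat \<Rightarrow> bool"
  assumes "meager U"
  shows "\<exists>z m. pre z m = s \<and> gen A z \<and> z \<notin> U"
proof -
  obtain F :: "nat \<Rightarrow> creal set" where F: "\<And>n. nowhere_dense (F n)" "U \<subseteq> (\<Union>n. F n)"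
    using assms unfolding meager_def by blast
  define D where "D j t \<longleftrightarrow> (\<forall>z m. pre z m = t \<longrightarrow> z \<notin> F (psnd j)) \<and>
     (A (psnd j, t) \<or> (\<forall>t'. ext t' t \<longrightarrow> \<not> A (psnd j, t')))" for j t
  have D: "\<exists>t. ext t s \<and> D j t" for j s
  proof -
    obtain t where t: "ext t s" "\<And>z m. pre z m = t \<Longrightarrow> z \<notin> F (psnd j)"
      using nowhere_dense_avoid[OF F(1)] by blast
    obtain t' where t': "ext t' t" "A (psnd j, t') \<or> (\<forall>u. ext u t' \<longrightarrow> \<not> A (psnd j, u))"
      using ext_refl by blast
    have "z \<notin> F (psnd j)" if "pre z m = t'" for z m using ext_preD[of z m t] t(2) t'(1) that by metis
    then show ?thesis using t(1) t' ext_trans unfolding D_def by blast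
  qed
  obtain z m where z: "pre z m = s" "\<And>j. \<exists>m. D j (pre z m)" using dense_meet[of D s, OF D] by blast
  have "z \<notin> F n" for n
    using z(2)[of "prod_encode (0, n)"] unfolding D_def by auto
  moreover have "gen A z" unfolding gen_def
  proof
    fix i show "(\<exists>m. A (i, pre z m)) \<or> (\<exists>m. \<forall>t. ext t (pre z m) \<longrightarrow> \<not> A (i, t))"
      using z(2)[of "prod_encode (0, i)"] unfolding D_def by auto
  qed
  ultimately show ?thesis using F(2) z(1) by blast
qed

subsection \<open>Runs as inductively defined relations\<close>

text \<open>Configurations are vectors whose coordinate \<open>0\<close> is the program line and whose coordinate \<open>n + 1\<close> is
  the register \<open>n\<close>; \<open>N\<close> bounds the registers that occur in the program.\<close>

fun rbound :: "instr \<Rightarrow> nat" where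
  "rbound (Zero n) = Suc n"
| "rbound (Inc n) = Suc n"
| "rbound (Copy m n) = Suc (max m n)"
| "rbound (Jump m n q) = Suc (max m n)"
| "rbound (Oracle n) = Suc n"

text \<open>Instructions are rendered as formulas made of connectives, equations and oracle atoms,
  so that the closure rules for \<open>nice\<close> apply to them.\<close>

fun newval :: "instr \<Rightarrow> creal \<Rightarrow> nat list \<Rightarrow> nat \<Rightarrow> nat \<Rightarrow> bool" where
  "newval (Zero n) z v j x \<longleftrightarrow> j = 0 \<and> x = Suc (nth0 v 0) \<or> j = Suc n \<and> x = 0 \<or>
     j \<noteq> 0 \<and> j \<noteq> Suc n \<and> x = nth0 v j"
| "newval (Inc n) z v j x \<longleftrightarrow> j = 0 \<and> x = Suc (nth0 v 0) \<or> j = Suc n \<and> x = Suc (nth0 v (Suc n)) \<or>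
     j \<noteq> 0 \<and> j \<noteq> Suc n \<and> x = nth0 v j"
| "newval (Copy m n) z v j x \<longleftrightarrow> j = 0 \<and> x = Suc (nth0 v 0) \<or> j = Suc n \<and> x = nth0 v (Suc m) \<or>
     j \<noteq> 0 \<and> j \<noteq> Suc n \<and> x = nth0 v j"
| "newval (Jump m n q) z v j x \<longleftrightarrow> j = 0 \<and> nth0 v (Suc m) = nth0 v (Suc n) \<and> x = q \<or>
     j = 0 \<and> nth0 v (Suc m) \<noteq> nth0 v (Suc n) \<and> x = Suc (nth0 v 0) \<or> j \<noteq> 0 \<and> x = nth0 v j"
| "newval (Oracle n) z v j x \<longleftrightarrow> j = 0 \<and> x = Suc (nth0 v 0) \<or>
     j = Suc n \<and> (z (nth0 v (Suc n)) \<and> x = 1 \<or> \<not> z (nth0 v (Suc n)) \<and> x = 0) \<or>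
     j \<noteq> 0 \<and> j \<noteq> Suc n \<and> x = nth0 v j"

definition vec :: "nat \<Rightarrow> config \<Rightarrow> nat list" where
  "vec N c = fst c # map (snd c) [0..<N]"

lemma length_vec: "length (vec N c) = Suc N"
  by (simp add: vec_def)

lemma nth0_vec: "nth0 (vec N c) j = (if j = 0 then fst c else if j \<le> N then snd c (j - 1) else 0)"
  unfolding nth0_eq vec_def by (cases j) auto

definition vstep :: "program \<Rightarrow> nat \<Rightarrow> creal \<Rightarrow> nat list \<Rightarrow> nat list \<Rightarrow> bool" where
  "vstep P N z v v' \<longleftrightarrow> length v' = Suc N \<and>
     (\<exists>l<length P. nth0 v 0 = l \<and> (\<forall>j. j \<le> N \<longrightarrow> newval (P ! l) z v j (nth0 v' j)))"

lemma vec_eqI: "length v = Suc N \<Longrightarrow> length v' = Suc N \<Longrightarrow> (\<And>j. j \<le> N \<Longrightarrow> nth0 v j = nth0 v' j) \<Longrightarrow> v = v'"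
  by (rule nth_equalityI) (auto simp: nth0_eq less_Suc_eq_le)

lemma newval_unique: "newval i z v j x \<Longrightarrow> newval i z v j x' \<Longrightarrow> x = x'"
  by (cases i) auto

lemma vstep_unique: "vstep P N z v v' \<Longrightarrow> vstep P N z v v'' \<Longrightarrow> v' = v''"
proof -
  assume a: "vstep P N z v v'" and b: "vstep P N z v v''"
  show ?thesis
  proof (rule vec_eqI)
    fix j assume "j \<le> N"
    then have "newval (P ! nth0 v 0) z v j (nth0 v' j)" "newval (P ! nth0 v 0) z v j (nth0 v'' j)"
      using a b unfolding vstep_def by auto
    then show "nth0 v' j = nth0 v'' j" by (rule newval_unique)
  qed (use a b in \<open>auto simp: vstep_def\<close>)
qed

lemma vstep_vec:
  assumes "\<And>i. i \<in> set P \<Longrightarrow> rbound i \<le> N" "fst c < length P"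
  shows "vstep P N z (vec N c) (vec N (step P z c))"
proof -
  obtain l R where c: "c = (l, R)" by (cases c)
  have b: "rbound (P ! l) \<le> N" using assms c by simp
  have "newval (P ! l) z (vec N c) j (nth0 (vec N (exec z (P ! l) c)) j)" if "j \<le> N" for j
    using b that unfolding c by (cases "P ! l") (auto simp: nth0_vec)
  then show ?thesis using assms(2) unfolding vstep_def step_def length_vec c by (auto simp: nth0_vec)
qed

text \<open>The cone consists of the non-halting vectors above \<open>w\<close> that are strictly above in coordinate \<open>i\<close>;
  \<open>i = N + 1\<close> means no strictness requirement.\<close>

definition Cone :: "program \<Rightarrow> nat \<Rightarrow> nat list \<Rightarrow> nat \<Rightarrow> nat list \<Rightarrow> bool" where
  "Cone P N w i v \<longleftrightarrow> nth0 v 0 < length P \<and> (\<forall>j. j \<le> N \<longrightarrow> nth0 w j \<le> nth0 v j) \<and> (i \<le> N \<longrightarrow> nth0 w i < nth0 v i)"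

definition nx :: "nat \<Rightarrow> nat \<Rightarrow> nat" where "nx N i = (if i = N then 0 else Suc i)"

type_synonym pos = "nat \<times> nat list \<times> nat list \<times> nat list \<times> nat \<times> nat"
type_synonym rul = "nat \<times> nat list \<times> nat list"

text \<open>Positions \<open>(0, w, c, d, i, _)\<close>: the run from \<open>c\<close> reaches \<open>d\<close> and stays in the cone of \<open>w, i\<close> before.
  Positions \<open>(1, w, c, _, i, j)\<close>: from \<open>c\<close> on, the run stays above \<open>w\<close> while the value of \<open>w\<close> is attained
  \<open>j\<close> times, cyclically in the coordinates \<open>i, i + 1, \<dots>\<close>. If this is possible for all \<open>j\<close>, the run has a limit
  with value \<open>w\<close> (rule 2). The relation \<open>L\<close> supplies further limits (rule 3).\<close>

definition VG :: "program \<Rightarrow> nat \<Rightarrow> (nat list \<Rightarrow> nat \<Rightarrow> nat list \<Rightarrow> nat list \<Rightarrow> bool) \<Rightarrow> creal \<Rightarrow> pos \<Rightarrow> rul \<Rightarrow> bool" where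
  "VG P N L z a r \<longleftrightarrow> (case a of (t, w, c, d, i, j) \<Rightarrow> case r of (k, x, y) \<Rightarrow>
     t = 0 \<and> (k = 0 \<and> c = d \<or> k = 1 \<and> Cone P N w i c \<and> vstep P N z c x \<or>
        k = 2 \<and> length x = Suc N \<and> (\<forall>l. l \<le> N \<longrightarrow> nth0 w l \<le> nth0 x l) \<and> (i \<le> N \<longrightarrow> nth0 w i < nth0 x i) \<and>
          Cone P N x (Suc N) c \<or>
        k = 3 \<and> L w i c x) \<or>
     t \<noteq> 0 \<and> (j = 0 \<or> vstep P N z c x \<and> Cone P N w (Suc N) y \<and> nth0 y i = nth0 w i))"

text \<open>Rule 2 has infinitely many premises, one for each number \<open>j'\<close> of returns: a
  guessed limit vector of finite values is verified by attempts of every finite length.\<close>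

definition MG :: "nat \<Rightarrow> pos \<Rightarrow> rul \<Rightarrow> pos \<Rightarrow> bool" where
  "MG N a r p \<longleftrightarrow> (case a of (t, w, c, d, i, j) \<Rightarrow> case r of (k, x, y) \<Rightarrow>
     t = 0 \<and> (k \<noteq> 0 \<and> p = (0, w, x, d, i, 0) \<or> k = 2 \<and> (\<exists>j'. p = (1, x, c, [], 0, j'))) \<or>
     t \<noteq> 0 \<and> j \<noteq> 0 \<and> (p = (0, w, x, y, i, 0) \<or> p = (1, w, y, [], nx N i, j - 1)))"

definition GL :: "program \<Rightarrow> nat \<Rightarrow> (nat list \<Rightarrow> nat \<Rightarrow> nat list \<Rightarrow> nat list \<Rightarrow> bool) \<Rightarrow> creal \<Rightarrow>
    nat list \<Rightarrow> nat \<Rightarrow> nat list \<Rightarrow> nat list \<Rightarrow> bool" where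
  "GL P N L z w i c d \<longleftrightarrow> ind (VG P N L z) (MG N) (0, w, c, d, i, 0)"

definition QL :: "program \<Rightarrow> nat \<Rightarrow> (nat list \<Rightarrow> nat \<Rightarrow> nat list \<Rightarrow> nat list \<Rightarrow> bool) \<Rightarrow> creal \<Rightarrow>
    nat list \<Rightarrow> nat list \<Rightarrow> nat \<Rightarrow> nat \<Rightarrow> bool" where
  "QL P N L z w c i j \<longleftrightarrow> ind (VG P N L z) (MG N) (1, w, c, [], i, j)"

lemma GL_refl: "GL P N L z w i c c"
  unfolding GL_def by (rule ind.indI[of _ _ "(0, [], [])"]) (auto simp: VG_def MG_def)

lemma GL_step: "Cone P N w i c \<Longrightarrow> vstep P N z c x \<Longrightarrow> GL P N L z w i x d \<Longrightarrow> GL P N L z w i c d"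
  unfolding GL_def by (rule ind.indI[of _ _ "(1, x, [])"]) (auto simp: VG_def MG_def)

lemma GL_lim:
  "length x = Suc N \<Longrightarrow> (\<And>l. l \<le> N \<Longrightarrow> nth0 w l \<le> nth0 x l) \<Longrightarrow> (i \<le> N \<Longrightarrow> nth0 w i < nth0 x i) \<Longrightarrow>
   Cone P N x (Suc N) c \<Longrightarrow> (\<And>j. QL P N L z x c 0 j) \<Longrightarrow> GL P N L z w i x d \<Longrightarrow> GL P N L z w i c d"
  unfolding GL_def QL_def by (rule ind.indI[of _ _ "(2, x, [])"]) (auto simp: VG_def MG_def)

lemma GL_L: "L w i c x \<Longrightarrow> GL P N L z w i x d \<Longrightarrow> GL P N L z w i c d"
  unfolding GL_def by (rule ind.indI[of _ _ "(3, x, [])"]) (auto simp: VG_def MG_def)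

lemma QL_0: "QL P N L z w c i 0"
  unfolding QL_def by (rule ind.indI[of _ _ "(0, [], [])"]) (auto simp: VG_def MG_def)

text \<open>From \<open>x\<close> up to \<open>y\<close> the run is strictly above \<open>w\<close>
  in coordinate \<open>i\<close>, so \<open>y\<close> is the first return of this coordinate to its
  limit value. Returns are thereby unique, and attempts of different lengths cohere.\<close>

lemma QL_Suc: "vstep P N z c x \<Longrightarrow> Cone P N w (Suc N) y \<Longrightarrow> nth0 y i = nth0 w i \<Longrightarrow> GL P N L z w i x y \<Longrightarrow>
   QL P N L z w y (nx N i) j \<Longrightarrow> QL P N L z w c i (Suc j)"
  unfolding GL_def QL_def by (rule ind.indI[of _ _ "(0, x, y)"]) (auto simp: VG_def MG_def)

lemma GL_induct:
  assumes "GL P N L z w i c d"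
    and refl: "\<And>w i c. A w i c c"
    and step: "\<And>w i c x d. Cone P N w i c \<Longrightarrow> vstep P N z c x \<Longrightarrow> A w i x d \<Longrightarrow> A w i c d"
    and lim: "\<And>w i c x d. length x = Suc N \<Longrightarrow> \<forall>l\<le>N. nth0 w l \<le> nth0 x l \<Longrightarrow> (i \<le> N \<Longrightarrow> nth0 w i < nth0 x i) \<Longrightarrow>
      Cone P N x (Suc N) c \<Longrightarrow> \<forall>j. B x c 0 j \<Longrightarrow> A w i x d \<Longrightarrow> A w i c d"
    and L: "\<And>w i c x d. L w i c x \<Longrightarrow> A w i x d \<Longrightarrow> A w i c d"
    and Q0: "\<And>w c i. B w c i 0"
    and QS: "\<And>w c i j x y. vstep P N z c x \<Longrightarrow> Cone P N w (Suc N) y \<Longrightarrow> nth0 y i = nth0 w i \<Longrightarrow> A w i x y \<Longrightarrow>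
       B w y (nx N i) j \<Longrightarrow> B w c i (Suc j)"
  shows "A w i c d"
proof -
  have "ind (VG P N L z) (MG N) p \<Longrightarrow> \<forall>t w c d i j. p = (t, w, c, d, i, j) \<longrightarrow>
     (t = 0 \<longrightarrow> A w i c d) \<and> (t \<noteq> 0 \<longrightarrow> B w c i j)" for p
  proof (induction rule: ind.induct)
    case (indI p r)
    show ?case
    proof (intro allI impI conjI)
      fix t w c d i j assume p: "p = (t, w, c, d, i, j)" and t: "t = (0 :: nat)"
      obtain k x y where r: "r = (k, x, y)" by (cases r)
      have V: "k = 0 \<and> c = d \<or> k = 1 \<and> Cone P N w i c \<and> vstep P N z c x \<or>
        k = 2 \<and> length x = Suc N \<and> (\<forall>l. l \<le> N \<longrightarrow> nth0 w l \<le> nth0 x l) \<and> (i \<le> N \<longrightarrow> nth0 w i < nth0 x i) \<and>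
          Cone P N x (Suc N) c \<or> k = 3 \<and> L w i c x"
        using indI(1) unfolding p r t VG_def by simp
      have A: "A w i x d" if "k \<noteq> 0"
      proof -
        have "MG N p r (0, w, x, d, i, 0)" unfolding p r t MG_def using that by simp
        then show ?thesis using indI.IH by blast
      qed
      have B: "B x c 0 j'" if "k = 2" for j'
      proof -
        have "MG N p r (1, x, c, [], 0, j')" unfolding p r t MG_def using that by simp
        then show ?thesis using indI.IH by fastforce
      qed
      from V consider "k = 0" "c = d" | "k = 1" "Cone P N w i c" "vstep P N z c x"
        | "k = 2" "length x = Suc N" "\<forall>l\<le>N. nth0 w l \<le> nth0 x l" "i \<le> N \<longrightarrow> nth0 w i < nth0 x i" "Cone P N x (Suc N) c"
        | "k = 3" "L w i c x" by blast
      then show "A w i c d"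
      proof cases
        case 1 then show ?thesis using refl by simp
      next
        case 2 then show ?thesis using step A by simp
      next
        case 3
        show ?thesis by (rule lim[OF 3(2,3) _ 3(5) _ A]) (use 3 B in auto)
      next
        case 4 then show ?thesis using L A by simp
      qed
    next
      fix t w c d i j assume p: "p = (t, w, c, d, i, j)" and t: "t \<noteq> (0 :: nat)"
      obtain k x y where r: "r = (k, x, y)" by (cases r)
      show "B w c i j"
      proof (cases j)
        case 0
        then show ?thesis using Q0 by simp
      next
        case (Suc j')
        have V: "vstep P N z c x" "Cone P N w (Suc N) y" "nth0 y i = nth0 w i"
          using indI(1) t Suc unfolding p r VG_def by auto
        have "MG N p r (0, w, x, y, i, 0)" "MG N p r (1, w, y, [], nx N i, j')"
          unfolding p r MG_def using t Suc by auto
        then have "A w i x y" "B w y (nx N i) j'" using indI.IH by fastforce+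
        then show ?thesis unfolding Suc using QS V by blast
      qed
    qed
  qed
  then show ?thesis using assms(1) unfolding GL_def by blast
qed

text \<open>The limit of everything that is reachable by means of the relation \<open>G\<close>; a coordinate without cofinal value
  overflows and becomes \<open>0\<close>.\<close>

definition cofv :: "program \<Rightarrow> nat \<Rightarrow> (nat list \<Rightarrow> nat list \<Rightarrow> bool) \<Rightarrow> creal \<Rightarrow> nat list \<Rightarrow> nat \<Rightarrow> nat \<Rightarrow> bool" where
  "cofv P N G z c l x \<longleftrightarrow> (\<forall>d. G c d \<longrightarrow> (\<exists>d1 d'. vstep P N z d d1 \<and> G d1 d' \<and> nth0 d' l = x))"

definition Limr :: "program \<Rightarrow> nat \<Rightarrow> (nat list \<Rightarrow> nat list \<Rightarrow> bool) \<Rightarrow> creal \<Rightarrow> nat list \<Rightarrow> nat \<Rightarrow> nat list \<Rightarrow> nat list \<Rightarrow> bool" where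
  "Limr P N G z w i c u \<longleftrightarrow> (\<forall>d. G c d \<longrightarrow> Cone P N w i d) \<and> length u = Suc N \<and>
     (\<forall>l. l \<le> N \<longrightarrow> cofv P N G z c l (nth0 u l) \<and> (\<forall>x. x < nth0 u l \<longrightarrow> \<not> cofv P N G z c l x) \<or>
        nth0 u l = 0 \<and> (\<forall>x. \<not> cofv P N G z c l x))"

text \<open>\<open>Limr\<close> uses its relation \<open>G\<close> negatively, so \<open>G\<close>
  must be complete before its failures are read off; this is the reason for levels. The parameters
  \<open>[]\<close> and \<open>Suc N\<close> denote the trivial cone of all non-halting
  vectors.\<close>

fun LL :: "program \<Rightarrow> nat \<Rightarrow> nat \<Rightarrow> creal \<Rightarrow> nat list \<Rightarrow> nat \<Rightarrow> nat list \<Rightarrow> nat list \<Rightarrow> bool" where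
  "LL P N 0 z w i c u = False"
| "LL P N (Suc k) z w i c u \<longleftrightarrow> LL P N k z w i c u \<or> Limr P N (GL P N (LL P N k z) z [] (Suc N)) z w i c u"

abbreviation GG :: "program \<Rightarrow> nat \<Rightarrow> nat \<Rightarrow> creal \<Rightarrow> nat list \<Rightarrow> nat \<Rightarrow> nat list \<Rightarrow> nat list \<Rightarrow> bool" where
  "GG P N k z \<equiv> GL P N (LL P N k z) z"

lemma LL_iff: "LL P N k z w i c u \<longleftrightarrow> (\<exists>k'<k. Limr P N (GG P N k' z [] (Suc N)) z w i c u)"
  by (induction k) (auto simp: less_Suc_eq)

section \<open>Forcing for the run relations\<close>

lemma nice_bex: "(\<And>l. l < (n :: nat) \<Longrightarrow> nice (R l)) \<Longrightarrow> nice (\<lambda>x z. \<exists>l<n. R l x z)"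
proof (induction n)
  case 0
  then show ?case using nice_dec[OF dec_const[of False]] by simp
next
  case (Suc n)
  have "nice (\<lambda>x z. (\<exists>l<n. R l x z) \<or> R n x z)" by (rule nice_disj) (use Suc in auto)
  moreover have "(\<exists>l<n. R l x z) \<or> R n x z \<longleftrightarrow> (\<exists>l<Suc n. R l x z)" for x z
    by (auto simp: less_Suc_eq)
  ultimately show ?case by simp
qed

lemma nice_eq: "cpt f \<Longrightarrow> cpt g \<Longrightarrow> nice (\<lambda>x z. f x = g x)"
  by (rule nice_dec) (rule dec_eq)

lemma nice_less: "cpt f \<Longrightarrow> cpt g \<Longrightarrow> nice (\<lambda>x z. f x < (g x :: nat))"
  by (rule nice_dec) (rule dec_less)

lemma nice_le: "cpt f \<Longrightarrow> cpt g \<Longrightarrow> nice (\<lambda>x z. f x \<le> (g x :: nat))"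
  by (rule nice_dec) (rule dec_le)

lemmas nice_rules = nice_eq nice_less nice_le nice_not nice_conj nice_disj nice_imp nice_ex nice_all

lemma nice_newval:
  "cpt v \<Longrightarrow> cpt j \<Longrightarrow> cpt x \<Longrightarrow> nice (\<lambda>p z. newval i z (v p) (j p) (x p))"
  unfolding One_nat_def
  by (cases i; simp only: newval.simps; intro nice_rules nice_oracle cpt_nth0 cpt_Suc cpt_const; assumption)

lemma nice_vstep: "cpt f \<Longrightarrow> cpt g \<Longrightarrow> nice (\<lambda>x z. vstep P N z (f x) (g x))"
proof -
  have "nice (\<lambda>p z. vstep P N z (fst p) (snd p))"
    unfolding vstep_def
    by (intro nice_conj nice_bex nice_eq nice_all nice_imp nice_le nice_newval cpt_intros cpt_nth0 cpt_length)
  then show "cpt f \<Longrightarrow> cpt g \<Longrightarrow> nice (\<lambda>x z. vstep P N z (f x) (g x))"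
    using nice_sub[OF _ cpt_Pair, of "\<lambda>p z. vstep P N z (fst p) (snd p)" f g] by simp
qed

lemma nice_Cone: "cpt w \<Longrightarrow> cpt i \<Longrightarrow> cpt v \<Longrightarrow> nice (\<lambda>x z. Cone P N (w x) (i x) (v x))"
proof -
  have "nice (\<lambda>p z. Cone P N (fst p) (fst (snd p)) (snd (snd p)))"
    unfolding Cone_def by (intro nice_rules cpt_intros cpt_nth0)
  then show "cpt w \<Longrightarrow> cpt i \<Longrightarrow> cpt v \<Longrightarrow> nice (\<lambda>x z. Cone P N (w x) (i x) (v x))"
    using nice_sub[OF _ cpt_Pair[OF _ cpt_Pair], of "\<lambda>p z. Cone P N (fst p) (fst (snd p)) (snd (snd p))" w i v] by simp
qed

definition nice4 :: "(creal \<Rightarrow> nat list \<Rightarrow> nat \<Rightarrow> nat list \<Rightarrow> nat list \<Rightarrow> bool) \<Rightarrow> bool" where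
  "nice4 R \<longleftrightarrow> nice (\<lambda>p z. R z (fst p) (fst (snd p)) (fst (snd (snd p))) (snd (snd (snd p))))"

lemma nice4_sub: "nice4 R \<Longrightarrow> cpt f \<Longrightarrow> cpt g \<Longrightarrow> cpt h \<Longrightarrow> cpt k \<Longrightarrow> nice (\<lambda>x z. R z (f x) (g x) (h x) (k x))"
  unfolding nice4_def
  using nice_sub[OF _ cpt_Pair[OF _ cpt_Pair[OF _ cpt_Pair]],
    of "\<lambda>p z. R z (fst p) (fst (snd p)) (fst (snd (snd p))) (snd (snd (snd p)))" f g h k] by simp

lemma nice4_GL:
  assumes L: "nice4 L"
  shows "nice4 (\<lambda>z. GL P N (L z) z)"
proof -
  have cnx: "cpt f \<Longrightarrow> cpt (\<lambda>x. nx N (f x))" for f :: "'b::enc \<Rightarrow> nat"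
    unfolding nx_def by (intro cpt_if dec_eq cpt_intros)
  have "nice (\<lambda>a z. ind (VG P N (L z) z) (MG N) a)"
  proof (rule nice_ind)
    show "nice (\<lambda>p z. VG P N (L z) z (fst p) (snd p))"
      unfolding VG_def split_beta
      by (intro nice_rules nice_vstep nice_Cone nice4_sub[OF L] cpt_intros cpt_nth0 cpt_length)
    show "nice (\<lambda>p z. MG N (fst p) (fst (snd p)) (snd (snd p)))"
      unfolding MG_def split_beta
      by (intro nice_rules cpt_intros cnx)
  qed
  then show ?thesis
    unfolding nice4_def GL_def by (rule nice_sub) (intro cpt_intros)
qed

text \<open>A level adds one fixed point, covered by \<open>nice_ind\<close>, and first-order
  operations, so each fixed number of levels keeps forcing decidable.\<close>

lemma nice4_LL: "nice4 (\<lambda>z. LL P N k z)"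
proof (induction k)
  case 0
  show ?case unfolding nice4_def LL.simps by (rule nice_dec[OF dec_const])
next
  case (Suc k)
  note G = nice4_sub[OF nice4_GL[OF Suc]]
  show ?case
    unfolding nice4_def LL.simps Limr_def cofv_def
    by (intro nice_rules nice4_sub[OF Suc] G nice_Cone nice_vstep cpt_intros cpt_nth0 cpt_length)
qed

lemma nice4_GG: "nice4 (\<lambda>z. GG P N k z)"
  by (rule nice4_GL[OF nice4_LL])

subsection \<open>Analysis of a halting run\<close>

text \<open>A halting run reduced to what derivations see: vectors instead of configurations, with
  the last time \<open>e\<close> as the only halted one.\<close>

locale trun =
  fixes W :: "('a \<times> 'a) set" and v :: "'a \<Rightarrow> nat list" and e :: 'a
    and P :: program and N :: nat and z :: creal
  assumes wo: "Well_order W" and eF: "e \<in> Field W" and top: "\<And>a. a \<in> Field W \<Longrightarrow> (a, e) \<in> W"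
    and unhalted: "\<And>a. wlt W a e \<Longrightarrow> nth0 (v a) 0 < length P"
    and halted: "\<not> nth0 (v e) 0 < length P"
    and len_v: "\<And>a. length (v a) = Suc N"
    and succ: "\<And>b a. is_ipred W b a \<Longrightarrow> vstep P N z (v b) (v a)"
    and lim: "\<And>a l. wlt W b a \<Longrightarrow> \<not> (\<exists>b. is_ipred W b a) \<Longrightarrow> l \<le> N \<Longrightarrow>
       nth0 (v a) l = liminf0 W a (\<lambda>b. nth0 (v b) l)"
begin

abbreviation lt :: "'a \<Rightarrow> 'a \<Rightarrow> bool" (infix "\<sqsubset>" 50) where "a \<sqsubset> b \<equiv> wlt W a b"
abbreviation le :: "'a \<Rightarrow> 'a \<Rightarrow> bool" (infix "\<sqsubseteq>" 50) where "a \<sqsubseteq> b \<equiv> (a, b) \<in> W"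

lemma W_facts: "refl_on (Field W) W" "trans W" "antisym W" "total_on (Field W) W" "wf (W - Id)"
  using wo by (simp_all add: well_order_on_def linear_order_on_def partial_order_on_def preorder_on_def)

lemma le_refl: "a \<in> Field W \<Longrightarrow> a \<sqsubseteq> a"
  using W_facts(1) by (simp add: refl_on_def)

lemma le_trans: "a \<sqsubseteq> b \<Longrightarrow> b \<sqsubseteq> c \<Longrightarrow> a \<sqsubseteq> c"
  using transD[OF W_facts(2)] by blast

lemma le_antisym: "a \<sqsubseteq> b \<Longrightarrow> b \<sqsubseteq> a \<Longrightarrow> a = b"
  using antisymD[OF W_facts(3)] by blast

lemma lt_le: "a \<sqsubset> b \<Longrightarrow> a \<sqsubseteq> b"
  by (simp add: wlt_def)

lemma lt_F: "a \<sqsubset> b \<Longrightarrow> a \<in> Field W" "a \<sqsubset> b \<Longrightarrow> b \<in> Field W"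
  by (auto simp: wlt_def Field_def)

lemma le_F: "a \<sqsubseteq> b \<Longrightarrow> a \<in> Field W" "a \<sqsubseteq> b \<Longrightarrow> b \<in> Field W"
  by (auto simp: Field_def)

lemma le_lt_trans: "a \<sqsubseteq> b \<Longrightarrow> b \<sqsubset> c \<Longrightarrow> a \<sqsubset> c"
  unfolding wlt_def using le_trans le_antisym by blast

lemma lt_le_trans: "a \<sqsubset> b \<Longrightarrow> b \<sqsubseteq> c \<Longrightarrow> a \<sqsubset> c"
  unfolding wlt_def using le_trans le_antisym by blast

lemma lt_trans: "a \<sqsubset> b \<Longrightarrow> b \<sqsubset> c \<Longrightarrow> a \<sqsubset> c"
  using lt_le_trans lt_le by blast

lemma lt_irrefl: "\<not> a \<sqsubset> a"
  by (simp add: wlt_def)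

lemma not_lt_le: "a \<in> Field W \<Longrightarrow> b \<in> Field W \<Longrightarrow> \<not> a \<sqsubset> b \<Longrightarrow> b \<sqsubseteq> a"
  using W_facts(4) le_refl unfolding total_on_def wlt_def by metis

lemma lt_not_le: "a \<sqsubset> b \<Longrightarrow> \<not> b \<sqsubseteq> a"
  unfolding wlt_def using le_antisym by blast

lemma lt_induct: "(\<And>a. (\<And>b. b \<sqsubset> a \<Longrightarrow> Q b) \<Longrightarrow> Q a) \<Longrightarrow> Q a"
proof -
  assume *: "\<And>a. (\<And>b. b \<sqsubset> a \<Longrightarrow> Q b) \<Longrightarrow> Q a"
  show "Q a"
    by (induction a rule: wf_induct_rule[OF W_facts(5)]) (rule *, auto simp: wlt_def)
qed

lemma least:
  assumes "a \<in> A" "A \<subseteq> Field W"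
  obtains m where "m \<in> A" "\<And>b. b \<in> A \<Longrightarrow> m \<sqsubseteq> b"
proof -
  obtain m where m: "m \<in> A" "\<And>b. (b, m) \<in> W - Id \<Longrightarrow> b \<notin> A"
    by (rule wfE_min[OF W_facts(5) assms(1)]) blast
  have "m \<sqsubseteq> b" if "b \<in> A" for b
    by (rule not_lt_le) (use that m assms(2) in \<open>auto simp: wlt_def\<close>)
  then show ?thesis using m(1) that by blast
qed

lemma succ_ex:
  assumes "a \<sqsubset> b"
  obtains s where "is_ipred W a s" "s \<sqsubseteq> b" "a \<sqsubset> s" "\<And>x. a \<sqsubset> x \<Longrightarrow> s \<sqsubseteq> x"
proof -
  obtain s where s: "s \<in> {x. a \<sqsubset> x}" "\<And>x. x \<in> {x. a \<sqsubset> x} \<Longrightarrow> s \<sqsubseteq> x"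
    by (rule least[of b "{x. a \<sqsubset> x}"]) (use assms lt_F in auto)
  have "is_ipred W a s" unfolding is_ipred_def
  proof (intro conjI allI impI)
    show "a \<sqsubset> s" using s(1) by simp
    fix g assume g: "a \<sqsubseteq> g \<and> g \<sqsubseteq> s"
    show "g = a \<or> g = s"
    proof (rule ccontr)
      assume *: "\<not> (g = a \<or> g = s)"
      then have "a \<sqsubset> g" using g by (auto simp: wlt_def)
      then show False using s(2) g * le_antisym by blast
    qed
  qed
  then show ?thesis using that s assms by blast
qed

lemma ipred_lt: "is_ipred W b a \<Longrightarrow> x \<sqsubset> a \<Longrightarrow> x \<sqsubseteq> b"
proof -
  assume b: "is_ipred W b a" and x: "x \<sqsubset> a"
  show "x \<sqsubseteq> b"
  proof (rule not_lt_le)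
    show "b \<in> Field W" "x \<in> Field W" using b x lt_F unfolding is_ipred_def by auto
    show "\<not> b \<sqsubset> x"
    proof
      assume "b \<sqsubset> x"
      then have "x = b \<or> x = a" using b x lt_le unfolding is_ipred_def by blast
      then show False using \<open>b \<sqsubset> x\<close> x lt_irrefl by blast
    qed
  qed
qed

definition islim :: "'a \<Rightarrow> bool" where
  "islim a \<longleftrightarrow> (\<exists>b. b \<sqsubset> a) \<and> \<not> (\<exists>b. is_ipred W b a)"

lemma islim_F: "islim a \<Longrightarrow> a \<in> Field W"
  unfolding islim_def using lt_F by blast

lemma islim_succ:
  assumes "islim a" "b \<sqsubset> a"
  obtains s where "is_ipred W b s" "b \<sqsubset> s" "s \<sqsubset> a" "\<And>x. b \<sqsubset> x \<Longrightarrow> s \<sqsubseteq> x"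
proof -
  obtain s where s: "is_ipred W b s" "s \<sqsubseteq> a" "b \<sqsubset> s" "\<And>x. b \<sqsubset> x \<Longrightarrow> s \<sqsubseteq> x"
    by (rule succ_ex[OF assms(2)]) blast
  have "s \<noteq> a" using s(1) assms(1) unfolding islim_def by blast
  then show ?thesis using s that by (simp add: wlt_def)
qed

abbreviation f :: "nat \<Rightarrow> 'a \<Rightarrow> nat" where "f l b \<equiv> nth0 (v b) l"

abbreviation cof :: "'a \<Rightarrow> nat \<Rightarrow> nat \<Rightarrow> bool" where "cof a l k \<equiv> cofinal_val W a (f l) k"

lemma lim_val: "islim a \<Longrightarrow> l \<le> N \<Longrightarrow> f l a = liminf0 W a (f l)"
  unfolding islim_def using lim by blast

lemma max_lt:
  assumes "g \<sqsubset> a" "h \<sqsubset> a"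
  obtains m where "m \<sqsubset> a" "g \<sqsubseteq> m" "h \<sqsubseteq> m"
proof (cases "g \<sqsubset> h")
  case True
  then show ?thesis using that[of h] assms lt_le le_refl lt_F by blast
next
  case False
  then show ?thesis using that[of g] assms not_lt_le le_refl lt_F by blast
qed

text \<open>Finitely many values that are not cofinal can be left behind at one common time.\<close>

lemma eventually_ge:
  assumes "b \<sqsubset> a" "\<And>k. k < m \<Longrightarrow> \<not> cof a l k"
  shows "\<exists>g. g \<sqsubset> a \<and> (\<forall>b. g \<sqsubseteq> b \<longrightarrow> b \<sqsubset> a \<longrightarrow> m \<le> f l b)"
  using assms(2)
proof (induction m)
  case 0
  then show ?case using assms(1) by auto
next
  case (Suc m)
  then obtain g where g: "g \<sqsubset> a" "\<And>b. g \<sqsubseteq> b \<Longrightarrow> b \<sqsubset> a \<Longrightarrow> m \<le> f l b" by auto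
  have "\<not> cof a l m" using Suc.prems by blast
  then obtain h where h: "h \<sqsubset> a" "\<And>b. h \<sqsubseteq> b \<Longrightarrow> b \<sqsubset> a \<Longrightarrow> f l b \<noteq> m"
    unfolding cofinal_val_def by blast
  obtain k where k: "k \<sqsubset> a" "g \<sqsubseteq> k" "h \<sqsubseteq> k" by (rule max_lt[OF g(1) h(1)])
  have "Suc m \<le> f l b" if "k \<sqsubseteq> b" "b \<sqsubset> a" for b
    using g(2)[OF le_trans[OF k(2) that(1)] that(2)] h(2)[OF le_trans[OF k(3) that(1)] that(2)] by simp
  then show ?case using k(1) by blast
qed

definition ovf :: "'a \<Rightarrow> nat \<Rightarrow> bool" where
  "ovf a l \<longleftrightarrow> (\<forall>k. \<not> cof a l k)"

lemma lim_ovf: "islim a \<Longrightarrow> l \<le> N \<Longrightarrow> ovf a l \<Longrightarrow> f l a = 0"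
  by (simp only: lim_val) (simp add: liminf0_def ovf_def)

lemma lim_least: "\<not> ovf a l \<Longrightarrow> liminf0 W a (f l) = (LEAST k. cof a l k)"
  unfolding liminf0_def ovf_def by auto

lemma lim_fin:
  assumes "islim a" "l \<le> N" "\<not> ovf a l"
  shows "cof a l (f l a)" "\<And>k. k < f l a \<Longrightarrow> \<not> cof a l k"
proof -
  have eq: "f l a = (LEAST k. cof a l k)" using lim_val[OF assms(1,2)] lim_least[OF assms(3)] by simp
  have "\<exists>k. cof a l k" using assms(3) unfolding ovf_def by blast
  then show "cof a l (f l a)" unfolding eq by (rule LeastI_ex)
  show "\<not> cof a l k" if "k < f l a" for k using that unfolding eq by (rule not_less_Least)
qed

text \<open>\<open>pass k a\<close>: the overflows at and close below \<open>a\<close> are nested to depth at most \<open>k\<close>.\<close>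

fun pass :: "nat \<Rightarrow> 'a \<Rightarrow> bool" where
  "pass 0 a \<longleftrightarrow> (\<forall>l\<le>N. \<not> ovf a l)"
| "pass (Suc k) a \<longleftrightarrow> pass k a \<or> (\<exists>g. g \<sqsubset> a \<and> (\<forall>b. g \<sqsubset> b \<longrightarrow> b \<sqsubset> a \<longrightarrow> islim b \<longrightarrow> pass k b))"

lemma pass_mono: "pass k a \<Longrightarrow> k \<le> k' \<Longrightarrow> pass k' a"
proof (induction k')
  case (Suc k')
  then show ?case by (cases "k = Suc k'") auto
qed simp

lemma ne_emptyI: "x \<in> A \<Longrightarrow> A \<noteq> {}"
  by blast

text \<open>A coordinate that overflows at \<open>a\<close> is positive close below \<open>a\<close>, hence does not overflow there. So each
  further level consumes a coordinate.\<close>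

lemma not_pass_card:
  "islim a \<Longrightarrow> \<not> pass k a \<Longrightarrow> g \<sqsubset> a \<Longrightarrow>
    Suc k \<le> card {l. l \<le> N \<and> (\<exists>b. g \<sqsubset> b \<and> b \<sqsubseteq> a \<and> islim b \<and> ovf b l)}"
proof (induction k arbitrary: a g)
  case 0
  then obtain l where "l \<le> N" "ovf a l" by auto
  then have "l \<in> {l. l \<le> N \<and> (\<exists>b. g \<sqsubset> b \<and> b \<sqsubseteq> a \<and> islim b \<and> ovf b l)}" (is "_ \<in> ?S")
    using 0 le_refl[OF islim_F] by blast
  then have ne: "?S \<noteq> {}" by (rule ne_emptyI)
  have "finite ?S" by (rule finite_subset[of _ "{..N}"]) auto
  then have "0 < card ?S" using ne by (simp only: card_gt_0_iff) blast
  then show ?case by (rule Suc_leI)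
next
  case (Suc k)
  let ?S = "\<lambda>g a. {l. l \<le> N \<and> (\<exists>b. g \<sqsubset> b \<and> b \<sqsubseteq> a \<and> islim b \<and> ovf b l)}"
  have "\<not> pass 0 a" using Suc.prems(2) pass_mono by blast
  then obtain l where l: "l \<le> N" "ovf a l" by auto
  obtain h where h: "h \<sqsubset> a" "\<And>b. h \<sqsubseteq> b \<Longrightarrow> b \<sqsubset> a \<Longrightarrow> 1 \<le> f l b"
    using eventually_ge[OF Suc.prems(3), of 1 l] l(2) unfolding ovf_def by blast
  obtain m where m: "m \<sqsubset> a" "g \<sqsubseteq> m" "h \<sqsubseteq> m" by (rule max_lt[OF Suc.prems(3) h(1)])
  obtain b where b: "m \<sqsubset> b" "b \<sqsubset> a" "islim b" "\<not> pass k b"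
    using Suc.prems(2) m(1) by auto
  have IH: "Suc k \<le> card (?S m b)" by (rule Suc.IH[OF b(3,4,1)])
  have "l \<notin> ?S m b"
  proof
    assume "l \<in> ?S m b"
    then obtain c where c: "m \<sqsubset> c" "c \<sqsubseteq> b" "islim c" "ovf c l" by blast
    have "f l c = 0" using lim_ovf c l by blast
    moreover have "1 \<le> f l c"
      by (rule h(2)[OF le_trans[OF m(3) lt_le[OF c(1)]] le_lt_trans[OF c(2) b(2)]])
    ultimately show False by simp
  qed
  moreover have "insert l (?S m b) \<subseteq> ?S g a"
  proof -
    have "l \<in> ?S g a" using l Suc.prems(1,3) le_refl[OF islim_F[OF Suc.prems(1)]] by blast
    moreover have "?S m b \<subseteq> ?S g a"
      using le_lt_trans[OF m(2)] le_trans[OF _ lt_le[OF b(2)]] by blast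
    ultimately show ?thesis by blast
  qed
  ultimately have "Suc (card (?S m b)) \<le> card (?S g a)"
    using card_mono[of "?S g a" "insert l (?S m b)"] by simp
  then show ?case using IH by linarith
qed

lemma pass_all: "islim a \<Longrightarrow> pass (Suc N) a"
proof (rule ccontr)
  assume a: "islim a" "\<not> pass (Suc N) a"
  obtain g where g: "g \<sqsubset> a" using a(1) unfolding islim_def by blast
  have "card {l. l \<le> N \<and> (\<exists>b. g \<sqsubset> b \<and> b \<sqsubseteq> a \<and> islim b \<and> ovf b l)} \<le> card {..N}"
    by (rule card_mono) auto
  then show False using not_pass_card[OF a g] by simp
qed

section \<open>Every segment of the run has a derivation\<close>

abbreviation inC :: "nat list \<Rightarrow> nat \<Rightarrow> 'a \<Rightarrow> bool" where "inC w i a \<equiv> Cone P N w i (v a)"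

definition stays :: "nat list \<Rightarrow> nat \<Rightarrow> 'a \<Rightarrow> 'a \<Rightarrow> bool" where
  "stays w i a b \<longleftrightarrow> (\<forall>c. a \<sqsubseteq> c \<longrightarrow> c \<sqsubset> b \<longrightarrow> inC w i c)"

lemma stays_comb: "stays w i a b \<Longrightarrow> stays w i b c \<Longrightarrow> a \<in> Field W \<Longrightarrow> b \<in> Field W \<Longrightarrow> stays w i a c"
  unfolding stays_def using not_lt_le lt_F by blast

text \<open>The limits for which level \<open>k\<close> has a rule: without overflow the rule of
  guessed vectors applies; otherwise \<open>LL\<close> has to supply the limit from all times close
  below and for every cone that the run stays in.\<close>

definition drv :: "nat \<Rightarrow> 'a \<Rightarrow> bool" where
  "drv k a \<longleftrightarrow> pass 0 a \<or> (\<exists>g. g \<sqsubset> a \<and> (\<forall>c w i. g \<sqsubseteq> c \<longrightarrow> c \<sqsubset> a \<longrightarrow> stays w i c a \<longrightarrow> LL P N k z w i (v c) (v a)))"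

lemma Cone_coarsen:
  assumes "Cone P N x (Suc N) c" "\<forall>l\<le>N. nth0 w l \<le> nth0 x l" "i \<le> N \<Longrightarrow> nth0 w i < nth0 x i"
  shows "Cone P N w i c"
  using assms unfolding Cone_def by (meson le_trans order_trans order_less_le_trans)

lemma Cone_none: "Cone P N w i c \<Longrightarrow> Cone P N w (Suc N) c"
  unfolding Cone_def by simp

lemma limit_value_eq:
  assumes lim: "islim a" and len: "length x = Suc N" and g: "g \<sqsubset> a"
    and ge: "\<And>c l. g \<sqsubseteq> c \<Longrightarrow> c \<sqsubset> a \<Longrightarrow> l \<le> N \<Longrightarrow> nth0 x l \<le> f l c"
    and cf: "\<And>l. l \<le> N \<Longrightarrow> cof a l (nth0 x l)"
  shows "v a = x"
proof (rule vec_eqI[OF len_v len])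
  fix l assume l: "l \<le> N"
  have "(LEAST k. cof a l k) = nth0 x l"
  proof (rule Least_equality[where P = "cof a l"])
    show "cof a l (nth0 x l)" by (rule cf[OF l])
    fix k assume "cof a l k"
    then obtain c where "g \<sqsubseteq> c" "c \<sqsubset> a" "f l c = k" using g unfolding cofinal_val_def by blast
    then show "nth0 x l \<le> k" using ge l by blast
  qed
  moreover have "\<not> ovf a l" using cf[OF l] unfolding ovf_def by blast
  ultimately show "f l a = nth0 x l" using lim_val[OF lim l] lim_least by simp
qed

text \<open>Derivations are extended backwards from \<open>b\<close>: the least time from which on
  \<open>b\<close> is derivable can be neither a successor nor a limit beyond \<open>a\<close>. The
  outer induction on \<open>b\<close> supplies the derivations between consecutive returns below a
  limit.\<close>

lemma completeness:
  "a \<sqsubseteq> b \<Longrightarrow> stays w i a b \<Longrightarrow> (\<And>c. a \<sqsubset> c \<Longrightarrow> c \<sqsubseteq> b \<Longrightarrow> islim c \<Longrightarrow> drv k c) \<Longrightarrow> GG P N k z w i (v a) (v b)"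
proof (induction b arbitrary: a w i rule: lt_induct)
  case (1 b)
  note IH = 1(1) and ab = 1(2) and st = 1(3) and drv = 1(4)
  define A where "A = {d. a \<sqsubseteq> d \<and> d \<sqsubseteq> b \<and> (\<forall>c. d \<sqsubseteq> c \<longrightarrow> c \<sqsubseteq> b \<longrightarrow> GG P N k z w i (v c) (v b))}"
  have "b \<in> A" unfolding A_def using ab le_F le_refl le_antisym GL_refl by blast
  then obtain d where d: "d \<in> A" "\<And>x. x \<in> A \<Longrightarrow> d \<sqsubseteq> x"
    by (rule least) (auto simp: A_def le_F)
  have d1: "a \<sqsubseteq> d" "d \<sqsubseteq> b" and d2: "\<And>c. d \<sqsubseteq> c \<Longrightarrow> c \<sqsubseteq> b \<Longrightarrow> GG P N k z w i (v c) (v b)"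
    using d(1) unfolding A_def by blast+
  have dF: "d \<in> Field W" using d1 le_F by blast
  have Gd: "GG P N k z w i (v d) (v b)" using d2 d1(2) le_refl[OF dF] by blast
  have contra: False if g: "a \<sqsubseteq> g" "g \<sqsubset> d" and G: "\<And>c. g \<sqsubseteq> c \<Longrightarrow> c \<sqsubset> d \<Longrightarrow> GG P N k z w i (v c) (v b)" for g
  proof -
    have "g \<in> A" unfolding A_def
    proof (intro CollectI conjI allI impI)
      show "g \<sqsubseteq> b" using le_trans[OF lt_le[OF g(2)] d1(2)] .
      fix c assume c: "g \<sqsubseteq> c" "c \<sqsubseteq> b"
      show "GG P N k z w i (v c) (v b)"
      proof (cases "c \<sqsubset> d")
        case True
        then show ?thesis by (rule G[OF c(1)])
      next
        case False
        show ?thesis by (rule d2[OF not_lt_le[OF le_F(1)[OF c(2)] dF False] c(2)])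
      qed
    qed (rule g)
    then show False using d(2) lt_not_le[OF g(2)] by blast
  qed
  show ?case
  proof (cases "a = d")
    case True
    then show ?thesis using Gd by simp
  next
    case False
    then have ad: "a \<sqsubset> d" using d1 by (simp add: wlt_def)
    show ?thesis
    proof (cases "\<exists>g. is_ipred W g d")
      case True
      then obtain g where g: "is_ipred W g d" by blast
      have ag: "a \<sqsubseteq> g" using ipred_lt[OF g ad] .
      have gd: "g \<sqsubset> d" using g unfolding is_ipred_def by blast
      have "inC w i g" using st ag lt_le_trans[OF gd d1(2)] unfolding stays_def by blast
      then have Gg: "GG P N k z w i (v g) (v b)" using GL_step succ[OF g] Gd by blast
      have False
      proof (rule contra[OF ag gd])
        fix c assume "g \<sqsubseteq> c" "c \<sqsubset> d"
        then have "c = g" using ipred_lt[OF g] le_antisym by blast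
        then show "GG P N k z w i (v c) (v b)" using Gg by simp
      qed
      then show ?thesis ..
    next
      case False
      then have lim: "islim d" unfolding islim_def using ad by blast
      have cone: "inC w i c" if "a \<sqsubseteq> c" "c \<sqsubset> d" for c
        using st that lt_le_trans[OF _ d1(2)] unfolding stays_def by blast
      have "drv k d" using drv ad d1(2) lim by blast
      then consider "pass 0 d" | g where "g \<sqsubset> d"
        "\<And>c w i. g \<sqsubseteq> c \<Longrightarrow> c \<sqsubset> d \<Longrightarrow> stays w i c d \<Longrightarrow> LL P N k z w i (v c) (v d)"
        unfolding drv_def by blast
      then show ?thesis
      proof cases
        case 2
        obtain h where h: "h \<sqsubset> d" "a \<sqsubseteq> h" "g \<sqsubseteq> h" by (rule max_lt[OF ad 2(1)])
        have False
        proof (rule contra[OF h(2,1)])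
          fix c assume c: "h \<sqsubseteq> c" "c \<sqsubset> d"
          have "stays w i c d" unfolding stays_def using cone h(2) c(1) le_trans by blast
          then have "LL P N k z w i (v c) (v d)" using 2(2) h(3) c le_trans by blast
          then show "GG P N k z w i (v c) (v b)" using GL_L Gd by blast
        qed
        then show ?thesis ..
      next
        case 1
        have fin: "\<And>l. l \<le> N \<Longrightarrow> \<not> ovf d l" using 1 by simp
        \<comment> \<open>One coordinate at a time, a common \<open>g\<close> is found beyond which
          no coordinate falls below its limit value.\<close>
        have "\<exists>g. g \<sqsubset> d \<and> a \<sqsubseteq> g \<and> (\<forall>l c. l < n \<longrightarrow> g \<sqsubseteq> c \<longrightarrow> c \<sqsubset> d \<longrightarrow> f l d \<le> f l c)" if "n \<le> Suc N" for n
          using that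
        proof (induction n)
          case 0
          then show ?case using ad le_refl lt_F by blast
        next
          case (Suc n)
          then obtain g where g: "g \<sqsubset> d" "a \<sqsubseteq> g" "\<And>l c. l < n \<Longrightarrow> g \<sqsubseteq> c \<Longrightarrow> c \<sqsubset> d \<Longrightarrow> f l d \<le> f l c" by auto
          have n: "n \<le> N" using Suc.prems by simp
          obtain h where h: "h \<sqsubset> d" "\<And>c. h \<sqsubseteq> c \<Longrightarrow> c \<sqsubset> d \<Longrightarrow> f n d \<le> f n c"
            using eventually_ge[OF ad lim_fin(2)[OF lim n fin[OF n]]] by blast
          obtain m where m: "m \<sqsubset> d" "g \<sqsubseteq> m" "h \<sqsubseteq> m" by (rule max_lt[OF g(1) h(1)])
          have "f l d \<le> f l c" if "l < Suc n" "m \<sqsubseteq> c" "c \<sqsubset> d" for l c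
            using that g(3) h(2) m le_trans by (metis less_Suc_eq)
          then show ?case using m g(2) le_trans by blast
        qed
        then obtain g where g: "g \<sqsubset> d" "a \<sqsubseteq> g" "\<And>l c. l \<le> N \<Longrightarrow> g \<sqsubseteq> c \<Longrightarrow> c \<sqsubset> d \<Longrightarrow> f l d \<le> f l c"
          by (metis less_Suc_eq_le order_refl)
        have cf: "\<exists>c. h \<sqsubseteq> c \<and> c \<sqsubset> d \<and> f l c = f l d" if "l \<le> N" "h \<sqsubset> d" for l h
          using lim_fin(1)[OF lim that(1) fin[OF that(1)]] that(2) unfolding cofinal_val_def by blast
        have wle: "nth0 w l \<le> f l d" if l: "l \<le> N" for l
        proof -
          obtain c where c: "a \<sqsubseteq> c" "c \<sqsubset> d" "f l c = f l d" using cf[OF l ad] by blast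
          show ?thesis using cone[OF c(1,2)] l c(3) unfolding Cone_def by metis
        qed
        have wlt: "nth0 w i < f i d" if i: "i \<le> N"
        proof -
          obtain c where c: "a \<sqsubseteq> c" "c \<sqsubset> d" "f i c = f i d" using cf[OF i ad] by blast
          show ?thesis using cone[OF c(1,2)] i c(3) unfolding Cone_def by metis
        qed
        have cd: "inC (v d) (Suc N) c" if "g \<sqsubseteq> c" "c \<sqsubset> d" for c
        proof -
          have "c \<sqsubset> e" using lt_le_trans[OF that(2) top[OF dF]] .
          then show ?thesis using g(3) that unhalted unfolding Cone_def by simp
        qed
        have Q: "QL P N (LL P N k z) z (v d) (v c) l j" if "g \<sqsubseteq> c" "c \<sqsubset> d" "l \<le> N" for c l j
          using that
        proof (induction j arbitrary: c l)
          case 0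
          show ?case by (rule QL_0)
        next
          case (Suc j)
          obtain s where s: "is_ipred W c s" "c \<sqsubset> s" "s \<sqsubset> d" by (rule islim_succ[OF lim Suc.prems(2)]) blast
          have gs: "g \<sqsubseteq> s" using Suc.prems(1) s(2) le_trans lt_le by blast
          \<comment> \<open>Its least element is the first return of coordinate \<open>l\<close>; in
            between, the coordinate is strictly above its limit value.\<close>
          define B where "B = {x. s \<sqsubseteq> x \<and> x \<sqsubset> d \<and> f l x = f l d}"
          obtain x where "x \<in> B" unfolding B_def using cf[OF Suc.prems(3) s(3)] by blast
          then obtain h where h: "h \<in> B" "\<And>x. x \<in> B \<Longrightarrow> h \<sqsubseteq> x"
            by (rule least) (auto simp: B_def lt_F)
          have h1: "s \<sqsubseteq> h" "h \<sqsubset> d" "f l h = f l d" using h(1) unfolding B_def by blast+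
          have gh: "g \<sqsubseteq> h" using gs h1(1) le_trans by blast
          have "stays (v d) l s h" unfolding stays_def
          proof (intro allI impI)
            fix c assume c: "s \<sqsubseteq> c" "c \<sqsubset> h"
            have gc: "g \<sqsubseteq> c" "c \<sqsubset> d" using c gs h1(2) le_trans lt_trans by blast+
            have "c \<notin> B" using h(2) c(2) lt_not_le by blast
            then have "f l c \<noteq> f l d" using c(1) gc(2) unfolding B_def by blast
            then have "f l d < f l c" using g(3)[OF Suc.prems(3) gc] by simp
            then show "inC (v d) l c" using cd[OF gc] unfolding Cone_def by simp
          qed
          moreover have "drv k c" if "s \<sqsubset> c" "c \<sqsubseteq> h" "islim c" for c
          proof (rule drv[OF _ _ that(3)])
            show "a \<sqsubset> c" using g(2) gs that(1) le_lt_trans le_trans by blast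
            show "c \<sqsubseteq> b" using that(2) h1(2) d1(2) lt_le le_trans by blast
          qed
          ultimately have "GG P N k z (v d) l (v s) (v h)"
            using IH[OF lt_le_trans[OF h1(2) d1(2)] h1(1)] by blast
          then show ?case
            using QL_Suc[OF succ[OF s(1)] cd[OF gh h1(2)]] h1(3) Suc.IH[OF gh h1(2)] Suc.prems(3)
            unfolding nx_def by auto
        qed
        have False
        proof (rule contra[OF g(2,1)])
          fix c assume c: "g \<sqsubseteq> c" "c \<sqsubset> d"
          show "GG P N k z w i (v c) (v b)"
            by (rule GL_lim[OF len_v wle wlt cd[OF c] Q[OF c] Gd]) simp_all
        qed
        then show ?thesis ..
      qed
    qed
  qed
qed

end

lemma least_or_zero_unique:
  "K x \<and> (\<forall>u. u < x \<longrightarrow> \<not> K u) \<or> x = 0 \<and> (\<forall>u. \<not> K u) \<Longrightarrow>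
   K y \<and> (\<forall>u. u < y \<longrightarrow> \<not> K u) \<or> y = 0 \<and> (\<forall>u. \<not> K u) \<Longrightarrow> x = (y :: nat)"
  by (metis linorder_neqE_nat)

context trun
begin

lemma ex_least: "a \<in> A \<Longrightarrow> A \<subseteq> Field W \<Longrightarrow> \<exists>m\<in>A. \<forall>b\<in>A. m \<sqsubseteq> b"
  by (rule least, assumption+, rule bexI, rule ballI)

lemma stays_unhalted: "b \<in> Field W \<Longrightarrow> stays [] (Suc N) a b"
  unfolding stays_def Cone_def using unhalted lt_le_trans[OF _ top] by (simp add: nth0_eq)

lemma stays_refl: "stays w i a a"
  unfolding stays_def using lt_not_le by blast

lemma stays_head: "inC w i a \<Longrightarrow> is_ipred W a s \<Longrightarrow> stays w i s b \<Longrightarrow> stays w i a b"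
  unfolding stays_def
proof (intro allI impI)
  fix c assume a: "inC w i a" "is_ipred W a s" "\<forall>c. s \<sqsubseteq> c \<longrightarrow> c \<sqsubset> b \<longrightarrow> inC w i c" and c: "a \<sqsubseteq> c" "c \<sqsubset> b"
  show "inC w i c"
  proof (cases "a = c")
    case True
    then show ?thesis using a(1) by simp
  next
    case False
    have "s \<sqsubseteq> c"
    proof (rule not_lt_le)
      show "c \<in> Field W" "s \<in> Field W" using c(1) a(2) le_F(2) lt_F(2) unfolding is_ipred_def by blast+
      show "\<not> c \<sqsubset> s" using ipred_lt[OF a(2)] le_antisym[OF c(1)] False by blast
    qed
    then show ?thesis using a(3) c(2) by blast
  qed
qed

lemma succ_step:
  assumes "a \<in> Field W" "vstep P N z (v a) x"
  obtains s where "is_ipred W a s" "a \<sqsubset> s" "x = v s"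
proof -
  have "f 0 a < length P" using assms(2) unfolding vstep_def by auto
  then have "a \<noteq> e" using halted by auto
  then have "a \<sqsubset> e" using top[OF assms(1)] by (simp add: wlt_def)
  then obtain s where s: "is_ipred W a s" "a \<sqsubset> s" by (rule succ_ex) blast
  then show ?thesis using that vstep_unique[OF assms(2) succ[OF s(1)]] by blast
qed

section \<open>Derivations cannot leave the run\<close>

definition hit :: "'a set \<Rightarrow> nat list \<Rightarrow> nat \<Rightarrow> 'a \<Rightarrow> 'a \<Rightarrow> bool" where
  "hit J x i a b \<longleftrightarrow> b \<in> J \<and> a \<sqsubset> b \<and> (\<forall>c. a \<sqsubset> c \<longrightarrow> c \<sqsubset> b \<longrightarrow> inC x i c) \<and> inC x (Suc N) b \<and> f i b = nth0 x i"

lemma hit_unique: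
  assumes "hit J x i a b" "hit J x i a b'" "i \<le> N"
  shows "b = b'"
proof -
  have *: "\<not> b \<sqsubset> b'" if "hit J x i a b" "hit J x i a b'" for b b'
  proof
    assume "b \<sqsubset> b'"
    then have "inC x i b" using that unfolding hit_def by blast
    then show False using that(1) assms(3) unfolding hit_def Cone_def by auto
  qed
  have "b \<in> Field W" "b' \<in> Field W" using assms(1,2) lt_F unfolding hit_def by blast+
  then show ?thesis using *[OF assms(1,2)] *[OF assms(2,1)] not_lt_le le_antisym by blast
qed

fun chain :: "'a set \<Rightarrow> nat list \<Rightarrow> nat \<Rightarrow> nat \<Rightarrow> 'a \<Rightarrow> bool" where
  "chain J x i 0 a = True"
| "chain J x i (Suc j) a = (\<exists>b. hit J x i a b \<and> chain J x (nx N i) j b)"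

text \<open>As hits are unique, the chains of all finite lengths are initial parts of one infinite
  sequence.\<close>

lemma chain_seq:
  assumes "\<forall>j. chain J x 0 j a"
  shows "\<exists>b. b 0 = a \<and> (\<forall>n. hit J x (n mod Suc N) (b n) (b (Suc n)))"
proof -
  have step: "\<exists>b. (\<forall>j. chain J x (Suc n mod Suc N) j b) \<and> hit J x (n mod Suc N) a b"
    if c: "\<forall>j. chain J x (n mod Suc N) j a" for n a
  proof -
    have nx: "nx N (n mod Suc N) = Suc n mod Suc N" unfolding nx_def mod_Suc by simp
    have i: "n mod Suc N \<le> N" using mod_less_divisor[of "Suc N" n] by linarith
    have "chain J x (n mod Suc N) (Suc 0) a" using c by blast
    then obtain b where b: "hit J x (n mod Suc N) a b" by auto
    have "chain J x (Suc n mod Suc N) j b" for j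
    proof -
      have "chain J x (n mod Suc N) (Suc j) a" using c by blast
      then obtain b' where b': "hit J x (n mod Suc N) a b'" "chain J x (Suc n mod Suc N) j b'" using nx by auto
      then show ?thesis using hit_unique[OF b b'(1) i] by simp
    qed
    then show ?thesis using b by blast
  qed
  have "\<exists>b. \<forall>n. ((\<forall>j. chain J x (n mod Suc N) j (b n)) \<and> (n = 0 \<longrightarrow> b n = a)) \<and> hit J x (n mod Suc N) (b n) (b (Suc n))"
  proof (rule dependent_nat_choice)
    show "\<exists>y. (\<forall>j. chain J x (0 mod Suc N) j y) \<and> (0 = (0::nat) \<longrightarrow> y = a)" using assms by auto
    fix y n assume "(\<forall>j. chain J x (n mod Suc N) j y) \<and> (n = 0 \<longrightarrow> y = a)"
    then show "\<exists>b. ((\<forall>j. chain J x (Suc n mod Suc N) j b) \<and> (Suc n = 0 \<longrightarrow> b = a)) \<and> hit J x (n mod Suc N) y b"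
      using step by blast
  qed
  then show ?thesis by blast
qed

text \<open>A derivation can only follow the run: the times reached by it have a supremum in \<open>J\<close>, where the run
  takes the limit value.\<close>

lemma chain_limit:
  assumes a: "a \<in> J" and inCa: "inC x (Suc N) a" and len: "length x = Suc N" and ch: "\<forall>j. chain J x 0 j a"
    and Jconv: "\<And>a b c. a \<in> J \<Longrightarrow> b \<in> J \<Longrightarrow> a \<sqsubseteq> c \<Longrightarrow> c \<sqsubseteq> b \<Longrightarrow> c \<in> J"
    and JF: "J \<subseteq> Field W"
    and Jlim: "\<And>a x. a \<in> J \<Longrightarrow> \<forall>b\<in>J. a \<sqsubseteq> b \<longrightarrow> inC x (Suc N) b \<Longrightarrow>
       \<forall>l\<le>N. \<forall>c\<in>J. \<exists>b\<in>J. c \<sqsubseteq> b \<and> f l b = nth0 x l \<Longrightarrow> False"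
  shows "\<exists>y\<in>J. a \<sqsubset> y \<and> x = v y \<and> stays x (Suc N) a y"
proof -
  obtain b where b0: "b 0 = a" and hit: "\<And>n. hit J x (n mod Suc N) (b n) (b (Suc n))"
    using chain_seq[OF ch] by blast
  have inJ: "b n \<in> J" for n using hit a b0 unfolding hit_def by (cases n) auto
  have inc: "b n \<sqsubset> b (Suc n)" for n using hit unfolding hit_def by blast
  have mono: "b n \<sqsubseteq> b (n + m)" for n m
  proof (induction m)
    case 0
    then show ?case using inJ JF le_refl by auto
  next
    case (Suc m)
    then show ?case using le_trans lt_le[OF inc[of "n + m"]] by auto
  qed
  have cone: "a \<sqsubseteq> c \<Longrightarrow> c \<sqsubseteq> b n \<Longrightarrow> inC x (Suc N) c" for c n
  proof (induction n)
    case 0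
    then have "c = a" using b0 le_antisym by auto
    then show ?case using inCa by simp
  next
    case (Suc n)
    have F: "c \<in> Field W" "b n \<in> Field W" using Suc.prems(1) le_F inJ JF by blast+
    show ?case
    proof (cases "b n \<sqsubset> c")
      case False
      then show ?thesis using Suc not_lt_le[OF F(2,1)] by blast
    next
      case True
      show ?thesis
      proof (cases "c = b (Suc n)")
        case True
        then show ?thesis using hit[of n] unfolding hit_def by simp
      next
        case False
        then have "c \<sqsubset> b (Suc n)" using Suc.prems(2) by (simp add: wlt_def)
        then have "inC x (n mod Suc N) c" using True hit[of n] unfolding hit_def by blast
        then show ?thesis by (rule Cone_none)
      qed
    qed
  qed
  have val: "\<exists>m. b n \<sqsubseteq> b m \<and> f l (b m) = nth0 x l" if l: "l \<le> N" for n l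
  proof -
    \<comment> \<open>The coordinates are visited cyclically, so this index beyond \<open>n\<close>
      belongs to coordinate \<open>l\<close>.\<close>
    have "(n * Suc N + l) mod Suc N = l" using l by (simp add: mod_mult_self3 del: mult_Suc_right)
    moreover have "n \<le> n * Suc N + l" by simp
    ultimately obtain k where k: "k mod Suc N = l" "n \<le> k" by blast
    have "f l (b (Suc k)) = nth0 x l" using hit[of k] k(1) unfolding hit_def by simp
    moreover have "b n \<sqsubseteq> b (Suc k)" using mono[of n "Suc k - n"] k(2) by simp
    ultimately show ?thesis by blast
  qed
  \<comment> \<open>If the hits are bounded in \<open>J\<close>, their supremum is a limit at which
    the run takes the value \<open>x\<close>; if they are cofinal in \<open>J\<close>, the
    assumption \<open>Jlim\<close> is violated.\<close>
  show ?thesis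
  proof (cases "\<exists>y\<in>J. \<forall>n. b n \<sqsubset> y")
    case True
    then obtain y0 where y0: "y0 \<in> J" "\<forall>n. b n \<sqsubset> y0" by blast
    let ?B = "{y. \<forall>n. b n \<sqsubset> y}"
    have "y0 \<in> ?B" using y0 by simp
    then obtain y where y: "y \<in> ?B" "\<forall>u\<in>?B. y \<sqsubseteq> u"
      using ex_least[of y0 ?B] lt_F by blast
    have yb: "\<And>n. b n \<sqsubset> y" using y(1) by blast
    have ay: "a \<sqsubset> y" using yb[of 0] b0 by simp
    have yJ: "y \<in> J" using Jconv[OF a y0(1) lt_le[OF ay]] y(2) y0(2) by blast
    have below: "\<exists>n. c \<sqsubseteq> b n" if c: "c \<sqsubset> y" for c
    proof (rule ccontr)
      assume *: "\<nexists>n. c \<sqsubseteq> b n"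
      have "b n \<sqsubset> c" for n
        using * not_lt_le[of "b n" c] lt_F(1)[OF c] lt_F(1)[OF yb[of n]] by blast
      then have "y \<sqsubseteq> c" using y(2) by blast
      then show False using lt_not_le[OF c] by blast
    qed
    have lim: "islim y" unfolding islim_def
    proof (intro conjI notI)
      show "\<exists>b. b \<sqsubset> y" using ay by blast
      assume "\<exists>p. is_ipred W p y"
      then obtain p where p: "is_ipred W p y" by blast
      then have "p \<sqsubset> y" unfolding is_ipred_def by blast
      then obtain n where "p \<sqsubseteq> b n" using below by blast
      moreover have "b (Suc n) \<sqsubseteq> p" by (rule ipred_lt[OF p yb])
      ultimately show False using lt_not_le[OF inc[of n]] le_trans by blast
    qed
    have st: "stays x (Suc N) a y" unfolding stays_def using cone below by blast
    have "v y = x"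
    proof (rule limit_value_eq[OF lim len ay])
      show "nth0 x l \<le> f l c" if "a \<sqsubseteq> c" "c \<sqsubset> y" "l \<le> N" for c l
        using st that unfolding stays_def Cone_def by blast
      show "cof y l (nth0 x l)" if l: "l \<le> N" for l
        unfolding cofinal_val_def
      proof (intro allI impI)
        fix g assume "g \<sqsubset> y"
        then obtain n where n: "g \<sqsubseteq> b n" using below by blast
        obtain m where m: "b n \<sqsubseteq> b m" "f l (b m) = nth0 x l" using val[OF l] by blast
        show "\<exists>b. g \<sqsubseteq> b \<and> b \<sqsubset> y \<and> f l b = nth0 x l" using le_trans[OF n m(1)] yb m(2) by blast
      qed
    qed
    then show ?thesis using yJ ay st by blast
  next
    case False
    have above: "\<exists>n. y \<sqsubseteq> b n" if y: "y \<in> J" for y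
    proof -
      obtain n where "\<not> b n \<sqsubset> y" using False y by blast
      then have "y \<sqsubseteq> b n" using not_lt_le[of "b n" y] inJ JF y by blast
      then show ?thesis ..
    qed
    have False
    proof (rule Jlim[OF a])
      show "\<forall>b\<in>J. a \<sqsubseteq> b \<longrightarrow> inC x (Suc N) b" using cone above by blast
      show "\<forall>l\<le>N. \<forall>c\<in>J. \<exists>b\<in>J. c \<sqsubseteq> b \<and> f l b = nth0 x l"
      proof (intro allI impI ballI)
        fix l c assume l: "l \<le> N" and c: "c \<in> J"
        obtain n where n: "c \<sqsubseteq> b n" using above[OF c] by blast
        obtain m where m: "b n \<sqsubseteq> b m" "f l (b m) = nth0 x l" using val[OF l] by blast
        show "\<exists>b\<in>J. c \<sqsubseteq> b \<and> f l b = nth0 x l" using le_trans[OF n m(1)] inJ m(2) by blast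
      qed
    qed
    then show ?thesis ..
  qed
qed

text \<open>\<open>J\<close> is the part of the run that derivations of level \<open>k\<close> can
  see: either all times or the times close below a limit with overflow. \<open>Jlim\<close> excludes
  that the returns to a guessed vector are cofinal in \<open>J\<close>, where they would lead out of
  it.\<close>

lemma soundness:
  assumes JF: "J \<subseteq> Field W"
    and Jconv: "\<And>a b c. a \<in> J \<Longrightarrow> b \<in> J \<Longrightarrow> a \<sqsubseteq> c \<Longrightarrow> c \<sqsubseteq> b \<Longrightarrow> c \<in> J"
    and Jsucc: "\<And>a s. a \<in> J \<Longrightarrow> is_ipred W a s \<Longrightarrow> s \<in> J"
    and Jlim: "\<And>a x. a \<in> J \<Longrightarrow> \<forall>b\<in>J. a \<sqsubseteq> b \<longrightarrow> inC x (Suc N) b \<Longrightarrow>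
       \<forall>l\<le>N. \<forall>c\<in>J. \<exists>b\<in>J. c \<sqsubseteq> b \<and> f l b = nth0 x l \<Longrightarrow> False"
    and JL: "\<And>a w i u. a \<in> J \<Longrightarrow> LL P N k z w i (v a) u \<Longrightarrow> \<exists>b\<in>J. a \<sqsubset> b \<and> u = v b \<and> stays w i a b"
    and G: "GG P N k z w i (v a) d" and a: "a \<in> J"
  shows "\<exists>b\<in>J. a \<sqsubseteq> b \<and> d = v b \<and> stays w i a b"
proof -
  define A where "A w i c d \<longleftrightarrow> (\<forall>a\<in>J. c = v a \<longrightarrow> (\<exists>b\<in>J. a \<sqsubseteq> b \<and> d = v b \<and> stays w i a b))" for w i c d
  define B where "B x c i j \<longleftrightarrow> (\<forall>a\<in>J. c = v a \<longrightarrow> chain J x i j a)" for x c i j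
  have comb: "\<exists>b\<in>J. a \<sqsubseteq> b \<and> d = v b \<and> stays w i a b"
    if *: "a \<in> J" "y \<in> J" "a \<sqsubset> y" "stays w i a y" "A w i (v y) d" for a y w i d
  proof -
    obtain b where b: "b \<in> J" "y \<sqsubseteq> b" "d = v b" "stays w i y b" using *(2,5) unfolding A_def by blast
    have "stays w i a b" by (rule stays_comb[OF *(4) b(4)]) (use * JF in auto)
    then show ?thesis using b le_trans[OF lt_le[OF *(3)] b(2)] by blast
  qed
  have "A w i (v a) d"
  proof (rule GL_induct[OF G, where A = A and B = B])
    show "A w i c c" for w i c
      unfolding A_def using stays_refl le_refl JF by blast
  next
    fix w i c x d assume c: "Cone P N w i c" and x: "vstep P N z c x" and A: "A w i x d"
    show "A w i c d" unfolding A_def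
    proof (intro ballI impI)
      fix a assume a: "a \<in> J" "c = v a"
      obtain s where s: "is_ipred W a s" "a \<sqsubset> s" "x = v s"
        by (rule succ_step[of a x]) (use a JF x in auto)
      have "stays w i a s" by (rule stays_head[OF _ s(1) stays_refl]) (use c a in simp)
      then show "\<exists>b\<in>J. a \<sqsubseteq> b \<and> d = v b \<and> stays w i a b"
        using comb[OF a(1) Jsucc[OF a(1) s(1)] s(2)] A s(3) by simp
    qed
  next
    fix w i c x d assume len: "length x = Suc N" and le: "\<forall>l\<le>N. nth0 w l \<le> nth0 x l"
      and lt: "i \<le> N \<Longrightarrow> nth0 w i < nth0 x i" and cone: "Cone P N x (Suc N) c"
      and B: "\<forall>j. B x c 0 j" and A: "A w i x d"
    show "A w i c d" unfolding A_def
    proof (intro ballI impI)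
      fix a assume a: "a \<in> J" "c = v a"
      have "\<exists>y\<in>J. a \<sqsubset> y \<and> x = v y \<and> stays x (Suc N) a y"
        by (rule chain_limit[OF a(1) _ len _ Jconv JF Jlim]) (use cone B a in \<open>auto simp: B_def\<close>)
      then obtain y where y: "y \<in> J" "a \<sqsubset> y" "x = v y" "stays x (Suc N) a y" by blast
      have "stays w i a y" using y(4) Cone_coarsen[OF _ le lt] unfolding stays_def by blast
      then show "\<exists>b\<in>J. a \<sqsubseteq> b \<and> d = v b \<and> stays w i a b"
        using comb[OF a(1) y(1,2)] A y(3) by simp
    qed
  next
    fix w i c x d assume L: "LL P N k z w i c x" and A: "A w i x d"
    show "A w i c d" unfolding A_def
    proof (intro ballI impI)
      fix a assume a: "a \<in> J" "c = v a"
      obtain y where y: "y \<in> J" "a \<sqsubset> y" "x = v y" "stays w i a y" using JL[OF a(1)] L a(2) by blast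
      then show "\<exists>b\<in>J. a \<sqsubseteq> b \<and> d = v b \<and> stays w i a b"
        using comb[OF a(1) y(1,2,4)] A by simp
    qed
  next
    show "B w c i 0" for w c i unfolding B_def by simp
  next
    fix w c i j x y assume x: "vstep P N z c x" and cone: "Cone P N w (Suc N) y" and y: "nth0 y i = nth0 w i"
      and A: "A w i x y" and B: "B w y (nx N i) j"
    show "B w c i (Suc j)" unfolding B_def
    proof (intro ballI impI)
      fix a assume a: "a \<in> J" "c = v a"
      obtain s where s: "is_ipred W a s" "a \<sqsubset> s" "x = v s"
        by (rule succ_step[of a x]) (use a JF x in auto)
      obtain b where b: "b \<in> J" "s \<sqsubseteq> b" "y = v b" "stays w i s b"
        using A Jsucc[OF a(1) s(1)] s(3) unfolding A_def by blast
      have "inC w i c" if c: "a \<sqsubset> c" "c \<sqsubset> b" for c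
      proof -
        have "s \<sqsubseteq> c"
        proof (rule not_lt_le)
          show "c \<in> Field W" "s \<in> Field W" using c s(2) lt_F by blast+
          show "\<not> c \<sqsubset> s" using ipred_lt[OF s(1), of c] lt_not_le[OF c(1)] by blast
        qed
        then show ?thesis using b(4) c(2) unfolding stays_def by blast
      qed
      then have "hit J w i a b" unfolding hit_def using b cone y lt_le_trans[OF s(2) b(2)] by auto
      then show "chain J w i (Suc j) a" using B b(1,3) unfolding B_def by auto
    qed
  qed
  then show ?thesis using a unfolding A_def by blast
qed

text \<open>If \<open>G\<close> describes the run below the limit \<open>y\<close>, then \<open>Limr\<close> computes the limit.\<close>

lemma Limr_iff:
  assumes lim: "islim y" and ay: "a \<sqsubset> y"
    and G: "\<And>c d. a \<sqsubseteq> c \<Longrightarrow> c \<sqsubset> y \<Longrightarrow> G (v c) d \<longleftrightarrow> (\<exists>b. c \<sqsubseteq> b \<and> b \<sqsubset> y \<and> d = v b)"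
  shows "Limr P N G z w i (v a) u \<longleftrightarrow> stays w i a y \<and> u = v y"
proof -
  have aF: "a \<sqsubseteq> a" using le_refl lt_F(1)[OF ay] .
  have Ga: "G (v a) d \<longleftrightarrow> (\<exists>b. a \<sqsubseteq> b \<and> b \<sqsubset> y \<and> d = v b)" for d by (rule G[OF aF ay])
  have cofv: "cofv P N G z (v a) l x \<longleftrightarrow> cof y l x" for l x
  proof
    assume c: "cofv P N G z (v a) l x"
    show "cof y l x" unfolding cofinal_val_def
    proof (intro allI impI)
      fix g assume g: "g \<sqsubset> y"
      obtain m where m: "m \<sqsubset> y" "g \<sqsubseteq> m" "a \<sqsubseteq> m" by (rule max_lt[OF g ay])
      have "G (v a) (v m)" by (rule iffD2[OF Ga]) (use m in blast)
      then obtain d1 d' where d: "vstep P N z (v m) d1" "G d1 d'" "nth0 d' l = x" using c unfolding cofv_def by blast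
      obtain s where s: "is_ipred W m s" "m \<sqsubset> s" "d1 = v s" by (rule succ_step[OF lt_F(1)[OF m(1)] d(1)])
      obtain s' where s': "is_ipred W m s'" "m \<sqsubset> s'" "s' \<sqsubset> y" "\<And>x. m \<sqsubset> x \<Longrightarrow> s' \<sqsubseteq> x"
        by (rule islim_succ[OF lim m(1)]) blast
      have "s \<sqsubset> y"
      proof -
        have "s' = m \<or> s' = s" using s(1) s'(4)[OF s(2)] lt_le[OF s'(2)] unfolding is_ipred_def by blast
        then show ?thesis using s'(2,3) lt_irrefl by blast
      qed
      have "a \<sqsubseteq> s" using le_trans[OF m(3) lt_le[OF s(2)]] .
      have "G (v s) d'" using d(2) s(3) by simp
      then have "\<exists>b. s \<sqsubseteq> b \<and> b \<sqsubset> y \<and> d' = v b" by (rule iffD1[OF G[OF \<open>a \<sqsubseteq> s\<close> \<open>s \<sqsubset> y\<close>]])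
      then obtain b where b: "s \<sqsubseteq> b" "b \<sqsubset> y" "d' = v b" by blast
      then show "\<exists>b. g \<sqsubseteq> b \<and> b \<sqsubset> y \<and> f l b = x"
        using d(3) le_trans[OF m(2) le_trans[OF lt_le[OF s(2)] b(1)]] by blast
    qed
  next
    assume c: "cof y l x"
    show "cofv P N G z (v a) l x" unfolding cofv_def
    proof (intro allI impI)
      fix d assume "G (v a) d"
      then obtain b where b: "a \<sqsubseteq> b" "b \<sqsubset> y" "d = v b" using Ga by blast
      obtain s where s: "is_ipred W b s" "b \<sqsubset> s" "s \<sqsubset> y" by (rule islim_succ[OF lim b(2)]) blast
      obtain b' where b': "s \<sqsubseteq> b'" "b' \<sqsubset> y" "f l b' = x" using c s(3) unfolding cofinal_val_def by blast
      have "a \<sqsubseteq> s" using le_trans[OF b(1) lt_le[OF s(2)]] .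
      then have "G (v s) (v b')" by (rule iffD2[OF G[OF _ s(3)]]) (use b' in blast)
      then show "\<exists>d1 d'. vstep P N z d d1 \<and> G d1 d' \<and> nth0 d' l = x" using succ[OF s(1)] b(3) b'(3) by blast
    qed
  qed
  have st: "(\<forall>d. G (v a) d \<longrightarrow> Cone P N w i d) \<longleftrightarrow> stays w i a y"
    unfolding stays_def by (auto simp: Ga)
  have key: "cof y l (f l y) \<and> (\<forall>x. x < f l y \<longrightarrow> \<not> cof y l x) \<or> f l y = 0 \<and> (\<forall>x. \<not> cof y l x)" if l: "l \<le> N" for l
  proof (cases "ovf y l")
    case True
    then show ?thesis using lim_ovf[OF lim l] unfolding ovf_def by blast
  next
    case False
    then show ?thesis using lim_fin[OF lim l] by blast
  qed
  show ?thesis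
  proof
    assume L: "Limr P N G z w i (v a) u"
    have "u = v y"
    proof (rule vec_eqI[OF _ len_v])
      show "length u = Suc N" using L unfolding Limr_def by blast
      show "nth0 u l = f l y" if "l \<le> N" for l
        by (rule least_or_zero_unique[of "cof y l", OF _ key[OF that]])
          (use L that in \<open>simp only: Limr_def cofv\<close>)
    qed
    then show "stays w i a y \<and> u = v y" using L st unfolding Limr_def by blast
  next
    assume "stays w i a y \<and> u = v y"
    then show "Limr P N G z w i (v a) u" unfolding Limr_def using st key len_v by (simp add: cofv)
  qed
qed

text \<open>The obstacle for level \<open>k\<close> is a limit \<open>y\<close> that is not
  \<open>pass k\<close> while all limits close below it are: derivations that start there reach
  exactly the times before \<open>y\<close>. Then \<open>Limr\<close> of this level computes the
  vector at \<open>y\<close>.\<close>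

definition correct :: "nat \<Rightarrow> bool" where
  "correct k \<longleftrightarrow> (\<forall>y g. islim y \<longrightarrow> \<not> pass k y \<longrightarrow> g \<sqsubset> y \<longrightarrow> (\<forall>b. g \<sqsubset> b \<longrightarrow> b \<sqsubset> y \<longrightarrow> islim b \<longrightarrow> pass k b) \<longrightarrow>
     (\<forall>c w i d. g \<sqsubseteq> c \<longrightarrow> c \<sqsubset> y \<longrightarrow>
        (GG P N k z w i (v c) d \<longleftrightarrow> (\<exists>b. c \<sqsubseteq> b \<and> b \<sqsubset> y \<and> d = v b \<and> stays w i c b))))"

lemma correctD:
  assumes "correct k" "islim y" "\<not> pass k y" "g \<sqsubset> y" "\<forall>b. g \<sqsubset> b \<longrightarrow> b \<sqsubset> y \<longrightarrow> islim b \<longrightarrow> pass k b"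
    "g \<sqsubseteq> c" "c \<sqsubset> y"
  shows "GG P N k z w i (v c) d \<longleftrightarrow> (\<exists>b. c \<sqsubseteq> b \<and> b \<sqsubset> y \<and> d = v b \<and> stays w i c b)"
  using assms unfolding correct_def by blast

lemma correct_Limr:
  assumes "correct k" "islim y" "\<not> pass k y" "g \<sqsubset> y" "\<forall>b. g \<sqsubset> b \<longrightarrow> b \<sqsubset> y \<longrightarrow> islim b \<longrightarrow> pass k b"
    "g \<sqsubseteq> c" "c \<sqsubset> y"
  shows "Limr P N (GG P N k z [] (Suc N)) z w i (v c) u \<longleftrightarrow> stays w i c y \<and> u = v y"
proof (rule Limr_iff[OF assms(2,7)])
  fix c' d assume c': "c \<sqsubseteq> c'" "c' \<sqsubset> y"
  have "stays [] (Suc N) c' b" if "b \<sqsubset> y" for b using stays_unhalted[OF lt_F(1)[OF that]] .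
  then show "GG P N k z [] (Suc N) (v c') d \<longleftrightarrow> (\<exists>b. c' \<sqsubseteq> b \<and> b \<sqsubset> y \<and> d = v b)"
    by (subst correctD[OF assms(1-5) le_trans[OF assms(6) c'(1)] c'(2)]) blast
qed

text \<open>If all limits above \<open>a\<close> were \<open>pass k\<close>, level \<open>k\<close>
  would reach the halting time \<open>e\<close>, whereas \<open>Limr\<close> confines all reachable
  vectors to a cone and so to unhalted ones. Hence a first obstacle exists, and
  \<open>correct\<close> applies to it.\<close>

lemma Limr_next:
  assumes corr: "correct k" and D: "\<And>y. islim y \<Longrightarrow> pass k y \<Longrightarrow> drv k y" and a: "a \<in> Field W"
    and L: "Limr P N (GG P N k z [] (Suc N)) z w i (v a) u"
  shows "\<exists>y. a \<sqsubset> y \<and> islim y \<and> \<not> pass k y \<and> (\<forall>b. a \<sqsubset> b \<longrightarrow> b \<sqsubset> y \<longrightarrow> islim b \<longrightarrow> pass k b) \<and>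
    u = v y \<and> stays w i a y"
proof -
  let ?A = "{y. a \<sqsubset> y \<and> islim y \<and> \<not> pass k y}"
  have "\<exists>y. y \<in> ?A"
  proof (rule ccontr)
    assume *: "\<nexists>y. y \<in> ?A"
    have "GG P N k z [] (Suc N) (v a) (v e)"
      by (rule completeness[OF top[OF a] stays_unhalted[OF eF]]) (use * D in blast)
    then have "Cone P N w i (v e)" using L unfolding Limr_def by blast
    then show False using halted unfolding Cone_def by blast
  qed
  then obtain y0 where "y0 \<in> ?A" ..
  then obtain y where y: "y \<in> ?A" "\<forall>u\<in>?A. y \<sqsubseteq> u"
    using ex_least[of y0 ?A] lt_F by blast
  have y1: "a \<sqsubset> y" "islim y" "\<not> pass k y" using y(1) by blast+
  have p: "\<forall>b. a \<sqsubset> b \<longrightarrow> b \<sqsubset> y \<longrightarrow> islim b \<longrightarrow> pass k b" using y(2) lt_not_le by blast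
  have "stays w i a y \<and> u = v y"
    using correct_Limr[OF corr y1(2,3,1) p le_refl[OF a] y1(1)] L by blast
  then show ?thesis using y1 p by blast
qed

lemma LL_mono: "LL P N k z w i c u \<Longrightarrow> k \<le> k' \<Longrightarrow> LL P N k' z w i c u"
  unfolding LL_iff[of P N k] LL_iff[of P N k'] by (meson less_le_trans)

text \<open>The two claims feed each other: correctness of smaller levels makes \<open>Limr\<close>
  supply the limits that are \<open>pass k\<close>, and with these limits the derivations of level
  \<open>k\<close> follow the run up to their own obstacle.\<close>

lemma correct_drv: "correct k \<and> (\<forall>y. islim y \<longrightarrow> pass k y \<longrightarrow> drv k y)"
proof (induction k rule: less_induct)
  case (less k)
  have D: "drv k y" if y: "islim y" "pass k y" for y
  proof (cases k)
    case 0
    then show ?thesis using y unfolding drv_def by simp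
  next
    case (Suc k')
    have IH: "correct k'" "\<And>y. islim y \<Longrightarrow> pass k' y \<Longrightarrow> drv k' y" using less[of k'] Suc by auto
    show ?thesis
    proof (cases "pass k' y")
      case True
      then have "drv k' y" using IH(2) y(1) by blast
      then show ?thesis unfolding drv_def using LL_mono[of k' _ _ _ _ k] Suc by (meson lessI less_imp_le)
    next
      case False
      then obtain g where g: "g \<sqsubset> y" "\<forall>b. g \<sqsubset> b \<longrightarrow> b \<sqsubset> y \<longrightarrow> islim b \<longrightarrow> pass k' b" using y(2) Suc by auto
      have "LL P N k z w i (v c) (v y)" if c: "g \<sqsubseteq> c" "c \<sqsubset> y" "stays w i c y" for c w i
      proof -
        have "Limr P N (GG P N k' z [] (Suc N)) z w i (v c) (v y)"
          using correct_Limr[OF IH(1) y(1) False g c(1,2)] c(3) by blast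
        then show ?thesis unfolding Suc LL.simps by blast
      qed
      then show ?thesis unfolding drv_def using g(1) by blast
    qed
  qed
  have "correct k" unfolding correct_def
  proof (intro allI impI)
    fix y g c w i d
    assume y: "islim y" "\<not> pass k y" and g: "g \<sqsubset> y" and p: "\<forall>b. g \<sqsubset> b \<longrightarrow> b \<sqsubset> y \<longrightarrow> islim b \<longrightarrow> pass k b"
      and c: "g \<sqsubseteq> c" "c \<sqsubset> y"
    let ?J = "{b. g \<sqsubseteq> b \<and> b \<sqsubset> y}"
    show "GG P N k z w i (v c) d \<longleftrightarrow> (\<exists>b. c \<sqsubseteq> b \<and> b \<sqsubset> y \<and> d = v b \<and> stays w i c b)"
    proof
      assume G: "GG P N k z w i (v c) d"
      have "\<exists>b\<in>?J. c \<sqsubseteq> b \<and> d = v b \<and> stays w i c b"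
      proof (rule soundness[OF _ _ _ _ _ G])
        show "?J \<subseteq> Field W" using lt_F by blast
        show "b \<in> ?J" if "a \<in> ?J" "a' \<in> ?J" "a \<sqsubseteq> b" "b \<sqsubseteq> a'" for a a' b
          using that le_trans[of g a b] le_lt_trans[of b a' y] by blast
        show "s \<in> ?J" if a: "a \<in> ?J" "is_ipred W a s" for a s
        proof -
          have "a \<sqsubset> s" using a(2) unfolding is_ipred_def by blast
          obtain s' where s': "is_ipred W a s'" "a \<sqsubset> s'" "s' \<sqsubset> y" "\<And>x. a \<sqsubset> x \<Longrightarrow> s' \<sqsubseteq> x"
            by (rule islim_succ[OF y(1), of a]) (use a in blast)+
          have "s' = a \<or> s' = s" using a(2) s'(4)[OF \<open>a \<sqsubset> s\<close>] lt_le[OF s'(2)] unfolding is_ipred_def by blast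
          then show ?thesis using s'(2,3) lt_irrefl a(1) le_trans[of g a s] lt_le[OF \<open>a \<sqsubset> s\<close>] by blast
        qed
        show False if "a \<in> ?J" "\<forall>b\<in>?J. a \<sqsubseteq> b \<longrightarrow> inC x (Suc N) b"
          "\<forall>l\<le>N. \<forall>c\<in>?J. \<exists>b\<in>?J. c \<sqsubseteq> b \<and> f l b = nth0 x l" for a x
        proof -
          \<comment> \<open>If every coordinate returned cofinally below \<open>y\<close>, there
            would be no overflow at \<open>y\<close>.\<close>
          have "cof y l (nth0 x l)" if l: "l \<le> N" for l
            unfolding cofinal_val_def
          proof (intro allI impI)
            fix h assume h: "h \<sqsubset> y"
            obtain m where m: "m \<sqsubset> y" "g \<sqsubseteq> m" "h \<sqsubseteq> m" by (rule max_lt[OF g h])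
            then have "m \<in> ?J" by blast
            then obtain b where "b \<in> ?J" "m \<sqsubseteq> b" "f l b = nth0 x l"
              using \<open>\<forall>l\<le>N. \<forall>c\<in>?J. \<exists>b\<in>?J. c \<sqsubseteq> b \<and> f l b = nth0 x l\<close> l by blast
            then show "\<exists>b. h \<sqsubseteq> b \<and> b \<sqsubset> y \<and> f l b = nth0 x l" using le_trans[OF m(3)] by blast
          qed
          then have "pass 0 y" unfolding pass.simps ovf_def by blast
          then show False using y(2) pass_mono by blast
        qed
        show "\<exists>b\<in>?J. a \<sqsubset> b \<and> u = v b \<and> stays w i a b" if a: "a \<in> ?J" and L: "LL P N k z w i (v a) u" for a w i u
        proof -
          obtain k' where k': "k' < k" "Limr P N (GG P N k' z [] (Suc N)) z w i (v a) u"
            using L unfolding LL_iff[of P N k] by blast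
          have IH: "correct k'" "\<And>y. islim y \<Longrightarrow> pass k' y \<Longrightarrow> drv k' y" using less[OF k'(1)] by auto
          have ay: "a \<sqsubset> y" and aF: "a \<in> Field W" using a lt_F by blast+
          obtain x where x: "a \<sqsubset> x" "islim x" "\<not> pass k' x" "\<forall>b. a \<sqsubset> b \<longrightarrow> b \<sqsubset> x \<longrightarrow> islim b \<longrightarrow> pass k' b"
            "u = v x" "stays w i a x"
            using Limr_next[OF IH aF k'(2)] by blast
          \<comment> \<open>Since \<open>y\<close> is not \<open>pass (Suc k')\<close>, some limit
            between \<open>a\<close> and \<open>y\<close> is not \<open>pass k'\<close>; so the
            limit \<open>x\<close> supplied by level \<open>k'\<close> still comes before
            \<open>y\<close>.\<close>
          have "\<not> pass (Suc k') y" using y(2) pass_mono k'(1) Suc_leI by blast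
          then obtain b where b: "a \<sqsubset> b" "b \<sqsubset> y" "islim b" "\<not> pass k' b" using ay by auto
          have "x \<sqsubseteq> b" by (rule not_lt_le) (use b x lt_F in blast)+
          then have "x \<sqsubset> y" using b(2) le_lt_trans by blast
          then have "x \<in> ?J" using a le_trans[of g a x] lt_le[OF x(1)] by blast
          then show ?thesis using x(1,5,6) by blast
        qed
        show "c \<in> ?J" using c by blast
      qed
      then show "\<exists>b. c \<sqsubseteq> b \<and> b \<sqsubset> y \<and> d = v b \<and> stays w i c b" by blast
    next
      assume "\<exists>b. c \<sqsubseteq> b \<and> b \<sqsubset> y \<and> d = v b \<and> stays w i c b"
      then obtain b where b: "c \<sqsubseteq> b" "b \<sqsubset> y" "d = v b" "stays w i c b" by blast
      show "GG P N k z w i (v c) d" unfolding b(3)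
      proof (rule completeness[OF b(1,4)])
        fix x assume x: "c \<sqsubset> x" "x \<sqsubseteq> b" "islim x"
        then have "pass k x" using p le_lt_trans[OF c(1)] le_lt_trans[OF _ b(2)] by blast
        then show "drv k x" using D x(3) by blast
      qed
    qed
  qed
  then show ?case using D by blast
qed

text \<open>Every limit is \<open>pass (Suc N)\<close>, so this level follows the run to its end.
  For soundness the interval is the whole run, whose last vector is halted and lies in no
  cone.\<close>

theorem GG_halting:
  assumes "\<And>a. a \<in> Field W \<Longrightarrow> (b0, a) \<in> W"
  shows "GG P N (Suc N) z [] (Suc N) (v b0) (v e)"
    and "GG P N (Suc N) z [] (Suc N) (v b0) d \<Longrightarrow> \<not> nth0 d 0 < length P \<Longrightarrow> d = v e"
proof -
  have D: "islim y \<Longrightarrow> drv k y" if "Suc N \<le> k" for y k using correct_drv[of k] pass_all pass_mono that by blast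
  show "GG P N (Suc N) z [] (Suc N) (v b0) (v e)"
    by (rule completeness[OF assms[OF eF] stays_unhalted[OF eF] D]) simp_all
  assume G: "GG P N (Suc N) z [] (Suc N) (v b0) d" and h: "\<not> nth0 d 0 < length P"
  have b0: "b0 \<in> Field W" using assms[OF eF] le_F by blast
  have "\<exists>b\<in>Field W. b0 \<sqsubseteq> b \<and> d = v b \<and> stays [] (Suc N) b0 b"
  proof (rule soundness[OF _ _ _ _ _ G b0])
    show "b \<in> Field W" if "a \<sqsubseteq> b" for a b using that le_F by blast
    show "s \<in> Field W" if "is_ipred W a s" for a s using that lt_F unfolding is_ipred_def by blast
    show False if "a \<in> Field W" "\<forall>b\<in>Field W. a \<sqsubseteq> b \<longrightarrow> inC x (Suc N) b" for a x
      using that eF top halted unfolding Cone_def by blast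
    show "\<exists>b\<in>Field W. a \<sqsubset> b \<and> u = v b \<and> stays w i a b" if a: "a \<in> Field W" and L: "LL P N (Suc N) z w i (v a) u" for a w i u
    proof -
      obtain k' where k': "k' < Suc N" "Limr P N (GG P N k' z [] (Suc N)) z w i (v a) u"
        using L unfolding LL_iff[of P N "Suc N"] by blast
      have IH: "correct k'" "\<And>y. islim y \<Longrightarrow> pass k' y \<Longrightarrow> drv k' y" using correct_drv[of k'] by auto
      obtain x where "a \<sqsubset> x" "u = v x" "stays w i a x" using Limr_next[OF IH a k'(2)] by blast
      then show ?thesis using lt_F by blast
    qed
  qed simp
  then obtain b where b: "b \<in> Field W" "d = v b" by blast
  have "\<not> b \<sqsubset> e" using unhalted b h by blast
  then have "b = e" using top[OF b(1)] by (simp add: wlt_def)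
  then show "d = v e" using b by simp
qed

end

subsection \<open>There is no universal test\<close>

abbreviation init :: "nat \<Rightarrow> nat list" where "init N \<equiv> vec N (0, \<lambda>_. 0)"

text \<open>Coordinate \<open>1\<close> is the output register \<open>0\<close>; it is present
  because \<open>N\<close> is positive.\<close>

lemma halts_GG:
  assumes P: "\<And>r. r \<in> set P \<Longrightarrow> rbound r \<le> N" and N: "1 \<le> N" and h: "halts_with P z i"
  shows "\<exists>d. GG P N (Suc N) z [] (Suc N) (init N) d \<and> length P \<le> nth0 d 0 \<and> nth0 d 1 = i"
    and "GG P N (Suc N) z [] (Suc N) (init N) d \<Longrightarrow> length P \<le> nth0 d 0 \<Longrightarrow> nth0 d 1 = i"
proof -
  obtain W :: "(nat set \<times> nat set) set" and c e where run: "itrm_run W c P z" and e: "e \<in> Field W"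
    "\<forall>a\<in>Field W. (a, e) \<in> W" "length P \<le> fst (c e)" "snd (c e) 0 = i"
    using h unfolding halts_with_def by blast
  define v where "v a = vec N (c a)" for a
  have wo: "Well_order W" using run unfolding itrm_run_def by blast
  have tot: "total_on (Field W) W" and anti: "antisym W" and wf: "wf (W - Id)" and rfl: "refl_on (Field W) W"
    using wo by (simp_all add: well_order_on_def linear_order_on_def partial_order_on_def preorder_on_def)
  have nb: "\<not> (\<forall>b\<in>Field W. (a, b) \<in> W)" if "wlt W b a" for a b
  proof
    assume "\<forall>b\<in>Field W. (a, b) \<in> W"
    then have "(a, b) \<in> W" using that by (auto simp: wlt_def Field_def)
    then show False using that antisymD[OF anti] unfolding wlt_def by blast
  qed
  have eqs: "c a = (if \<exists>b. is_ipred W b a then step P z (c (THE b. is_ipred W b a)) else limit_config W a c)"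
    if b: "wlt W b a" for a b
  proof -
    have "a \<in> Field W" using b by (auto simp: wlt_def Field_def)
    then have "if (\<forall>b\<in>Field W. (a, b) \<in> W) then c a = (0, \<lambda>_. 0)
         else if (\<exists>b. is_ipred W b a) then c a = step P z (c (THE b. is_ipred W b a))
         else c a = limit_config W a c" using run unfolding itrm_run_def by blast
    then show ?thesis using nb[OF b] by (simp split: if_splits)
  qed
  have the: "(THE b. is_ipred W b a) = b" if b: "is_ipred W b a" for a b
  proof (rule the_equality)
    show "is_ipred W b a" by (rule b)
    fix b' assume b': "is_ipred W b' a"
    have F: "b \<in> Field W" "b' \<in> Field W" using b b' unfolding is_ipred_def wlt_def Field_def by auto
    show "b' = b"
    proof (rule ccontr)
      assume "b' \<noteq> b"
      then have "(b, b') \<in> W \<or> (b', b) \<in> W" using tot F unfolding total_on_def by blast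
      then show False using b b' \<open>b' \<noteq> b\<close> unfolding is_ipred_def wlt_def by blast
    qed
  qed
  have unh: "fst (c b) < length P" if "wlt W b a" for a b
    using run that unfolding itrm_run_def wlt_def Field_def by blast
  interpret trun W v e P N z
  proof
    show "Well_order W" by (rule wo)
    show "e \<in> Field W" by (rule e)
    show "(a, e) \<in> W" if "a \<in> Field W" for a using e(2) that by blast
    show "nth0 (v a) 0 < length P" if "wlt W a e" for a using unh[OF that] by (simp add: v_def nth0_vec)
    show "\<not> nth0 (v e) 0 < length P" using e(3) by (simp add: v_def nth0_vec)
    show "length (v a) = Suc N" for a by (simp add: v_def length_vec)
    show "vstep P N z (v b) (v a)" if b: "is_ipred W b a" for a b
    proof -
      have w: "wlt W b a" using b unfolding is_ipred_def by blast
      have "c a = step P z (c b)" using eqs[OF w] the[OF b] b by auto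
      then show ?thesis unfolding v_def using vstep_vec[OF P unh[OF w]] by simp
    qed
    show "nth0 (v a) l = liminf0 W a (\<lambda>b. nth0 (v b) l)"
      if b: "wlt W b a" and n: "\<not> (\<exists>b. is_ipred W b a)" and l: "l \<le> N" for a b l
    proof -
      have "c a = limit_config W a c" using eqs[OF b] n by simp
      then show ?thesis using l by (simp add: v_def nth0_vec limit_config_def)
    qed
  qed
  obtain b0 where b0: "b0 \<in> Field W" "\<forall>b. (b, b0) \<in> W - Id \<longrightarrow> b \<notin> Field W"
    using wfE_min[OF wf e(1)] by metis
  have bot: "(b0, a) \<in> W" if a: "a \<in> Field W" for a
  proof (rule not_lt_le[OF a b0(1)])
    show "\<not> wlt W a b0" using b0(2) a by (auto simp: wlt_def)
  qed
  have "c b0 = (0, \<lambda>_. 0)" using run b0(1) bot unfolding itrm_run_def by auto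
  then have vb: "v b0 = init N" by (simp add: v_def)
  have ve: "length P \<le> nth0 (v e) 0" "nth0 (v e) 1 = i" using e(3,4) N by (simp_all add: v_def nth0_vec)
  show "\<exists>d. GG P N (Suc N) z [] (Suc N) (init N) d \<and> length P \<le> nth0 d 0 \<and> nth0 d 1 = i"
    using GG_halting(1)[OF bot] ve unfolding vb by blast
  show "nth0 d 1 = i" if "GG P N (Suc N) z [] (Suc N) (init N) d" "length P \<le> nth0 d 0"
  proof -
    have "d = v e" by (rule GG_halting(2)[OF bot]) (use that vb in simp_all)
    then show ?thesis using ve by simp
  qed
qed

lemma rbound_ex: "\<exists>N\<ge>1. \<forall>r\<in>set P. rbound r \<le> N"
proof (intro exI conjI ballI)
  show "1 \<le> Suc (sum_list (map rbound P))" by simp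
  show "rbound r \<le> Suc (sum_list (map rbound P))" if "r \<in> set P" for r
    using member_le_sum_list[of "rbound r" "map rbound P"] that by simp
qed

text \<open>Two halting runs may live on different well-orders. Instead of constructing an
  isomorphism, both are compared with the relation \<open>GG\<close>, which mentions
  neither.\<close>

lemma halts_with_unique:
  assumes "halts_with P z i" "halts_with P z j"
  shows "i = j"
proof -
  obtain N where N: "1 \<le> N" "\<And>r. r \<in> set P \<Longrightarrow> rbound r \<le> N" using rbound_ex by blast
  obtain d where "GG P N (Suc N) z [] (Suc N) (init N) d" "length P \<le> nth0 d 0" "nth0 d 1 = i"
    using halts_GG(1)[OF N(2,1) assms(1)] by blast
  then show ?thesis using halts_GG(2)[OF N(2,1) assms(2)] by blast
qed

instance instr :: countable
  by countable_datatype

lemma meager_decidable_union: "meager (\<Union> {X :: creal set. meager X \<and> itrm_decidable X})"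
proof (rule meager_UN)
  have "{X :: creal set. meager X \<and> itrm_decidable X} \<subseteq> range (\<lambda>P. {z. halts_with P z 1})"
  proof
    fix X :: "creal set" assume "X \<in> {X. meager X \<and> itrm_decidable X}"
    then obtain P where P: "\<And>z. z \<in> X \<Longrightarrow> halts_with P z 1" "\<And>z. z \<notin> X \<Longrightarrow> halts_with P z 0"
      unfolding itrm_decidable_def by blast
    have "z \<in> X" if "halts_with P z 1" for z using halts_with_unique[OF that P(2)] by auto
    then have "X = {z. halts_with P z 1}" using P(1) by blast
    then show "X \<in> range (\<lambda>P. {z. halts_with P z 1})" by blast
  qed
  then show "countable {X :: creal set. meager X \<and> itrm_decidable X}"
    by (rule countable_subset) simp
qed simp

lemma C_halts:
  assumes "C f"
  shows "\<exists>P. \<forall>z. halts_with P z (f z 0)"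
proof -
  obtain c where c: "\<And>z \<sigma>. wps z 0 c (\<lambda>\<tau>. \<tau> 0 = f z (\<sigma> 0)) \<sigma>" using assms unfolding C_def by blast
  have "halts_with (cmp c 0) z (f z 0)" for z
  proof -
    have "code_at (cmp c 0) 0 (cmp c 0)" unfolding code_at_def by (rule exI[of _ "[]"]) simp
    then obtain \<tau> where \<tau>: "\<tau> 0 = f z 0" "ex (cmp c 0) z 0 c (\<lambda>_. 0) (fr 0 (\<lambda>_. 0)) \<tau>"
      by (rule wpsE[OF c[of z "\<lambda>_. 0"]]) blast
    then obtain V where "run (cmp c 0) z (0, \<lambda>_. 0) V (csz c, \<tau>)" unfolding ex_def by auto
    then have "halts_with (cmp c 0) z (snd (csz c, \<tau>) 0)" by (rule run_halts_with) (simp add: length_cmp)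
    then show ?thesis using \<tau>(1) by simp
  qed
  then show ?thesis by blast
qed

text \<open>\<open>?d\<close> is the characteristic function of disagreement between the oracle and
  the decidable real \<open>x\<close>, and a search through a limit decides whether they ever
  disagree.\<close>

lemma decidable_singleton:
  assumes "dec x"
  shows "itrm_decidable {x}"
proof -
  let ?d = "\<lambda>z k. if of_bool (x (psnd k)) = (0 :: nat) then of_bool (z (psnd k)) else if of_bool (z (psnd k)) = (0 :: nat) then 1 else (0 :: nat)"
  have cx: "C (\<lambda>z k. of_bool (x k))" using assms unfolding dec_def by simp
  have cp: "C ?d"
    by (intro C_if C_comp[OF cx] C_comp[OF C_oracle] C_const C_psnd C_id)
  let ?f = "\<lambda>z n. if (if \<exists>m. ?d z (prod_encode (n, m)) \<noteq> 0 then Suc (LEAST m. ?d z (prod_encode (n, m)) \<noteq> 0) else 0) = 0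
    then 1 else (0 :: nat)"
  have "C ?f" by (rule C_if[OF C_search[OF cp] C_const C_const])
  then obtain P where P: "\<And>z. halts_with P z (?f z 0)" using C_halts[of ?f] by blast
  have "?f z 0 = of_bool (z = x)" for z
    by (auto simp: fun_eq_iff)
  then have "halts_with P z (of_bool (z = x))" for z using P[of z] by simp
  then show ?thesis unfolding itrm_decidable_def
    by (metis of_bool_eq singleton_iff)
qed

theorem mainTheorem2:
  shows "\<not> itrm_decidable (\<Union> {X :: creal set. meager X \<and> itrm_decidable X})"
proof
  let ?U = "\<Union> {X :: creal set. meager X \<and> itrm_decidable X}"
  assume "itrm_decidable ?U"
  then obtain P where P: "\<And>z. z \<in> ?U \<Longrightarrow> halts_with P z 1" "\<And>z. z \<notin> ?U \<Longrightarrow> halts_with P z 0"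
    unfolding itrm_decidable_def by blast
  obtain N where N: "1 \<le> N" "\<And>r. r \<in> set P \<Longrightarrow> rbound r \<le> N" using rbound_ex by blast
  define R where "R a z \<longleftrightarrow> (\<exists>d. GG P N (Suc N) z [] (Suc N) (init N) d \<and> length P \<le> nth0 d 0 \<and> nth0 d 1 = 0)"
    for a :: nat and z
  have "nice R" unfolding R_def
    by (intro nice_rules nice4_sub[OF nice4_GG] cpt_intros cpt_nth0)
  then have "nice (\<lambda>a z. \<not> R a z)" by (rule nice_not)
  then obtain F and A :: "nat \<times> nat \<Rightarrow> bool" where "dec A"
    and FA: "\<forall>z. gen A z \<longrightarrow> (\<forall>a. \<not> R a z \<longleftrightarrow> (\<exists>m. F (a, pre z m)))" unfolding nice_def by blast
  obtain x where x: "dec x" "gen A x" using decidable_generic[OF \<open>dec A\<close>] by blast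
  have "meager {x}" unfolding meager_def by (rule exI[of _ "\<lambda>_. {x}"]) (simp add: nowhere_dense_singleton)
  then have "x \<in> ?U" using decidable_singleton[OF x(1)] by blast
  \<comment> \<open>On oracle \<open>x\<close> the program outputs \<open>1\<close>, so every halted
    vector derived from the initial one has output \<open>1\<close>.\<close>
  then have "\<not> R 0 x" unfolding R_def using halts_GG(2)[OF N(2,1) P(1)] by fastforce
  then obtain m where m: "F (0, pre x m)" using FA x(2) by blast
  obtain z n where z: "pre z n = pre x m" "gen A z" "z \<notin> ?U"
    using generic_avoiding_meager[OF meager_decidable_union, of "pre x m" A] by blast
  have "\<not> R 0 z" using FA z(2) m unfolding z(1)[symmetric] by blast
  moreover have "R 0 z" unfolding R_def using halts_GG(1)[OF N(2,1) P(2)[OF z(3)]] .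
  ultimately show False by blast
qed

end
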